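(* Let $X$ be a smooth projective toric variety over $\mathbb{C}$ embedded as $X\subset\mathbb{P}(T_{\mathbf v})$, let $F\in T_{\mathbf v}$ and let $r=\underline{\mathbf{rk}}_X(F)$ be the $X$-border rank of $F$. Let $\mathcal K\subset\mathrm{Pic}(X)$ be the semigroup of nef classes with minimal generating set $\{\mathbf c_1,\dots,\mathbf c_l\}$. Suppose that there exists $\mathbf u\in\mathcal K$ such that \[ \mathrm{HF}(S/\mathrm{Ann}(F),\mathbf u)=\mathrm{HF}(S/\mathrm{Ann}(F),\mathbf u+\mathbf c_1+\cdots+\mathbf c_l)=r. \] If there exists a $B$-saturated ideal $I\in\underline{\mathrm{VSP}}(F,r)$, then $\underline{\mathrm{VSP}}(F,r)=\{I\}$.
   Context: $X$ is a smooth projective toric variety over $\mathbb{C}$ with $\mathrm{Pic}(X)\cong\mathbb{Z}^s$. $S=\mathbb{C}[y_0,\dots,y_n]$ is its Cox ring, graded by $\mathrm{Pic}(X)$, with irrelevant ideal $B$. The graded dual ring is $T=\bigoplus_{D\in \mathrm{Pic}(X)}H^0(\mathcal O_X(D))^*\cong \mathbb{C}[x_0,\dots,x_n]$, on which $S$ acts by differentiation ($y_i\circ x_j=\delta_{ij}$). $\mathbf v$ is the class of a fixed ample line bundle, giving the embedding $X\subset\mathbb{P}(T_{\mathbf v})$. The $X$-border rank $\underline{\mathbf{rk}}_X(F)$ of $0\neq F\in T_{\mathbf v}$ is the least $r$ with $[F]\in\sigma_r(X)$, the $r$-th secant variety (closure of the union of linear spans of $r$ points of $X$). $\mathrm{Ann}(F)=\{\psi\in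 S:\psi\circ F=0\}$. For a homogeneous ideal $I\subset S$: $\mathrm{HF}(S/I,\mathbf u)=\dim_{\mathbb C}(S/I)_{\mathbf u}$, and $I$ is $B$-saturated if $I=(I:B^\infty)$. $h_{r,X}(\mathbf u)=\min\{r,\dim_{\mathbb C}S_{\mathbf u}\}$. $\mathrm{Hilb}^{h_{r,X}}_S$ is the Haiman–Sturmfels multigraded Hilbert scheme of homogeneous ideals $I\subset S$ with $\mathrm{HF}(S/I,\cdot)=h_{r,X}$; $\mathrm{Slip}_{r,X}$ is its irreducible component which is the closure of the locus of $B$-saturated ideals of $r$ distinct points of $X$ with Hilbert function $h_{r,X}$. $\underline{\mathrm{VSP}}(F,r)=\{J\in \mathrm{Slip}_{r,X}: J\subset \mathrm{Ann}(F)\}$. The semigroup $\mathcal K\subset\mathrm{Pic}(X)\cong\mathbb{Z}^s$ consists of the classes of nef line bundles on $X$; a minimal generating set $\{\mathbf c_1,\dots,\mathbf c_l\}$ of it, $\mathcal K=\mathbb{N}\mathbf c_1+\cdots+\mathbb{N}\mathbf c_l$, is fixed. *)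

theory Defs
  imports "HOL-Analysis.Analysis" "HOL-Library.Poly_Mapping"
begin

section \<open>Polynomials\<close>

text \<open>Polynomials over the complex numbers in variables indexed by a type; exponents are
  finitely supported functions. The Cox ring \<open>S\<close> and its graded dual \<open>T\<close> both live in
  the type of polynomials with variables indexed by the finite type of rays of the fan.\<close>

type_synonym 'k cpoly = "('k \<Rightarrow>\<^sub>0 nat) \<Rightarrow>\<^sub>0 complex"

abbreviation lookup :: "('a \<Rightarrow>\<^sub>0 'b::zero) \<Rightarrow> 'a \<Rightarrow> 'b"
  where "lookup \<equiv> Poly_Mapping.lookup"

abbreviation keys :: "('a \<Rightarrow>\<^sub>0 'b::zero) \<Rightarrow> 'a set"
  where "keys \<equiv> Poly_Mapping.keys"

definition var :: "'k \<Rightarrow> 'k cpoly"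
  where "var i = Poly_Mapping.single (Poly_Mapping.single i 1) 1"

definition const :: "complex \<Rightarrow> 'k cpoly"
  where "const c = Poly_Mapping.single 0 c"

definition eval_poly :: "'k cpoly \<Rightarrow> ('k \<Rightarrow> complex) \<Rightarrow> complex"
  where "eval_poly p x =
    (\<Sum>a\<in>keys p. lookup p a * (\<Prod>i\<in>keys a. x i ^ lookup a i))"

lemma const_add: "const (a + b) = const a + const b"
  by (simp add: const_def single_add)

lemma const_mult: "const (a * b) = const a * const b"
  by (simp add: const_def mult_single)

lemma const_1: "const 1 = 1"
  by (simp add: const_def)

global_interpretation cvec: vector_space "\<lambda>c (p :: 'k cpoly). const c * p"
  defines cvec_span = "cvec.span" and cvec_dependent = "cvec.dependent"
    and cvec_subspace = "cvec.subspace" and cvec_dim = "cvec.dim"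
  by unfold_locales
    (simp_all add: const_add const_mult const_1 algebra_simps)

text \<open>Ideals are the submodules of the ring regarded as a module over itself.\<close>

global_interpretation ring_ideal: module "(*) :: 'k cpoly \<Rightarrow> 'k cpoly \<Rightarrow> 'k cpoly"
  defines is_ideal = "ring_ideal.subspace" and ideal_gen = "ring_ideal.span"
  by unfold_locales (simp_all add: algebra_simps)

text \<open>The action of \<open>S\<close> on \<open>T\<close> by differentiation: the monomial with exponent \<open>a\<close> sends
  the monomial with exponent \<open>b\<close> to \<open>\<Prod>\<^sub>i b\<^sub>i! / (b\<^sub>i - a\<^sub>i)!\<close> times the one with exponent
  \<open>b - a\<close>, or to \<open>0\<close> if \<open>a\<close> does not divide \<open>b\<close>.\<close>

definition act :: "'n::finite cpoly \<Rightarrow> 'n cpoly \<Rightarrow> 'n cpoly" (infixr \<open>\<diamondop>\<close> 70)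
  where "\<psi> \<diamondop> F = (\<Sum>a\<in>keys \<psi>. \<Sum>b\<in>keys F.
     if \<forall>i. lookup a i \<le> lookup b i
     then Poly_Mapping.single (b - a)
            (lookup \<psi> a * lookup F b *
             (\<Prod>i\<in>UNIV. fact (lookup b i) / fact (lookup b i - lookup a i)))
     else 0)"

lemma var_act_var: "var i \<diamondop> var j = (if i = j then 1 else 0)"
proof -
  have "(\<forall>k. lookup (Poly_Mapping.single i (1::nat)) k \<le> lookup (Poly_Mapping.single j 1) k)
        \<longleftrightarrow> i = j"
    by (auto simp: lookup_single when_def split: if_splits)
  moreover have "(\<Prod>k\<in>UNIV. fact (lookup (Poly_Mapping.single j (1::nat)) k) /
      fact (lookup (Poly_Mapping.single j (1::nat)) k - lookup (Poly_Mapping.single j 1) k)) = (1::complex)"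
    by (intro prod.neutral) (auto simp: lookup_single when_def)
  ultimately show ?thesis by (auto simp: act_def var_def)
qed

definition Ann :: "'n::finite cpoly \<Rightarrow> 'n cpoly set"
  where "Ann F = {\<psi>. \<psi> \<diamondop> F = 0}"


section \<open>Smooth complete toric varieties and their Cox rings\<close>

text \<open>A fan in \<open>\<int>\<^sup>d\<close> is given by the primitive generators \<open>ray i\<close> of its rays,
  indexed by a finite type \<open>'n\<close>, and by the set \<open>\<Sigma>\<close> of its cones, each cone being recorded
  as the set of (indices of) its rays. The cones of a smooth fan are simplicial, so that
  faces correspond to subsets.\<close>

definition fan_cone :: "('n::finite \<Rightarrow> int^'d) \<Rightarrow> 'n set \<Rightarrow> (real^'d) set"
  where "fan_cone ray \<sigma> =
    {x. \<exists>c. (\<forall>i\<in>\<sigma>. 0 \<le> c i) \<and> x = (\<Sum>i\<in>\<sigma>. c i *\<^sub>R (\<chi> j. real_of_int (ray i $ j)))}"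

text \<open>The generators of \<open>\<sigma>\<close> are part of a basis of the lattice: they are distinct rows of
  a matrix that is invertible over the integers.\<close>

definition smooth_cone :: "('n::finite \<Rightarrow> int^'d) \<Rightarrow> 'n set \<Rightarrow> bool"
  where "smooth_cone ray \<sigma> \<longleftrightarrow>
    (\<exists>(M :: int^'d^'d) f. invertible M \<and> inj_on f \<sigma> \<and> (\<forall>i\<in>\<sigma>. row (f i) M = ray i))"

definition smooth_complete_fan :: "('n::finite \<Rightarrow> int^'d) \<Rightarrow> 'n set set \<Rightarrow> bool"
  where "smooth_complete_fan ray \<Sigma> \<longleftrightarrow>
    (\<forall>\<sigma>\<in>\<Sigma>. \<forall>\<tau>\<subseteq>\<sigma>. \<tau> \<in> \<Sigma>) \<and>
    (\<forall>i. {i} \<in> \<Sigma>) \<and>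
    (\<forall>\<sigma>\<in>\<Sigma>. smooth_cone ray \<sigma>) \<and>
    (\<forall>\<sigma>\<in>\<Sigma>. \<forall>\<tau>\<in>\<Sigma>. fan_cone ray \<sigma> \<inter> fan_cone ray \<tau> = fan_cone ray (\<sigma> \<inter> \<tau>)) \<and>
    (\<Union>\<sigma>\<in>\<Sigma>. fan_cone ray \<sigma>) = UNIV"

definition pairing :: "int^'d \<Rightarrow> int^'d \<Rightarrow> int"
  where "pairing m u = (\<Sum>j\<in>UNIV. m $ j * u $ j)"

text \<open>The Picard group is the cokernel of \<open>M \<rightarrow> \<int>\<^bsup>rays\<^esup>\<close>, \<open>m \<mapsto> (\<langle>m, ray i\<rangle>)\<^sub>i\<close>. Fixing an
  isomorphism of it with \<open>\<int>\<^sup>s\<close> amounts to giving the classes \<open>grd i\<close> of the torus invariant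
  prime divisors, such that \<open>M \<rightarrow> \<int>\<^bsup>rays\<^esup> \<rightarrow> \<int>\<^sup>s \<rightarrow> 0\<close> is exact.\<close>

definition picard_grading :: "('n::finite \<Rightarrow> int^'d) \<Rightarrow> ('n \<Rightarrow> int^'s) \<Rightarrow> bool"
  where "picard_grading ray grd \<longleftrightarrow>
    (\<forall>w. \<exists>a :: 'n \<Rightarrow> int. w = (\<Sum>i\<in>UNIV. a i *s grd i)) \<and>
    (\<forall>a :: 'n \<Rightarrow> int. (\<Sum>i\<in>UNIV. a i *s grd i) = 0 \<longleftrightarrow> (\<exists>m. \<forall>i. a i = pairing m (ray i)))"

definition mon_deg :: "('n::finite \<Rightarrow> int^'s) \<Rightarrow> ('n \<Rightarrow>\<^sub>0 nat) \<Rightarrow> int^'s"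
  where "mon_deg grd a = (\<Sum>i\<in>UNIV. int (lookup a i) *s grd i)"

text \<open>The piece of degree \<open>w\<close>, of \<open>S\<close> as well as of \<open>T\<close>.\<close>

definition graded_piece :: "('n::finite \<Rightarrow> int^'s) \<Rightarrow> int^'s \<Rightarrow> 'n cpoly set"
  where "graded_piece grd w = {f. \<forall>a\<in>keys f. mon_deg grd a = w}"

definition hcomponent :: "('n::finite \<Rightarrow> int^'s) \<Rightarrow> int^'s \<Rightarrow> 'n cpoly \<Rightarrow> 'n cpoly"
  where "hcomponent grd w f =
    (\<Sum>a | a \<in> keys f \<and> mon_deg grd a = w. Poly_Mapping.single a (lookup f a))"

definition homogeneous_ideal :: "('n::finite \<Rightarrow> int^'s) \<Rightarrow> 'n cpoly set \<Rightarrow> bool"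
  where "homogeneous_ideal grd I \<longleftrightarrow>
    is_ideal I \<and> (\<forall>f\<in>I. \<forall>w. hcomponent grd w f \<in> I)"

text \<open>\<open>HF grd I w\<close> is the dimension of \<open>(S/I)\<^sub>w\<close> for a homogeneous ideal \<open>I\<close>; the spaces
  \<open>S\<^sub>w\<close> are finite-dimensional because the variety is complete.\<close>

definition HF :: "('n::finite \<Rightarrow> int^'s) \<Rightarrow> 'n cpoly set \<Rightarrow> int^'s \<Rightarrow> nat"
  where "HF grd I w = cvec_dim (graded_piece grd w) - cvec_dim (graded_piece grd w \<inter> I)"

definition irrelevant_ideal :: "'n::finite set set \<Rightarrow> 'n cpoly set"
  where "irrelevant_ideal \<Sigma> = ideal_gen {\<Prod>i\<in>-\<sigma>. var i | \<sigma>. \<sigma> \<in> \<Sigma>}"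

fun ideal_power :: "'k cpoly set \<Rightarrow> nat \<Rightarrow> 'k cpoly set"
  where
    "ideal_power B 0 = UNIV"
  | "ideal_power B (Suc k) = ideal_gen {f * g | f g. f \<in> B \<and> g \<in> ideal_power B k}"

definition saturation :: "'k cpoly set \<Rightarrow> 'k cpoly set \<Rightarrow> 'k cpoly set"
  where "saturation I B = {f. \<exists>k. \<forall>g\<in>ideal_power B k. f * g \<in> I}"

definition B_saturated :: "'n::finite set set \<Rightarrow> 'n cpoly set \<Rightarrow> bool"
  where "B_saturated \<Sigma> I \<longleftrightarrow> I = saturation I (irrelevant_ideal \<Sigma>)"

text \<open>\<open>X = (\<complex>\<^bsup>rays\<^esup> - V(B)) / G\<close>, a geometric quotient by the torus \<open>G = Hom(Pic X, \<complex>\<^sup>*)\<close>: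
  points of \<open>X\<close> are represented by elements of \<open>cox_space\<close>, up to \<open>same_point\<close>.\<close>

definition cox_space :: "'n::finite set set \<Rightarrow> ('n \<Rightarrow> complex) set"
  where "cox_space \<Sigma> = {\<xi>. \<exists>f\<in>irrelevant_ideal \<Sigma>. eval_poly f \<xi> \<noteq> 0}"

definition cox_group :: "('n::finite \<Rightarrow> int^'d) \<Rightarrow> ('n \<Rightarrow> complex) set"
  where "cox_group ray =
    {t. (\<forall>i. t i \<noteq> 0) \<and> (\<forall>m. (\<Prod>i\<in>UNIV. t i powi pairing m (ray i)) = 1)}"

definition same_point :: "('n::finite \<Rightarrow> int^'d) \<Rightarrow> ('n \<Rightarrow> complex) \<Rightarrow> ('n \<Rightarrow> complex) \<Rightarrow> bool"
  where "same_point ray \<xi> \<eta> \<longleftrightarrow> (\<exists>t\<in>cox_group ray. \<eta> = (\<lambda>i. t i * \<xi> i))"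


section \<open>Ample and nef classes\<close>

text \<open>The Lie algebra of \<open>G\<close>; the tangent space of \<open>X\<close> at the class of \<open>\<xi>\<close> is the quotient
  of \<open>\<complex>\<^bsup>rays\<^esup>\<close> by the space of vectors \<open>(l\<^sub>i \<xi>\<^sub>i)\<^sub>i\<close> with \<open>l\<close> in this Lie algebra.\<close>

definition cox_lie :: "('n::finite \<Rightarrow> int^'d) \<Rightarrow> ('n \<Rightarrow> complex) set"
  where "cox_lie ray = {l. \<forall>m. (\<Sum>i\<in>UNIV. l i * of_int (pairing m (ray i))) = 0}"

definition dir_deriv :: "'n::finite cpoly \<Rightarrow> ('n \<Rightarrow> complex) \<Rightarrow> ('n \<Rightarrow> complex) \<Rightarrow> complex"
  where "dir_deriv f \<xi> \<omega> = (\<Sum>i\<in>UNIV. \<omega> i * eval_poly (var i \<diamondop> f) \<xi>)"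

text \<open>The complete linear system of \<open>w\<close> (its space of sections is \<open>S\<^sub>w\<close>) has no base points
  and separates points and tangent vectors, i.e. it defines a closed embedding of the
  complete variety \<open>X\<close> into a projective space.\<close>

definition very_ample ::
    "('n::finite \<Rightarrow> int^'d) \<Rightarrow> 'n set set \<Rightarrow> ('n \<Rightarrow> int^'s) \<Rightarrow> int^'s \<Rightarrow> bool"
  where "very_ample ray \<Sigma> grd w \<longleftrightarrow>
    (\<forall>\<xi>\<in>cox_space \<Sigma>. \<exists>f\<in>graded_piece grd w. eval_poly f \<xi> \<noteq> 0) \<and>
    (\<forall>\<xi>\<in>cox_space \<Sigma>. \<forall>\<eta>\<in>cox_space \<Sigma>.
       (\<exists>c. c \<noteq> 0 \<and> (\<forall>f\<in>graded_piece grd w. eval_poly f \<eta> = c * eval_poly f \<xi>))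
       \<longrightarrow> same_point ray \<xi> \<eta>) \<and>
    (\<forall>\<xi>\<in>cox_space \<Sigma>. \<forall>\<omega>.
       (\<exists>c. \<forall>f\<in>graded_piece grd w. dir_deriv f \<xi> \<omega> = c * eval_poly f \<xi>)
       \<longrightarrow> (\<exists>l\<in>cox_lie ray. \<omega> = (\<lambda>i. l i * \<xi> i)))"

definition ample ::
    "('n::finite \<Rightarrow> int^'d) \<Rightarrow> 'n set set \<Rightarrow> ('n \<Rightarrow> int^'s) \<Rightarrow> int^'s \<Rightarrow> bool"
  where "ample ray \<Sigma> grd w \<longleftrightarrow> (\<exists>k::nat. k > 0 \<and> very_ample ray \<Sigma> grd (int k *s w))"

text \<open>Irreducible closed subsets of \<open>X\<close> correspond to the homogeneous primes of \<open>S\<close> that do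
  not contain \<open>B\<close>; the Krull dimension of the closed subset is the maximal length of a chain
  of such primes starting at the given one.\<close>

definition relevant_prime ::
    "'n::finite set set \<Rightarrow> ('n \<Rightarrow> int^'s) \<Rightarrow> 'n cpoly set \<Rightarrow> bool"
  where "relevant_prime \<Sigma> grd P \<longleftrightarrow>
    homogeneous_ideal grd P \<and> P \<noteq> UNIV \<and> (\<forall>f g. f * g \<in> P \<longrightarrow> f \<in> P \<or> g \<in> P) \<and>
    \<not> irrelevant_ideal \<Sigma> \<subseteq> P"

definition irreducible_curve ::
    "'n::finite set set \<Rightarrow> ('n \<Rightarrow> int^'s) \<Rightarrow> 'n cpoly set \<Rightarrow> bool"
  where "irreducible_curve \<Sigma> grd P \<longleftrightarrow>
    relevant_prime \<Sigma> grd P \<and>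
    (\<exists>Q. relevant_prime \<Sigma> grd Q \<and> P \<subset> Q) \<and>
    \<not> (\<exists>Q R. relevant_prime \<Sigma> grd Q \<and> relevant_prime \<Sigma> grd R \<and> P \<subset> Q \<and> Q \<subset> R)"

text \<open>Intersection number of a class \<open>w\<close> with the curve \<open>C\<close> defined by \<open>P\<close>. It is the
  difference of Euler characteristics \<open>\<chi>(C, w + k A) - \<chi>(C, k A)\<close>, independently of \<open>k\<close>
  and \<open>A\<close>. For \<open>A\<close> ample and \<open>k\<close> large, \<open>\<chi>(C, w + k A) = dim H\<^sup>0(C, w + k A)\<close>, which is
  the dimension of \<open>(S/P)\<close> in degree \<open>w + k A\<close>.\<close>

definition intersection_number ::
    "('n::finite \<Rightarrow> int^'d) \<Rightarrow> 'n set set \<Rightarrow> ('n \<Rightarrow> int^'s) \<Rightarrow> int^'s \<Rightarrow> 'n cpoly set \<Rightarrow> int \<Rightarrow> bool"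
  where "intersection_number ray \<Sigma> grd w P e \<longleftrightarrow>
    (\<exists>A. ample ray \<Sigma> grd A \<and>
      (\<forall>\<^sub>F k in sequentially.
         int (HF grd P (w + int k *s A)) - int (HF grd P (int k *s A)) = e))"

definition nef ::
    "('n::finite \<Rightarrow> int^'d) \<Rightarrow> 'n set set \<Rightarrow> ('n \<Rightarrow> int^'s) \<Rightarrow> int^'s \<Rightarrow> bool"
  where "nef ray \<Sigma> grd w \<longleftrightarrow>
    (\<forall>P e. irreducible_curve \<Sigma> grd P \<and> intersection_number ray \<Sigma> grd w P e \<longrightarrow> 0 \<le> e)"

definition nef_semigroup ::
    "('n::finite \<Rightarrow> int^'d) \<Rightarrow> 'n set set \<Rightarrow> ('n \<Rightarrow> int^'s) \<Rightarrow> (int^'s) set"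
  where "nef_semigroup ray \<Sigma> grd = {w. nef ray \<Sigma> grd w}"

definition nat_span :: "(int^'s) set \<Rightarrow> (int^'s) set"
  where "nat_span C = {\<Sum>c\<in>C. int (a c) *s c | a. True}"

definition minimal_generating_set :: "(int^'s) set \<Rightarrow> (int^'s) set \<Rightarrow> bool"
  where "minimal_generating_set C K \<longleftrightarrow>
    finite C \<and> nat_span C = K \<and> (\<forall>D. D \<subset> C \<longrightarrow> nat_span D \<noteq> K)"


section \<open>Border rank\<close>

definition zariski_closure :: "('k \<Rightarrow> complex) set \<Rightarrow> ('k \<Rightarrow> complex) set"
  where "zariski_closure A =
    {x. \<forall>p. (\<forall>y\<in>A. eval_poly p y = 0) \<longrightarrow> eval_poly p x = 0}"

text \<open>The affine cone over \<open>X \<subseteq> \<P>(T\<^sub>v)\<close>: under the identification of \<open>T\<^sub>v\<close> with the dual of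
  \<open>S\<^sub>v\<close>, a point \<open>\<xi>\<close> is mapped to the class of the functional \<open>\<psi> \<mapsto> \<psi>(\<xi>)\<close>.\<close>

definition affine_cone :: "'n::finite set set \<Rightarrow> ('n \<Rightarrow> int^'s) \<Rightarrow> int^'s \<Rightarrow> 'n cpoly set"
  where "affine_cone \<Sigma> grd v =
    {G \<in> graded_piece grd v. \<exists>\<xi>\<in>cox_space \<Sigma>. \<exists>c.
       \<forall>\<psi>\<in>graded_piece grd v. \<psi> \<diamondop> G = const (c * eval_poly \<psi> \<xi>)}"

text \<open>The affine cone over the \<open>r\<close>-th secant variety; coordinates on \<open>T\<^sub>v\<close> are the
  coefficients.\<close>

definition secant_cone :: "'n::finite set set \<Rightarrow> ('n \<Rightarrow> int^'s) \<Rightarrow> int^'s \<Rightarrow> nat \<Rightarrow> 'n cpoly set"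
  where "secant_cone \<Sigma> grd v r =
    {F \<in> graded_piece grd v.
       lookup F \<in> zariski_closure
         (lookup ` {\<Sum>i<r. G i | G. \<forall>i<r. G i \<in> affine_cone \<Sigma> grd v})}"

definition border_rank :: "'n::finite set set \<Rightarrow> ('n \<Rightarrow> int^'s) \<Rightarrow> int^'s \<Rightarrow> 'n cpoly \<Rightarrow> nat"
  where "border_rank \<Sigma> grd v F = (LEAST r. F \<in> secant_cone \<Sigma> grd v r)"


section \<open>The multigraded Hilbert scheme, Slip and border VSP\<close>

definition generic_HF :: "('n::finite \<Rightarrow> int^'s) \<Rightarrow> nat \<Rightarrow> int^'s \<Rightarrow> nat"
  where "generic_HF grd r w = min r (cvec_dim (graded_piece grd w))"

text \<open>The closed points of the multigraded Hilbert scheme for \<open>h\<^sub>r\<close>.\<close>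

definition Hilb :: "('n::finite \<Rightarrow> int^'s) \<Rightarrow> nat \<Rightarrow> 'n cpoly set set"
  where "Hilb grd r = {I. homogeneous_ideal grd I \<and> (\<forall>w. HF grd I w = generic_HF grd r w)}"

text \<open>The Zariski topology on \<open>Hilb\<close>. The multigraded Hilbert scheme is a closed subscheme of
  a finite product of Grassmannians of subspaces of the \<open>S\<^sub>w\<close>, and it maps by a morphism to
  the Grassmannian of \<open>S\<^sub>w\<close> for every further \<open>w\<close>. A product of Grassmannians carries the
  quotient topology from the space of tuples of bases (frames), an open subset of an affine
  space; hence a subset is closed iff the condition on its frames is given by polynomials
  in the coefficients of the frame vectors. A frame here comprises bases in all degrees, but
  a polynomial involves only finitely many degrees.\<close>

definition is_frame ::
    "('n::finite \<Rightarrow> int^'s) \<Rightarrow> 'n cpoly set \<Rightarrow> (int^'s \<Rightarrow> nat \<Rightarrow> 'n cpoly) \<Rightarrow> bool"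
  where "is_frame grd I b \<longleftrightarrow>
    (\<forall>w. let k = cvec_dim (graded_piece grd w \<inter> I) in
       inj_on (b w) {..<k} \<and> \<not> cvec_dependent (b w ` {..<k}) \<and>
       cvec_span (b w ` {..<k}) = graded_piece grd w \<inter> I \<and>
       (\<forall>i\<ge>k. b w i = 0))"

definition frame_coords ::
    "(int^'s \<Rightarrow> nat \<Rightarrow> 'n cpoly) \<Rightarrow> (int^'s) \<times> nat \<times> ('n \<Rightarrow>\<^sub>0 nat) \<Rightarrow> complex"
  where "frame_coords b = (\<lambda>(w, i, a). lookup (b w i) a)"

definition hilb_closed :: "('n::finite \<Rightarrow> int^'s) \<Rightarrow> nat \<Rightarrow> 'n cpoly set set \<Rightarrow> bool"
  where "hilb_closed grd r Z \<longleftrightarrow>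
    (\<exists>E. Z = {I \<in> Hilb grd r.
       \<forall>p\<in>E. \<forall>b. is_frame grd I b \<longrightarrow> eval_poly p (frame_coords b) = 0})"

text \<open>The ideal generated by the homogeneous polynomials vanishing on a set of points of \<open>X\<close>;
  it is radical and \<open>B\<close>-saturated.\<close>

definition ideal_of_points ::
    "('n::finite \<Rightarrow> int^'s) \<Rightarrow> ('n \<Rightarrow> complex) set \<Rightarrow> 'n cpoly set"
  where "ideal_of_points grd Z = {f. \<forall>w. \<forall>\<xi>\<in>Z. eval_poly (hcomponent grd w f) \<xi> = 0}"

definition point_ideals ::
    "('n::finite \<Rightarrow> int^'d) \<Rightarrow> 'n set set \<Rightarrow> ('n \<Rightarrow> int^'s) \<Rightarrow> nat \<Rightarrow> 'n cpoly set set"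
  where "point_ideals ray \<Sigma> grd r =
    {ideal_of_points grd Z | Z.
       Z \<subseteq> cox_space \<Sigma> \<and> finite Z \<and> card Z = r \<and>
       pairwise (\<lambda>\<xi> \<eta>. \<not> same_point ray \<xi> \<eta>) Z \<and>
       ideal_of_points grd Z \<in> Hilb grd r}"

definition Slip ::
    "('n::finite \<Rightarrow> int^'d) \<Rightarrow> 'n set set \<Rightarrow> ('n \<Rightarrow> int^'s) \<Rightarrow> nat \<Rightarrow> 'n cpoly set set"
  where "Slip ray \<Sigma> grd r =
    \<Inter>{Z. hilb_closed grd r Z \<and> point_ideals ray \<Sigma> grd r \<subseteq> Z}"

definition border_VSP ::
    "('n::finite \<Rightarrow> int^'d) \<Rightarrow> 'n set set \<Rightarrow> ('n \<Rightarrow> int^'s) \<Rightarrow> 'n cpoly \<Rightarrow> nat \<Rightarrow> 'n cpoly set set"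
  where "border_VSP ray \<Sigma> grd F r = {J \<in> Slip ray \<Sigma> grd r. J \<subseteq> Ann F}"

end

theory Submission
  imports Defs "HOL-Computational_Algebra.Polynomial"
begin

text \<open>Let \<open>J\<close> be another element of \<open>border_VSP\<close> and \<open>c = c\<^sub>1 + \<dots> + c\<^sub>l\<close>. In the degrees \<open>u\<close> and
  \<open>u + c\<close> the ideals \<open>I\<close>, \<open>J\<close> and \<open>Ann F\<close> have the same colength \<open>r\<close>, hence agree. As \<open>I\<close> is
  saturated, a general \<open>s \<in> S\<^sub>c\<close> is a nonzerodivisor modulo \<open>I\<close> (McCoy's theorem, applied to the
  generic linear combination of the monomials in \<open>S\<^sub>c\<close>), so \<open>S\<^bsub>u+c\<^esub> = s S\<^sub>u + I\<^bsub>u+c\<^esub>\<close>. For large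
  \<open>k\<close> every monomial of degree \<open>u + k c\<close> is a product of a monomial of degree \<open>u\<close> and \<open>k\<close> monomials
  of degree \<open>c\<close>, because \<open>u\<close> is nef and \<open>c\<close> is ample. Thus \<open>S\<^bsub>u+kc\<^esub> = s\<^sup>k S\<^sub>u + (I \<inter> J)\<^bsub>u+kc\<^esub>\<close>, which
  forces \<open>I\<close> and \<open>J\<close> to agree in all degrees \<open>u + k c\<close> with \<open>k\<close> large, so that \<open>J \<subseteq> I\<close> by
  saturation and \<open>J = I\<close> by comparing Hilbert functions. That nef classes correspond to polytopes
  with the expected vertices is tested on the torus invariant curves.\<close>

section \<open>Linear algebra modulo a subspace\<close>

text \<open>No associated primes are avoided and no primary decomposition is used: \<open>s\<close>
  is chosen anew for every \<open>k\<close>, and all that is asked of it is that multiplication by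
  \<open>s ^ k\<close> kill nothing in the finite-dimensional space (S/I)_u. For a section depending
  on one parameter this fails for only finitely many parameter values. No regularity bound is used
  either: that high degrees are reached from degree u is a fact about lattice points. The reductions
  take place modulo I \<inter> J, which coincides with I and with J in degree u + c, so one
  reduction serves both ideals. The obstacle is that ample and nef classes are given geometrically,
  by separation of points and tangent vectors and by intersection numbers with arbitrary curves,
  whereas lattice points need inequalities between vertex coordinates
  \<open>vx \<sigma> w j\<close>. For nef classes this requires that the walls of the fan define
  irreducible curves in the sense of chains of primes, that edge lengths are their intersection
  numbers, and that the inequalities between adjacent vertices imply all others. The class c
  inherits strictness from v, which is itself a combination of the generators.\<close>

definition independent_mod ::
    "('a::zero \<Rightarrow> 'b \<Rightarrow> 'b::comm_monoid_add) \<Rightarrow> 'b set \<Rightarrow> 'b set \<Rightarrow> bool"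
  where "independent_mod sc A E \<longleftrightarrow>
    finite E \<and> (\<forall>c. (\<Sum>e\<in>E. sc (c e) e) \<in> A \<longrightarrow> (\<forall>e\<in>E. c e = 0))"

context vector_space
begin

text \<open>The space of all polynomials is infinite-dimensional, and \<open>dim\<close> is 0 for a
  space without finite basis. Containment in the span of a finite set \<open>T\<close> keeps the
  dimensions genuine; for graded pieces \<open>T\<close> will consist of monomials.\<close>

lemma independent_card_le_dim_of_span:
  assumes "B \<subseteq> V" "independent B" "V \<subseteq> span T" "finite T"
  shows "finite B" "card B \<le> dim V"
proof -
  obtain B' where B': "B' \<subseteq> V" "independent B'" "V \<subseteq> span B'" "card B' = dim V"
    using basis_exists by blast
  have "finite B'" using B'(1,2) assms(3,4) independent_span_bound[of T B'] by auto
  moreover have "B \<subseteq> span B'" using assms(1) B'(3) by auto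
  ultimately have "finite B \<and> card B \<le> card B'" using independent_span_bound assms(2) by blast
  then show "finite B" "card B \<le> dim V" using B'(4) by auto
qed

lemma dim_mono_of_span:
  assumes "V \<subseteq> W" "W \<subseteq> span T" "finite T"
  shows "dim V \<le> dim W"
proof -
  obtain B where B: "B \<subseteq> V" "independent B" "V \<subseteq> span B" "card B = dim V"
    using basis_exists by blast
  then show ?thesis
    using independent_card_le_dim_of_span[of B W T] assms by auto
qed

lemma subset_of_dim_le:
  assumes "subspace A" "A \<subseteq> G" "G \<subseteq> span T" "finite T" "dim G \<le> dim A"
  shows "G \<subseteq> A"
proof -
  obtain B where B: "B \<subseteq> A" "independent B" "A \<subseteq> span B" "card B = dim A"
    using basis_exists by blast
  obtain C where C: "B \<subseteq> C" "C \<subseteq> G" "independent C" "G \<subseteq> span C"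
    using maximal_independent_subset_extend[of B G] B assms by blast
  have "card C = dim G" using C basis_card_eq_dim by blast
  moreover have "finite C"
    using independent_card_le_dim_of_span(1)[of C G T] C assms by auto
  ultimately have "B = C" using card_seteq[of C B] C(1) B(4) assms(5) by simp
  then show ?thesis using C(4) B(1) assms(1) span_minimal by blast
qed

lemma exists_complement:
  assumes "subspace A" "A \<subseteq> G" "G \<subseteq> span T" "finite T"
  obtains E where "E \<subseteq> G" "independent_mod scale A E" "card E + dim A = dim G"
    "\<And>g. g \<in> G \<Longrightarrow> \<exists>c. g - (\<Sum>e\<in>E. scale (c e) e) \<in> A"
proof -
  obtain B where B: "B \<subseteq> A" "independent B" "A \<subseteq> span B" "card B = dim A"
    using basis_exists by blast
  obtain C where C: "B \<subseteq> C" "C \<subseteq> G" "independent C" "G \<subseteq> span C"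
    using maximal_independent_subset_extend[of B G] B assms by blast
  have cC: "card C = dim G" using C basis_card_eq_dim by blast
  have fC: "finite C"
    using independent_card_le_dim_of_span(1)[of C G T] C assms by auto
  then have fB: "finite B" using C(1) finite_subset by blast
  have spB: "span B = A" using B assms(1) by (metis span_minimal subset_antisym)
  have split: "(\<Sum>e\<in>C. scale (c e) e) = (\<Sum>e\<in>C - B. scale (c e) e) + (\<Sum>e\<in>B. scale (c e) e)" for c
    using sum.subset_diff[OF C(1) fC] .
  have "c e = 0" if c: "(\<Sum>e\<in>C - B. scale (c e) e) \<in> A" and e: "e \<in> C - B" for c e
  proof -
    have "(\<Sum>e\<in>C - B. scale (c e) e) \<in> span B" using c spB by simp
    then obtain d where d: "(\<Sum>e\<in>C - B. scale (c e) e) = (\<Sum>e\<in>B. scale (d e) e)"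
      using fB span_finite by auto
    \<comment> \<open>A relation modulo \<open>A\<close> becomes a relation in the basis
      \<open>C\<close> once the element of \<open>A\<close> is expanded in \<open>B\<close> and
      moved to the other side.\<close>
    define f where "f = (\<lambda>e. if e \<in> B then - d e else c e)"
    have "(\<Sum>e\<in>C. scale (f e) e) = (\<Sum>e\<in>C - B. scale (c e) e) + (\<Sum>e\<in>B. scale (- d e) e)"
      unfolding split by (intro arg_cong2[where f = "(+)"] sum.cong) (auto simp: f_def)
    also have "\<dots> = 0" by (simp add: d sum_negf)
    finally have "f e = 0" using independentD[OF C(3) fC order_refl] e by blast
    then show ?thesis using e by (simp add: f_def)
  qed
  then have "independent_mod scale A (C - B)" using fC by (auto simp: independent_mod_def)
  moreover have "card (C - B) + dim A = dim G"
    using card_Diff_subset[OF fB C(1)] card_mono[OF fC C(1)] B(4) cC by simp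
  moreover have "\<exists>c. g - (\<Sum>e\<in>C - B. scale (c e) e) \<in> A" if "g \<in> G" for g
  proof -
    have "g \<in> span C" using that C(4) by auto
    then obtain c where "g = (\<Sum>e\<in>C. scale (c e) e)"
      using fC span_finite by auto
    then have "g - (\<Sum>e\<in>C - B. scale (c e) e) = (\<Sum>e\<in>B. scale (c e) e)"
      by (simp add: split)
    also have "\<dots> \<in> A" unfolding spB[symmetric] by (intro span_sum span_scale span_base)
    finally show ?thesis by blast
  qed
  ultimately show ?thesis using that[of "C - B"] C(2) by blast
qed

lemma independent_mod_union_basis:
  assumes "independent_mod scale A E" "B \<subseteq> A" "independent B" "finite B" "subspace A"
  shows "E \<inter> B = {}" "independent (E \<union> B)"
proof -
  have fE: "finite E" using assms(1) by (simp add: independent_mod_def)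
  show disj: "E \<inter> B = {}"
  proof (rule ccontr)
    assume "E \<inter> B \<noteq> {}"
    then obtain x where x: "x \<in> E" "x \<in> B" by blast
    have "(\<Sum>e\<in>E. scale ((\<lambda>e. if e = x then 1 else 0) e) e) = (\<Sum>e\<in>E. if e = x then x else 0)"
      by (rule sum.cong) auto
    also have "\<dots> = x" using x fE by simp
    finally have "(\<Sum>e\<in>E. scale ((\<lambda>e. if e = x then 1 else 0) e) e) \<in> A"
      using x assms(2) by auto
    then have "(\<lambda>e. if e = x then 1 else 0 :: 'a) x = 0"
      using assms(1)[unfolded independent_mod_def, THEN conjunct2,
          THEN spec[of _ "\<lambda>e. if e = x then 1 else 0"]] x(1) by blast
    then show False by simp
  qed
  show "independent (E \<union> B)"
  proof (rule independent_if_scalars_zero)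
    show "finite (E \<union> B)" using fE assms(4) by simp
    fix f x assume s: "(\<Sum>x\<in>E \<union> B. scale (f x) x) = 0" and x: "x \<in> E \<union> B"
    have s': "(\<Sum>x\<in>E. scale (f x) x) + (\<Sum>x\<in>B. scale (f x) x) = 0"
      using s disj fE assms(4) by (simp add: sum.union_disjoint)
    have inA: "(\<Sum>x\<in>B. scale (f x) x) \<in> A"
      using assms(2,5) by (intro subspace_sum subspace_scale) auto
    have "(\<Sum>x\<in>E. scale (f x) x) = - (\<Sum>x\<in>B. scale (f x) x)" using s' by (simp add: eq_neg_iff_add_eq_0)
    then have "(\<Sum>x\<in>E. scale (f x) x) \<in> A" using inA assms(5) subspace_neg by simp
    then have zE: "\<forall>e\<in>E. f e = 0" using assms(1) by (auto simp: independent_mod_def)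
    then have "(\<Sum>x\<in>B. scale (f x) x) = 0" using s' by simp
    then have "\<forall>b\<in>B. f b = 0" using independentD[OF assms(3,4) order_refl] by blast
    with zE x show "f x = 0" by blast
  qed
qed

lemma card_independent_mod_le:
  assumes "independent_mod scale A E" "subspace A" "E \<subseteq> G" "A \<subseteq> G" "G \<subseteq> span T" "finite T"
  shows "card E + dim A \<le> dim G"
proof -
  obtain B where B: "B \<subseteq> A" "independent B" "A \<subseteq> span B" "card B = dim A"
    using basis_exists by blast
  have fB: "finite B" using independent_card_le_dim_of_span(1)[of B G T] B assms by auto
  note u = independent_mod_union_basis[OF assms(1) B(1,2) fB assms(2)]
  have "card (E \<union> B) \<le> dim G"
    using independent_card_le_dim_of_span(2)[of "E \<union> B" G T] u B assms by auto
  moreover have "card (E \<union> B) = card E + card B"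
    using u(1) fB assms(1) by (simp add: card_Un_disjoint independent_mod_def)
  ultimately show ?thesis using B by simp
qed

text \<open>The dimension count behind the surjectivity in \<open>HF_mono\<close>: together with a
  basis of \<open>A\<close>, the set \<open>E\<close> is already too large to be extended to a
  bigger basis of \<open>G\<close>.\<close>

lemma independent_mod_spans:
  assumes "independent_mod scale A E" "subspace A" "E \<subseteq> G" "A \<subseteq> G" "G \<subseteq> span T" "finite T"
    and "dim G \<le> card E + dim A" "g \<in> G"
  shows "\<exists>c. g - (\<Sum>e\<in>E. scale (c e) e) \<in> A"
proof -
  obtain B where B: "B \<subseteq> A" "independent B" "A \<subseteq> span B" "card B = dim A"
    using basis_exists by blast
  have fB: "finite B" using independent_card_le_dim_of_span(1)[of B G T] B assms by auto
  have fE: "finite E" using assms(1) by (simp add: independent_mod_def)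
  note u = independent_mod_union_basis[OF assms(1) B(1,2) fB assms(2)]
  have uG: "E \<union> B \<subseteq> G" using B assms by auto
  obtain C where C: "E \<union> B \<subseteq> C" "C \<subseteq> G" "independent C" "G \<subseteq> span C"
    using maximal_independent_subset_extend[OF uG u(2)] by blast
  have "card C = dim G" using C basis_card_eq_dim by blast
  moreover have "finite C"
    using independent_card_le_dim_of_span(1)[of C G T] C assms by auto
  moreover have "card (E \<union> B) = card E + card B"
    using u(1) fB fE by (simp add: card_Un_disjoint)
  ultimately have "E \<union> B = C" using card_seteq[of C "E \<union> B"] C(1) assms(7) B(4) by simp
  then have "g \<in> span (E \<union> B)" using C(4) assms(8) by auto
  then obtain c where "g = (\<Sum>e\<in>E \<union> B. scale (c e) e)"
    using fE fB span_finite[of "E \<union> B"] by auto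
  then have "g - (\<Sum>e\<in>E. scale (c e) e) = (\<Sum>e\<in>B. scale (c e) e)"
    using u(1) fE fB by (simp add: sum.union_disjoint)
  also have "\<dots> \<in> A" using B(1) assms(2) by (intro subspace_sum subspace_scale) auto
  finally show ?thesis by blast
qed

end

section \<open>Monomials, degrees and ideals\<close>

text \<open>Graded pieces, ideals of orbit closures and their intersections all have this form, so
  their dimensions are numbers of exponents.\<close>

definition mspace :: "('k \<Rightarrow>\<^sub>0 nat) set \<Rightarrow> 'k cpoly set"
  where "mspace E = {f. keys f \<subseteq> E}"

abbreviation xmon :: "('k \<Rightarrow>\<^sub>0 nat) \<Rightarrow> 'k cpoly"
  where "xmon a \<equiv> Poly_Mapping.single a 1"

lemma lookup_const_mult: "lookup (const c * f) a = c * lookup f a"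
proof -
  have "const c * f = Poly_Mapping.map ((*) c) f"
    by (simp add: const_def mult_map_scale_conv_mult)
  then show ?thesis by (simp add: Poly_Mapping.map.rep_eq when_def)
qed

lemma sum_lookup_xmon: "finite E \<Longrightarrow> keys f \<subseteq> E \<Longrightarrow> f = (\<Sum>a\<in>E. const (lookup f a) * xmon a)"
  by (intro poly_mapping_eqI)
    (auto simp: lookup_sum lookup_const_mult lookup_single when_def if_distrib[of "(*) _"]
      not_in_keys_iff_lookup_eq_zero subset_iff cong: if_cong)

lemma xmon_mult: "xmon a * xmon b = xmon (a + b)"
  by (simp add: mult_single)

lemma inj_xmon: "inj xmon"
  by (rule injI) (metis (full_types) keys_single singleton_inject zero_neq_one)

lemma cvec_subspace_mspace: "cvec_subspace (mspace E)"
  unfolding cvec.subspace_def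
  by (auto simp: mspace_def in_keys_iff lookup_add lookup_const_mult subset_iff) (metis add_0)

lemma mspace_subset_span: "mspace E \<subseteq> cvec_span (xmon ` E)"
proof
  fix f assume "f \<in> mspace E"
  then have "keys f \<subseteq> E" by (simp add: mspace_def)
  then have "(\<Sum>a\<in>keys f. const (lookup f a) * xmon a) \<in> cvec_span (xmon ` E)"
    by (intro cvec.span_sum cvec.span_scale cvec.span_base) auto
  then show "f \<in> cvec_span (xmon ` E)" using sum_lookup_xmon[of "keys f" f] by simp
qed

lemma independent_xmon: "finite E \<Longrightarrow> \<not> cvec_dependent (xmon ` E)"
proof (rule cvec.independent_if_scalars_zero)
  assume fE: "finite E"
  then show "finite (xmon ` E)" by simp
  fix f x assume s: "(\<Sum>x\<in>xmon ` E. const (f x) * x) = 0" and x: "x \<in> xmon ` E"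
  then obtain a where a: "a \<in> E" "x = xmon a" by blast
  have "0 = lookup (\<Sum>b\<in>E. const (f (xmon b)) * xmon b) a"
    using s by (simp add: sum.reindex inj_on_subset[OF inj_xmon])
  also have "\<dots> = (\<Sum>b\<in>E. if b = a then f (xmon b) else 0)"
    by (auto simp: lookup_sum lookup_const_mult lookup_single when_def intro!: sum.cong)
  also have "\<dots> = f x" using a fE by simp
  finally show "f x = 0" by simp
qed

lemma dim_mspace:
  assumes "finite E"
  shows "cvec_dim (mspace E) = card E"
proof -
  have "xmon ` E \<subseteq> mspace E" by (auto simp: mspace_def)
  then have "cvec_dim (mspace E) = card (xmon ` E)"
    using cvec.basis_card_eq_dim[of "xmon ` E" "mspace E"] independent_xmon[OF assms]
      mspace_subset_span[of E] by simp
  then show ?thesis using card_image[OF inj_on_subset[OF inj_xmon subset_UNIV], of E] by simp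
qed

lemma mspace_Int: "mspace E \<inter> mspace E' = mspace (E \<inter> E')"
  by (auto simp: mspace_def)

lemma graded_piece_eq_mspace: "graded_piece grd w = mspace {a. mon_deg grd a = w}"
  by (auto simp: graded_piece_def mspace_def)

lemma mon_deg_add: "mon_deg grd (a + b) = mon_deg grd a + mon_deg grd b"
  by (simp add: mon_deg_def lookup_add sum.distrib vec.scale_left_distrib)

lemma mult_graded_piece:
  assumes "f \<in> graded_piece grd w" "g \<in> graded_piece grd w'"
  shows "f * g \<in> graded_piece grd (w + w')"
  using assms keys_mult[of f g] by (fastforce simp: graded_piece_def mon_deg_add)

lemma xmon_in_graded_piece: "xmon a \<in> graded_piece grd w \<longleftrightarrow> mon_deg grd a = w"
  by (simp add: graded_piece_def)

lemma lookup_hcomponent: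
  "lookup (hcomponent grd w f) a = (if mon_deg grd a = w then lookup f a else 0)"
proof -
  have "lookup (hcomponent grd w f) a
      = (\<Sum>b | b \<in> keys f \<and> mon_deg grd b = w. if b = a then lookup f b else 0)"
    by (auto simp: hcomponent_def lookup_sum lookup_single when_def intro!: sum.cong)
  also have "\<dots> = (if mon_deg grd a = w then lookup f a else 0)"
    by (simp add: in_keys_iff)
  finally show ?thesis .
qed

lemma hcomponent_in_graded_piece: "hcomponent grd w f \<in> graded_piece grd w"
  by (auto simp: graded_piece_def in_keys_iff lookup_hcomponent split: if_splits)

lemma sum_hcomponents: "f = (\<Sum>w\<in>mon_deg grd ` keys f. hcomponent grd w f)"
  by (rule poly_mapping_eqI)
    (auto simp: lookup_sum lookup_hcomponent in_keys_iff image_iff)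

lemma is_ideal_iff:
  "is_ideal I \<longleftrightarrow> 0 \<in> I \<and> (\<forall>f\<in>I. \<forall>g\<in>I. f + g \<in> I) \<and> (\<forall>h. \<forall>f\<in>I. h * f \<in> I)"
  by (auto simp: ring_ideal.subspace_def)

lemma ideal_cvec_subspace: "is_ideal I \<Longrightarrow> cvec_subspace I"
  by (auto simp: is_ideal_iff cvec.subspace_def)

lemma ideal_mult_left: "is_ideal I \<Longrightarrow> f \<in> I \<Longrightarrow> h * f \<in> I"
  by (simp add: is_ideal_iff)

lemma ideal_mult_right: "is_ideal I \<Longrightarrow> f \<in> I \<Longrightarrow> f * h \<in> I"
  using ideal_mult_left[of I f h] by (simp add: mult.commute)

lemma ideal_sum: "is_ideal I \<Longrightarrow> (\<And>x. x \<in> X \<Longrightarrow> f x \<in> I) \<Longrightarrow> sum f X \<in> I"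
  by (rule ring_ideal.subspace_sum)

lemma ideal_add: "is_ideal I \<Longrightarrow> f \<in> I \<Longrightarrow> g \<in> I \<Longrightarrow> f + g \<in> I"
  by (simp add: is_ideal_iff)

lemma ideal_diff: "is_ideal I \<Longrightarrow> f \<in> I \<Longrightarrow> g \<in> I \<Longrightarrow> f - g \<in> I"
  by (rule ring_ideal.subspace_diff)

lemma homogeneous_not_subset:
  assumes "homogeneous_ideal grd I" "is_ideal J" "\<not> I \<subseteq> J"
  obtains w f where "f \<in> I" "f \<in> graded_piece grd w" "f \<notin> J"
proof -
  obtain f where f: "f \<in> I" "f \<notin> J" using assms(3) by blast
  then have "\<exists>w. hcomponent grd w f \<notin> J"
    using sum_hcomponents[of f grd] ideal_sum[OF assms(2)] by metis
  then obtain w where "hcomponent grd w f \<notin> J" by blast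
  moreover have "hcomponent grd w f \<in> I" using assms(1) f by (simp add: homogeneous_ideal_def)
  ultimately show ?thesis using that hcomponent_in_graded_piece by blast
qed

text \<open>A Kronecker substitution: the weight \<open>a \<mapsto> \<Sum>\<^sub>i a\<^sub>i N\<^bsup>i\<^esup>\<close> separates any given finite set
  of exponents once \<open>N\<close> is large, so that products have a unique leading monomial.\<close>

lemma base_digits_unique:
  fixes f g :: "nat \<Rightarrow> nat"
  assumes "\<And>i. f i < N" "\<And>i. g i < N" "(\<Sum>i<n. f i * N ^ i) = (\<Sum>i<n. g i * N ^ i)" "i < n"
  shows "f i = g i"
  using assms
proof (induction n arbitrary: f g i)
  case (Suc n)
  have N: "N > 0" using Suc.prems(1)[of 0] by simp
  have e: "(\<Sum>i<Suc n. h i * N ^ i) = h 0 + N * (\<Sum>i<n. h (Suc i) * N ^ i)" for h :: "nat \<Rightarrow> nat"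
    by (subst sum.lessThan_Suc_shift) (simp add: sum_distrib_left algebra_simps)
  have eq: "f 0 + N * (\<Sum>i<n. f (Suc i) * N ^ i) = g 0 + N * (\<Sum>i<n. g (Suc i) * N ^ i)"
    using Suc.prems(3) by (simp only: e)
  have f0: "f 0 = g 0"
    using arg_cong[OF eq, of "\<lambda>x. x mod N"] Suc.prems(1)[of 0] Suc.prems(2)[of 0] by simp
  then have "(\<Sum>i<n. f (Suc i) * N ^ i) = (\<Sum>i<n. g (Suc i) * N ^ i)" using eq N by simp
  then have "j < n \<Longrightarrow> f (Suc j) = g (Suc j)" for j
    using Suc.IH[of "\<lambda>i. f (Suc i)" "\<lambda>i. g (Suc i)" j] Suc.prems(1,2) by simp
  then show ?case using f0 Suc.prems(4) by (cases i) auto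
qed simp

lemma separating_weight:
  fixes E :: "('n::finite \<Rightarrow>\<^sub>0 nat) set"
  assumes "finite E"
  obtains L :: "('n \<Rightarrow>\<^sub>0 nat) \<Rightarrow> nat"
  where "inj_on L E" "\<And>a b. L (a + b) = L a + L b"
proof -
  obtain h where h: "bij_betw h {..<CARD('n)} (UNIV :: 'n set)"
    using ex_bij_betw_nat_finite[OF finite[of "UNIV :: 'n set"]] by (auto simp: atLeast0LessThan)
  define N where "N = Suc (\<Sum>a\<in>E. \<Sum>i\<in>UNIV. lookup a i)"
  define L where "L = (\<lambda>a :: 'n \<Rightarrow>\<^sub>0 nat. \<Sum>i<CARD('n). lookup a (h i) * N ^ i)"
  have lt: "lookup a i < N" if "a \<in> E" for a i
  proof -
    have "lookup a i \<le> (\<Sum>i\<in>UNIV. lookup a i)" by (rule member_le_sum) auto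
    also have "\<dots> \<le> (\<Sum>a\<in>E. \<Sum>i\<in>UNIV. lookup a i)" by (rule member_le_sum[OF that]) (auto simp: assms)
    finally show ?thesis by (simp add: N_def)
  qed
  have "inj_on L E"
  proof (rule inj_onI)
    fix a b assume ab: "a \<in> E" "b \<in> E" "L a = L b"
    show "a = b"
    proof (rule poly_mapping_eqI)
      fix k
      obtain i where "i < CARD('n)" "h i = k" using h by (metis UNIV_I bij_betw_iff_bijections lessThan_iff)
      then show "lookup a k = lookup b k"
        using base_digits_unique[of "\<lambda>i. lookup a (h i)" N "\<lambda>i. lookup b (h i)" "CARD('n)" i] ab lt
        by (auto simp: L_def)
    qed
  qed
  moreover have "L (a + b) = L a + L b" for a b
    by (simp add: L_def lookup_add sum.distrib algebra_simps)
  ultimately show ?thesis using that by blast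
qed

lemma cpoly_mult_eq_0:
  fixes f g :: "'n::finite cpoly"
  assumes "f * g = 0"
  shows "f = 0 \<or> g = 0"
proof (rule ccontr)
  assume n: "\<not> (f = 0 \<or> g = 0)"
  obtain L :: "('n \<Rightarrow>\<^sub>0 nat) \<Rightarrow> nat" where L: "inj_on L (keys f \<union> keys g)" "\<And>a b. L (a + b) = L a + L b"
    using separating_weight[of "keys f \<union> keys g"] by auto
  have mx: "\<exists>a\<in>keys p. \<forall>b\<in>keys p. L b \<le> L a" if "p \<noteq> 0" for p :: "'n cpoly"
  proof -
    have ne: "L ` keys p \<noteq> {}" using that by simp
    then have "Max (L ` keys p) \<in> L ` keys p" by (intro Max_in) auto
    then show ?thesis by (metis (no_types, lifting) Max_ge finite_imageI finite_keys imageE imageI)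
  qed
  obtain a where a: "a \<in> keys f" "\<And>b. b \<in> keys f \<Longrightarrow> L b \<le> L a" using mx[of f] n by blast
  obtain b where b: "b \<in> keys g" "\<And>c. c \<in> keys g \<Longrightarrow> L c \<le> L b" using mx[of g] n by blast
  have fs: "f = (\<Sum>x\<in>keys f. Poly_Mapping.single x (lookup f x))"
    by (rule poly_mapping_eqI) (auto simp: lookup_sum lookup_single when_def not_in_keys_iff_lookup_eq_zero)
  have gs: "g = (\<Sum>x\<in>keys g. Poly_Mapping.single x (lookup g x))"
    by (rule poly_mapping_eqI) (auto simp: lookup_sum lookup_single when_def not_in_keys_iff_lookup_eq_zero)
  \<comment> \<open>The weight is injective on the exponents of \<open>f\<close> and
    \<open>g\<close> only, not on sums. Additivity compensates: since \<open>L a\<close> and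
    \<open>L b\<close> are maximal, equality of the sums forces equality in each summand.\<close>
  have uniq: "x = a \<and> y = b" if "x \<in> keys f" "y \<in> keys g" "x + y = a + b" for x y
  proof -
    have "L x + L y = L a + L b" using that(3) L(2) by metis
    then have "L x = L a" "L y = L b" using a(2)[OF that(1)] b(2)[OF that(2)] by linarith+
    then show ?thesis using L(1) that(1,2) a(1) b(1) by (meson UnI1 UnI2 inj_onD)
  qed
  have "f * g = (\<Sum>x\<in>keys f. \<Sum>y\<in>keys g. Poly_Mapping.single (x + y) (lookup f x * lookup g y))"
    by (subst fs, subst gs) (simp add: sum_product mult_single)
  then have "lookup (f * g) (a + b)
      = (\<Sum>x\<in>keys f. \<Sum>y\<in>keys g. if x + y = a + b then lookup f x * lookup g y else 0)"
    by (simp add: lookup_sum lookup_single when_def)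
  also have "\<dots> = (\<Sum>x\<in>keys f. if x = a then (\<Sum>y\<in>keys g. if y = b then lookup f a * lookup g b else 0) else 0)"
    using uniq by (intro sum.cong refl) (auto intro!: sum.cong sum.neutral)
  also have "\<dots> = lookup f a * lookup g b" using a(1) b(1) by simp
  finally show False using assms a(1) b(1) by (simp add: in_keys_iff)
qed

section \<open>Generic linear forms modulo an ideal\<close>

text \<open>In other words, \<open>P\<close> is a nonzerodivisor over S/I if no nonzero constant
  annihilates all its coefficients. Induction on a bound \<open>d\<close> for the degree of
  \<open>Q\<close> modulo \<open>I\<close>; inside it, descending induction on \<open>i\<close>
  shows that \<open>coeff P i\<close> kills the top coefficient of \<open>Q\<close>, so that
  \<open>coeff P i\<close> times \<open>Q\<close> has smaller degree and is covered by the outer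
  induction.\<close>

lemma mccoy:
  fixes P Q :: "'k cpoly poly"
  assumes I: "is_ideal I"
    and P: "\<And>f. (\<And>i. coeff P i * f \<in> I) \<Longrightarrow> f \<in> I"
    and PQ: "\<And>i. coeff (P * Q) i \<in> I"
  shows "coeff Q i \<in> I"
proof -
  have "\<And>i. coeff Q i \<in> I" if "\<And>i. i \<ge> d \<Longrightarrow> coeff Q i \<in> I" "\<And>i. coeff (P * Q) i \<in> I" for d Q
    using that
  proof (induction d arbitrary: Q)
    case (Suc d)
    have main: "coeff P i * coeff Q j \<in> I" for i j
    proof (induction "degree P - i" arbitrary: i j rule: less_induct)
      case less
      have above: "coeff P a * coeff Q b \<in> I" if "a > i" for a b
      proof (cases "a \<le> degree P")
        case True
        then show ?thesis using less that by (meson diff_less_mono2 less_le_trans)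
      next
        case False
        then show ?thesis using I by (simp add: coeff_eq_0 is_ideal_iff)
      qed
      have "coeff (P * Q) (i + d)
          = (\<Sum>a\<le>i + d. coeff P a * coeff Q (i + d - a))" by (simp add: coeff_mult)
      also have "\<dots> = coeff P i * coeff Q d + (\<Sum>a\<in>{..i + d} - {i}. coeff P a * coeff Q (i + d - a))"
        by (subst sum.remove[of _ i]) auto
      finally have "coeff P i * coeff Q d
          = coeff (P * Q) (i + d) - (\<Sum>a\<in>{..i + d} - {i}. coeff P a * coeff Q (i + d - a))"
        by simp
      also have "\<dots> \<in> I"
      proof (intro ideal_diff[OF I] ideal_sum[OF I] Suc.prems(2))
        fix a assume a: "a \<in> {..i + d} - {i}"
        show "coeff P a * coeff Q (i + d - a) \<in> I"
        proof (cases "a > i")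
          case False
          then have "Suc d \<le> i + d - a" using a by auto
          then show ?thesis using Suc.prems(1) ideal_mult_left[OF I] by blast
        next
          case True
          then show ?thesis by (rule above)
        qed
      qed
      finally have top: "coeff P i * coeff Q d \<in> I" .
      define Q' where "Q' = [:coeff P i:] * Q"
      have c: "coeff Q' b = coeff P i * coeff Q b" for b by (simp add: Q'_def)
      have "coeff Q' b \<in> I" for b
      proof (rule Suc.IH)
        fix b assume "d \<le> b"
        then show "coeff Q' b \<in> I"
          using top Suc.prems(1)[of b] ideal_mult_left[OF I] c by (cases "b = d") auto
      next
        fix b
        have "P * Q' = [:coeff P i:] * (P * Q)" by (simp add: Q'_def mult.left_commute)
        then have "coeff (P * Q') b = coeff P i * coeff (P * Q) b" by simp
        then show "coeff (P * Q') b \<in> I" using Suc.prems(2) ideal_mult_left[OF I] by simp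
      qed
      then show ?case by (simp add: c)
    qed
    show ?case by (rule P) (rule main)
  qed simp
  from this[of "Suc (degree Q)"] show ?thesis
    using PQ I by (simp add: coeff_eq_0 is_ideal_iff)
qed

lemma mccoy_power:
  fixes P Q :: "'k cpoly poly"
  assumes I: "is_ideal I"
    and P: "\<And>f. (\<And>i. coeff P i * f \<in> I) \<Longrightarrow> f \<in> I"
    and PQ: "\<And>i. coeff (P ^ k * Q) i \<in> I"
  shows "coeff Q i \<in> I"
  using PQ
proof (induction k arbitrary: Q i)
  case (Suc k)
  have "coeff (P ^ k * Q) i \<in> I" for i
  proof (rule mccoy[OF I, where P = P])
    show "coeff (P * (P ^ k * Q)) i \<in> I" for i using Suc.prems by (simp add: mult.assoc)
  qed (rule P)
  then show ?case by (rule Suc.IH)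
qed simp

text \<open>Gaussian elimination: the pivots of linearly independent polynomial vectors have only
  finitely many zeros.\<close>

lemma generic_independent:
  fixes a :: "'i \<Rightarrow> 'j \<Rightarrow> complex poly"
  assumes "finite E"
    and "\<And>c. (\<And>j. (\<Sum>e\<in>E. c e * a e j) = 0) \<Longrightarrow> \<forall>e\<in>E. c e = 0"
  shows "\<exists>g. g \<noteq> 0 \<and> (\<forall>t. poly g t \<noteq> 0 \<longrightarrow>
    (\<forall>c. (\<forall>j. (\<Sum>e\<in>E. c e * poly (a e j) t) = 0) \<longrightarrow> (\<forall>e\<in>E. c e = 0)))"
  using assms
proof (induction E arbitrary: a rule: finite_induct)
  case empty
  then show ?case by (intro exI[of _ 1]) auto
next
  case (insert x E)
  have "\<exists>p. a x p \<noteq> 0"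
  proof (rule ccontr)
    assume z: "\<not> (\<exists>p. a x p \<noteq> 0)"
    have "\<forall>e\<in>insert x E. (\<lambda>e. if e = x then 1 else 0 :: complex poly) e = 0"
    proof (rule insert.prems)
      show "(\<Sum>e\<in>insert x E. (if e = x then 1 else 0) * a e j) = 0" for j
        using z by (intro sum.neutral) auto
    qed
    then show False by simp
  qed
  then obtain p where p: "a x p \<noteq> 0" by blast
  \<comment> \<open>Fraction-free elimination of the pivot coordinate \<open>p\<close>. A relation
    among the new rows lifts to one among the old rows because the pivot is nonzero; for the same
    reason the parameter has to avoid the zeros of the pivot as well.\<close>
  define b where "b = (\<lambda>e j. a x p * a e j - a e p * a x j)"
  have "\<exists>g. g \<noteq> 0 \<and> (\<forall>t. poly g t \<noteq> 0 \<longrightarrow>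
    (\<forall>c. (\<forall>j. (\<Sum>e\<in>E. c e * poly (b e j) t) = 0) \<longrightarrow> (\<forall>e\<in>E. c e = 0)))"
  proof (rule insert.IH)
    fix c assume c: "\<And>j. (\<Sum>e\<in>E. c e * b e j) = 0"
    define c' where "c' = (\<lambda>e. if e = x then - (\<Sum>e\<in>E. c e * a e p) else c e * a x p)"
    have "(\<Sum>e\<in>insert x E. c' e * a e j) = 0" for j
    proof -
      have "(\<Sum>e\<in>insert x E. c' e * a e j)
          = - (\<Sum>e\<in>E. c e * a e p) * a x j + (\<Sum>e\<in>E. (c e * a x p) * a e j)"
        using insert.hyps by (auto simp: c'_def intro!: sum.cong)
      also have "\<dots> = (\<Sum>e\<in>E. c e * b e j)"
        by (simp add: b_def algebra_simps sum_subtractf sum_distrib_left)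
      finally show ?thesis using c by simp
    qed
    then have "\<forall>e\<in>insert x E. c' e = 0" by (rule insert.prems)
    then have "c' e = 0" if "e \<in> E" for e using that by blast
    then show "\<forall>e\<in>E. c e = 0" using p insert.hyps(2) unfolding c'_def by (metis mult_eq_0_iff)
  qed
  then obtain g where g: "g \<noteq> 0" "\<And>t c. poly g t \<noteq> 0 \<Longrightarrow>
      (\<And>j. (\<Sum>e\<in>E. c e * poly (b e j) t) = 0) \<Longrightarrow> (\<forall>e\<in>E. c e = 0)" by blast
  have "\<forall>e\<in>insert x E. c e = 0"
    if t: "poly (g * a x p) t \<noteq> 0" and c: "\<forall>j. (\<Sum>e\<in>insert x E. c e * poly (a e j) t) = 0" for t c
  proof -
    have c': "(\<Sum>e\<in>E. c e * poly (a e j) t) = - c x * poly (a x j) t" for j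
      using c[rule_format, of j] insert.hyps by (simp add: eq_neg_iff_add_eq_0 add.commute)
    have "(\<Sum>e\<in>E. c e * poly (b e j) t) = 0" for j
    proof -
      have "(\<Sum>e\<in>E. c e * poly (b e j) t)
        = poly (a x p) t * (\<Sum>e\<in>E. c e * poly (a e j) t) - (\<Sum>e\<in>E. c e * poly (a e p) t) * poly (a x j) t"
        by (simp add: b_def algebra_simps sum_subtractf sum_distrib_left)
      then show ?thesis by (simp add: c')
    qed
    then have z: "\<forall>e\<in>E. c e = 0" using g(2)[of t c] t by simp
    then have "c x * poly (a x p) t = 0" using c'[of p] by simp
    then show ?thesis using z t by simp
  qed
  then show ?case using g(1) p by (intro exI[of _ "g * a x p"]) auto
qed

definition functional :: "('k cpoly \<Rightarrow> complex) \<Rightarrow> bool"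
  where "functional \<kappa> \<longleftrightarrow> (\<forall>f g. \<kappa> (f + g) = \<kappa> f + \<kappa> g) \<and> (\<forall>c f. \<kappa> (const c * f) = c * \<kappa> f)"

lemma functional_0: "functional \<kappa> \<Longrightarrow> \<kappa> 0 = 0"
  unfolding functional_def by (metis add_cancel_left_left)

lemma functional_sum: "functional \<kappa> \<Longrightarrow> \<kappa> (sum f X) = (\<Sum>x\<in>X. \<kappa> (f x))"
  by (induction X rule: infinite_finite_induct) (auto simp: functional_0, auto simp: functional_def)

lemma functional_poly:
  assumes "functional \<kappa>"
  shows "\<kappa> (poly R (const t)) = poly (map_poly \<kappa> R) t"
proof (induction R)
  case (pCons a R)
  then show ?case using assms by (simp add: map_poly_pCons functional_0, simp add: functional_def)
qed (simp add: functional_0[OF assms])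

lemma exists_functional:
  assumes "cvec_subspace I" "g \<notin> I"
  obtains \<kappa> where "functional \<kappa>" "\<And>f. f \<in> I \<Longrightarrow> \<kappa> f = 0" "\<kappa> g \<noteq> 0"
proof -
  interpret vp: vector_space_pair "\<lambda>c (p :: 'a cpoly). const c * p" "(*) :: complex \<Rightarrow> complex \<Rightarrow> complex"
    by (rule vector_space_pair.intro[OF cvec.vector_space_axioms], unfold_locales)
      (simp_all add: algebra_simps)
  obtain B where B: "B \<subseteq> I" "\<not> cvec_dependent B" "I \<subseteq> cvec_span B"
    using cvec.basis_exists by metis
  have "cvec_span B \<subseteq> I" using B(1) assms(1) by (rule cvec.span_minimal)
  then have "\<not> cvec_dependent (insert g B)"
    using assms(2) B(2) by (intro cvec.independent_insertI) auto
  then obtain \<kappa> where \<kappa>: "Vector_Spaces.linear (\<lambda>c p. const c * p) (*) \<kappa>"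
      "\<forall>x\<in>insert g B. \<kappa> x = (if x = g then 1 else 0)"
    using vp.linear_independent_extend[of "insert g B" "\<lambda>x. if x = g then 1 else 0"]
    unfolding cvec_dependent_def by blast
  have f: "functional \<kappa>"
    using \<kappa>(1) by (auto simp: functional_def Vector_Spaces.linear_iff)
  have "cvec_subspace {f. \<kappa> f = 0}"
    using f functional_0[OF f] by (auto simp: cvec.subspace_def functional_def)
  moreover have "B \<subseteq> {f. \<kappa> f = 0}" using \<kappa>(2) B(1) assms(2) by auto
  ultimately have "cvec_span B \<subseteq> {f. \<kappa> f = 0}" by (intro cvec.span_minimal)
  then have "\<kappa> f = 0" if "f \<in> I" for f using that B(3) by auto
  moreover have "\<kappa> g \<noteq> 0" using \<kappa>(2) by simp
  ultimately show ?thesis using that f by blast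
qed

text \<open>\<open>P\<close> is a family of sections depending on one parameter. With the parameter
  as an indeterminate, the vectors \<open>P ^ k * e\<close> stay independent modulo \<open>I\<close>
  over the complex polynomials in it, by McCoy; independence then survives specialization at all but
  finitely many values \<open>t\<close>.\<close>

lemma generic_power_independent:
  fixes P :: "'k cpoly poly"
  assumes I: "is_ideal I"
    and P: "\<And>f. (\<And>i. coeff P i * f \<in> I) \<Longrightarrow> f \<in> I"
    and E: "independent_mod (\<lambda>c f. const c * f) I E"
  shows "\<exists>t. \<forall>c. poly P (const t) ^ k * (\<Sum>e\<in>E. const (c e) * e) \<in> I \<longrightarrow> (\<forall>e\<in>E. c e = 0)"
proof -
  \<comment> \<open>Functionals vanishing on \<open>I\<close> separate the elements of S/I and serve
    as its coordinates, possibly infinitely many, for the elimination.\<close>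
  define K where "K = {\<kappa> :: 'k cpoly \<Rightarrow> complex. functional \<kappa> \<and> (\<forall>f\<in>I. \<kappa> f = 0)}"
  have fK: "functional \<kappa>" if "\<kappa> \<in> K" for \<kappa> using that by (simp add: K_def)
  have inI: "f \<in> I" if "\<And>\<kappa>. \<kappa> \<in> K \<Longrightarrow> \<kappa> f = 0" for f
  proof (rule ccontr)
    assume "f \<notin> I"
    then obtain \<kappa> where "functional \<kappa>" "\<And>f. f \<in> I \<Longrightarrow> \<kappa> f = 0" "\<kappa> f \<noteq> 0"
      using exists_functional[OF ideal_cvec_subspace[OF I]] by metis
    then show False using that[of \<kappa>] by (simp add: K_def)
  qed
  have fE: "finite E" using E by (simp add: independent_mod_def)
  \<comment> \<open>The coordinate index ranges over all functions on polynomials; those outside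
    \<open>K\<close> contribute zero columns.\<close>
  define a where "a = (\<lambda>e \<kappa>. if \<kappa> \<in> K then map_poly \<kappa> (P ^ k * [:e:]) else 0)"
  have "\<exists>g. g \<noteq> 0 \<and> (\<forall>t. poly g t \<noteq> 0 \<longrightarrow>
    (\<forall>c. (\<forall>\<kappa>. (\<Sum>e\<in>E. c e * poly (a e \<kappa>) t) = 0) \<longrightarrow> (\<forall>e\<in>E. c e = 0)))"
  proof (rule generic_independent[OF fE])
    fix c assume c: "\<And>\<kappa>. (\<Sum>e\<in>E. c e * a e \<kappa>) = 0"
    \<comment> \<open>A relation with polynomial coefficients \<open>c e\<close> is read as one
      polynomial over the Cox ring, to which \<open>mccoy_power\<close> applies.\<close>
    define Q where "Q = (\<Sum>e\<in>E. map_poly const (c e) * [:e:])"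
    have const0: "const 0 = (0 :: 'k cpoly)" by (simp add: const_def)
    have cQ: "coeff Q n = (\<Sum>e\<in>E. const (coeff (c e) n) * e)" for n
      by (simp add: Q_def coeff_sum coeff_map_poly const0 mult.commute)
    have "coeff (P ^ k * Q) n \<in> I" for n
    proof (rule inI)
      fix \<kappa> assume \<kappa>: "\<kappa> \<in> K"
      have fk: "functional \<kappa>" and k0: "\<kappa> 0 = 0" using fK[OF \<kappa>] functional_0 by auto
      have "P ^ k * Q = (\<Sum>e\<in>E. map_poly const (c e) * (P ^ k * [:e:]))"
        unfolding Q_def sum_distrib_left by (intro sum.cong refl mult.left_commute)
      then have "\<kappa> (coeff (P ^ k * Q) n)
          = (\<Sum>e\<in>E. \<Sum>i\<le>n. \<kappa> (const (coeff (c e) i) * coeff (P ^ k * [:e:]) (n - i)))"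
        by (simp only: coeff_sum coeff_mult functional_sum[OF fk] coeff_map_poly const0)
      also have "\<dots> = (\<Sum>e\<in>E. \<Sum>i\<le>n. coeff (c e) i * coeff (map_poly \<kappa> (P ^ k * [:e:])) (n - i))"
        using fk k0 by (simp add: functional_def coeff_map_poly del: mult_pCons_right)
      also have "\<dots> = coeff (\<Sum>e\<in>E. c e * a e \<kappa>) n"
        using \<kappa> by (simp add: a_def coeff_sum coeff_mult del: mult_pCons_right)
      finally show "\<kappa> (coeff (P ^ k * Q) n) = 0" using c by simp
    qed
    then have "coeff Q n \<in> I" for n using mccoy_power[OF I, where P = P and Q = Q and k = k] P by simp
    then have "\<forall>e\<in>E. coeff (c e) n = 0" for n
      using E[unfolded independent_mod_def, THEN conjunct2, THEN spec[of _ "\<lambda>e. coeff (c e) n"]] cQ by simp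
    then show "\<forall>e\<in>E. c e = 0" by (auto intro: poly_eqI)
  qed
  then obtain g where g: "g \<noteq> 0" "\<And>t c. poly g t \<noteq> 0 \<Longrightarrow>
      (\<And>\<kappa>. (\<Sum>e\<in>E. c e * poly (a e \<kappa>) t) = 0) \<Longrightarrow> (\<forall>e\<in>E. c e = 0)" by blast
  obtain t where t: "poly g t \<noteq> 0"
    using poly_roots_finite[OF g(1)] infinite_UNIV_char_0[where 'a = complex]
    by (metis (mono_tags, lifting) UNIV_eq_I mem_Collect_eq)
  have "\<forall>e\<in>E. c e = 0" if c: "poly P (const t) ^ k * (\<Sum>e\<in>E. const (c e) * e) \<in> I" for c
  proof (rule g(2)[OF t])
    fix \<kappa>
    show "(\<Sum>e\<in>E. c e * poly (a e \<kappa>) t) = 0"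
    proof (cases "\<kappa> \<in> K")
      case True
      have fk: "functional \<kappa>" using fK[OF True] .
      have "0 = \<kappa> (poly P (const t) ^ k * (\<Sum>e\<in>E. const (c e) * e))"
        using True c by (simp add: K_def)
      also have "\<dots> = \<kappa> (\<Sum>e\<in>E. const (c e) * poly (P ^ k * [:e:]) (const t))"
        unfolding sum_distrib_left poly_mult poly_power
        by (intro arg_cong[of _ _ \<kappa>] sum.cong refl) (simp add: mult.left_commute)
      also have "\<dots> = (\<Sum>e\<in>E. c e * \<kappa> (poly (P ^ k * [:e:]) (const t)))"
        unfolding functional_sum[OF fk]
        by (intro sum.cong refl) (use fk in \<open>simp only: functional_def\<close>)
      also have "\<dots> = (\<Sum>e\<in>E. c e * poly (a e \<kappa>) t)"
        using True by (simp only: functional_poly[OF fk] a_def if_True)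
      finally show ?thesis by simp
    qed (simp add: a_def)
  qed
  then show ?thesis by blast
qed

section \<open>Membership in a saturated ideal, tested on generators\<close>

lemma saturated_generators:
  assumes I: "is_ideal I" "I = saturation I (ideal_gen H)"
    and "\<And>h. h \<in> H \<Longrightarrow> f * h \<in> I"
  shows "f \<in> I"
proof -
  have id: "is_ideal {g. f * g \<in> I}"
    unfolding is_ideal_iff
  proof (intro conjI allI ballI; unfold mem_Collect_eq)
    show "f * 0 \<in> I" using I(1) by (simp add: is_ideal_iff)
    show "f * (g + h) \<in> I" if "f * g \<in> I" "f * h \<in> I" for g h
      unfolding distrib_left using that by (rule ideal_add[OF I(1)])
    show "f * (h * g) \<in> I" if "f * g \<in> I" for g h
      unfolding mult.left_commute[of f h] using that by (rule ideal_mult_left[OF I(1)])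
  qed
  have "ideal_gen H \<subseteq> {g. f * g \<in> I}"
    using assms(3) id by (intro ring_ideal.span_minimal) auto
  then have sub: "f * (g * h) \<in> I" if "g \<in> ideal_gen H" for g h
    unfolding mult.assoc[symmetric] using that by - (rule ideal_mult_right[OF I(1)], blast)
  \<comment> \<open>This is the first power of the ideal as \<open>ideal_power\<close> unfolds it,
    the zeroth power being the whole ring; the exponent 1 suffices for saturation.\<close>
  have "ideal_gen {g * h | g h. g \<in> ideal_gen H \<and> h \<in> UNIV} \<subseteq> {g. f * g \<in> I}"
    using sub by (intro ring_ideal.span_minimal[OF _ id]) blast
  then have "\<forall>g\<in>ideal_power (ideal_gen H) (Suc 0). f * g \<in> I"
    unfolding ideal_power.simps by blast
  then have "f \<in> saturation I (ideal_gen H)" unfolding saturation_def by blast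
  then show ?thesis using I(2) by blast
qed

text \<open>Induction on the sum of the exponents \<open>M h\<close>: replacing \<open>f\<close> by
  \<open>f * h\<close> lowers the exponent at \<open>h\<close> by one, so all these products lie in
  \<open>I\<close>, and then \<open>f\<close> does by saturation. If some exponent is 0, there is
  nothing left to prove.\<close>

lemma saturated_powers:
  assumes I: "is_ideal I" "I = saturation I (ideal_gen H)"
    and H: "finite H\<^sub>0" "\<And>h. h \<in> H \<Longrightarrow> \<exists>h\<^sub>0\<in>H\<^sub>0. h\<^sub>0 dvd h"
    and f: "\<And>h. h \<in> H\<^sub>0 \<Longrightarrow> \<exists>N. h ^ N * f \<in> I"
  shows "f \<in> I"
proof -
  have "f \<in> I" if "(\<Sum>h\<in>H\<^sub>0. M h) = m" "\<And>h. h \<in> H\<^sub>0 \<Longrightarrow> h ^ M h * f \<in> I" for m M f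
    using that
  proof (induction m arbitrary: M f rule: less_induct)
    case (less m)
    show ?case
    proof (cases "\<exists>h\<in>H\<^sub>0. M h = 0")
      case True
      then show ?thesis using less.prems(2) by fastforce
    next
      case False
      have key: "f * h \<in> I" if h: "h \<in> H\<^sub>0" for h
      proof (rule less.IH[OF _ refl, of "M(h := M h - 1)"])
        show "(\<Sum>x\<in>H\<^sub>0. (M(h := M h - 1)) x) < m"
          unfolding less.prems(1)[symmetric]
          using H(1) h False by (intro sum_strict_mono_ex1) auto
        fix x assume x: "x \<in> H\<^sub>0"
        have "x ^ (M(h := M h - 1)) x * (f * h) = (if x = h then x ^ M x * f else h * (x ^ M x * f))"
        proof (cases "x = h")
          case True
          have e: "h ^ M h = h * h ^ (M h - 1)" using False h by (metis power_eq_if)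
          have "h ^ (M h - 1) * (f * h) = (h * h ^ (M h - 1)) * f" by (simp only: mult_ac)
          also have "\<dots> = h ^ M h * f" by (simp only: e[symmetric])
          finally show ?thesis using True by simp
        next
          case False
          then show ?thesis by (simp add: mult.left_commute[of _ h] mult.commute[of f h])
        qed
        moreover have "(if x = h then x ^ M x * f else h * (x ^ M x * f)) \<in> I"
          using less.prems(2)[OF x] ideal_mult_left[OF I(1) less.prems(2)[OF x], of h]
          by (simp only: split: if_split) blast
        ultimately show "x ^ (M(h := M h - 1)) x * (f * h) \<in> I" by (simp only:)
      qed
      show ?thesis
      proof (rule saturated_generators[OF I])
        fix h assume "h \<in> H"
        then obtain h0 g where h0: "h0 \<in> H\<^sub>0" and h: "h = h0 * g" using H(2) by (meson dvdE)
        show "f * h \<in> I"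
          unfolding h mult.assoc[symmetric] by (rule ideal_mult_right[OF I(1) key[OF h0]])
      qed
    qed
  qed
  moreover obtain M where "\<And>h. h \<in> H\<^sub>0 \<Longrightarrow> h ^ M h * f \<in> I" using f by metis
  ultimately show ?thesis by blast
qed

section \<open>Maximal cones and walls of a smooth complete fan\<close>

lemma pairing_add_left: "pairing (m + m') x = pairing m x + pairing m' x"
  by (simp add: pairing_def distrib_right sum.distrib)

lemma pairing_diff_left: "pairing (m - m') x = pairing m x - pairing m' x"
  by (simp add: pairing_def left_diff_distrib sum_subtractf)

lemma pairing_scale_left: "pairing (c *s m) x = c * pairing m x"
  by (simp add: pairing_def sum_distrib_left mult.assoc)

lemma pairing_0_left [simp]: "pairing 0 x = 0"
  by (simp add: pairing_def)

lemma pairing_sum_left: "pairing (\<Sum>i\<in>A. f i) x = (\<Sum>i\<in>A. pairing (f i) x)"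
  by (induction A rule: infinite_finite_induct) (simp_all add: pairing_add_left)

definition rpairing :: "int^'d \<Rightarrow> real^'d \<Rightarrow> real"
  where "rpairing m x = (\<Sum>j\<in>UNIV. real_of_int (m $ j) * x $ j)"

lemma rpairing_add: "rpairing m (x + y) = rpairing m x + rpairing m y"
  by (simp add: rpairing_def distrib_left sum.distrib)

lemma rpairing_diff: "rpairing m (x - y) = rpairing m x - rpairing m y"
  by (simp add: rpairing_def right_diff_distrib sum_subtractf)

lemma rpairing_scale: "rpairing m (c *\<^sub>R x) = c * rpairing m x"
  by (simp add: rpairing_def sum_distrib_left mult_ac)

lemma rpairing_sum: "rpairing m (\<Sum>i\<in>A. f i) = (\<Sum>i\<in>A. rpairing m (f i))"
  by (induction A rule: infinite_finite_induct) (simp_all add: rpairing_add, simp_all add: rpairing_def)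

lemma continuous_rpairing: "continuous_on UNIV (rpairing m)"
  unfolding rpairing_def by (intro continuous_intros)

locale toric =
  fixes ray :: "'n::finite \<Rightarrow> int^'d"
    and \<Sigma> :: "'n set set"
    and grd :: "'n \<Rightarrow> int^'s"
  assumes fan: "smooth_complete_fan ray \<Sigma>"
    and grading: "picard_grading ray grd"
begin

definition rray :: "'n \<Rightarrow> real^'d"
  where "rray i = (\<chi> j. real_of_int (ray i $ j))"

abbreviation pr :: "int^'d \<Rightarrow> 'n \<Rightarrow> int"
  where "pr m i \<equiv> pairing m (ray i)"

text \<open>Generators of a smooth cone are linearly independent, so these are the cones of full
  dimension.\<close>

definition max_cone :: "'n set \<Rightarrow> bool"
  where "max_cone \<sigma> \<longleftrightarrow> \<sigma> \<in> \<Sigma> \<and> card \<sigma> = CARD('d)"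

text \<open>For a maximal cone this is the dual lattice basis. In the polytope of a nef class,
  \<open>dual \<sigma> i\<close> is the direction of the edge that leaves the vertex of \<sigma> and
  stays on the facets of the other rays of \<sigma>.\<close>

definition dual :: "'n set \<Rightarrow> 'n \<Rightarrow> int^'d"
  where "dual \<sigma> = (SOME e. \<forall>i\<in>\<sigma>. \<forall>k\<in>\<sigma>. pr (e i) k = (if i = k then 1 else 0))"

lemma rpairing_rray: "rpairing m (rray i) = real_of_int (pr m i)"
  by (simp add: rpairing_def rray_def pairing_def)

lemma fan_cone_eq: "fan_cone ray \<sigma> = {x. \<exists>c. (\<forall>i\<in>\<sigma>. 0 \<le> c i) \<and> x = (\<Sum>i\<in>\<sigma>. c i *\<^sub>R rray i)}"
  by (simp add: fan_cone_def rray_def)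

lemma face_in_fan: "\<sigma> \<in> \<Sigma> \<Longrightarrow> \<tau> \<subseteq> \<sigma> \<Longrightarrow> \<tau> \<in> \<Sigma>"
  using fan unfolding smooth_complete_fan_def by blast

lemma ray_in_fan: "{i} \<in> \<Sigma>"
  using fan unfolding smooth_complete_fan_def by blast

lemma fan_cone_Int: "\<sigma> \<in> \<Sigma> \<Longrightarrow> \<tau> \<in> \<Sigma> \<Longrightarrow> fan_cone ray \<sigma> \<inter> fan_cone ray \<tau> = fan_cone ray (\<sigma> \<inter> \<tau>)"
  using fan unfolding smooth_complete_fan_def by blast

lemma fan_complete: "\<exists>\<sigma>\<in>\<Sigma>. x \<in> fan_cone ray \<sigma>"
proof -
  have "(\<Union>\<sigma>\<in>\<Sigma>. fan_cone ray \<sigma>) = UNIV"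
    using fan unfolding smooth_complete_fan_def by (elim conjE)
  then show ?thesis by (metis UNIV_I UN_E)
qed

lemma smooth_matrix:
  assumes "\<sigma> \<in> \<Sigma>"
  obtains M N :: "int^'d^'d" and f where "M ** N = mat 1" "N ** M = mat 1" "inj_on f \<sigma>"
    "\<And>i. i \<in> \<sigma> \<Longrightarrow> row (f i) M = ray i"
proof -
  have "smooth_cone ray \<sigma>" using fan assms unfolding smooth_complete_fan_def by blast
  then show ?thesis using that unfolding smooth_cone_def invertible_def by blast
qed

lemma dual_exists:
  assumes "\<sigma> \<in> \<Sigma>"
  shows "\<exists>e. \<forall>i\<in>\<sigma>. \<forall>k\<in>\<sigma>. pr (e i) k = (if i = k then 1 else 0)"
proof -
  obtain M N :: "int^'d^'d" and f where M: "M ** N = mat 1" "N ** M = mat 1" "inj_on f \<sigma>"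
    "\<And>i. i \<in> \<sigma> \<Longrightarrow> row (f i) M = ray i" using smooth_matrix[OF assms] by blast
  have "pr (column (f i) N) k = (if i = k then 1 else 0)" if "i \<in> \<sigma>" "k \<in> \<sigma>" for i k
  proof -
    have "pr (column (f i) N) k = (M ** N) $ f k $ f i"
      using M(4)[OF that(2), symmetric]
      by (simp add: pairing_def row_def column_def matrix_matrix_mult_def mult.commute)
    then show ?thesis using M(1,3) that by (auto simp: mat_def inj_on_def)
  qed
  then show ?thesis by (intro exI[of _ "\<lambda>i. column (f i) N"]) simp
qed

lemma pr_dual:
  assumes "\<sigma> \<in> \<Sigma>" "i \<in> \<sigma>" "k \<in> \<sigma>"
  shows "pr (dual \<sigma> i) k = (if i = k then 1 else 0)"
  using someI_ex[OF dual_exists[OF assms(1)], folded dual_def] assms by simp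

lemma max_coneD: "max_cone \<sigma> \<Longrightarrow> \<sigma> \<in> \<Sigma>"
  by (simp add: max_cone_def)

lemma max_cone_separates:
  assumes "max_cone \<sigma>" "\<And>k. k \<in> \<sigma> \<Longrightarrow> pr m k = 0"
  shows "m = 0"
proof -
  obtain M N :: "int^'d^'d" and f where M: "M ** N = mat 1" "N ** M = mat 1" "inj_on f \<sigma>"
    "\<And>i. i \<in> \<sigma> \<Longrightarrow> row (f i) M = ray i" using smooth_matrix[OF max_coneD[OF assms(1)]] by blast
  have surj: "f ` \<sigma> = UNIV"
    using M(3) assms(1) by (intro card_subset_eq) (auto simp: card_image max_cone_def)
  have "(M *v m) $ j = 0" for j
  proof -
    obtain i where i: "i \<in> \<sigma>" "j = f i" using surj by blast
    then have "(M *v m) $ j = pr m i"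
      using M(4)[OF i(1), symmetric] by (simp add: pairing_def row_def matrix_vector_mult_def mult.commute)
    then show ?thesis using assms(2) i by simp
  qed
  then have "M *v m = 0" by (simp add: vec_eq_iff)
  then have "N *v (M *v m) = 0" by (simp add: matrix_vector_mult_def vec_eq_iff)
  then show ?thesis using M(2) by (simp add: matrix_vector_mul_assoc)
qed

lemma max_cone_expand:
  assumes "max_cone \<sigma>"
  shows "x = (\<Sum>i\<in>\<sigma>. rpairing (dual \<sigma> i) x *\<^sub>R rray i)"
proof -
  have k: "(\<Sum>i\<in>\<sigma>. c i * rpairing (dual \<sigma> k) (rray i)) = c k" if "k \<in> \<sigma>" for k c
  proof -
    have "(\<Sum>i\<in>\<sigma>. c i * rpairing (dual \<sigma> k) (rray i)) = (\<Sum>i\<in>\<sigma>. if i = k then c i else 0)"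
      using that pr_dual[OF max_coneD[OF assms]] by (intro sum.cong) (auto simp: rpairing_rray)
    then show ?thesis using that by simp
  qed
  have inj: "inj_on rray \<sigma>"
  proof (rule inj_onI)
    fix i k assume ik: "i \<in> \<sigma>" "k \<in> \<sigma>" "rray i = rray k"
    have "pr (dual \<sigma> i) i = pr (dual \<sigma> i) k" using ik(3) rpairing_rray by (metis of_int_eq_iff)
    then show "i = k" using pr_dual[OF max_coneD[OF assms]] ik by (auto split: if_splits)
  qed
  have "independent (rray ` \<sigma>)"
  proof (rule real_vector.independent_if_scalars_zero)
    fix f x assume s: "(\<Sum>x\<in>rray ` \<sigma>. f x *\<^sub>R x) = 0" and "x \<in> rray ` \<sigma>"
    then obtain k where kk: "k \<in> \<sigma>" "x = rray k" by blast
    have "0 = rpairing (dual \<sigma> k) (\<Sum>i\<in>\<sigma>. f (rray i) *\<^sub>R rray i)"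
      using s inj by (simp add: sum.reindex) (simp add: rpairing_def)
    also have "\<dots> = f x" using k[OF kk(1), of "\<lambda>i. f (rray i)"] kk by (simp add: rpairing_sum rpairing_scale)
    finally show "f x = 0" by simp
  qed simp
  moreover have "card (rray ` \<sigma>) = DIM(real^'d)" using inj assms by (simp add: card_image max_cone_def)
  ultimately have "UNIV \<subseteq> span (rray ` \<sigma>)"
    using card_ge_dim_independent[of "rray ` \<sigma>" UNIV] by simp
  then obtain f where "x = (\<Sum>y\<in>rray ` \<sigma>. f y *\<^sub>R y)"
    using span_finite[of "rray ` \<sigma>"] by auto
  then have x: "x = (\<Sum>i\<in>\<sigma>. f (rray i) *\<^sub>R rray i)" using inj by (simp add: sum.reindex)
  have "rpairing (dual \<sigma> i) x = f (rray i)" if "i \<in> \<sigma>" for i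
    using k[OF that, of "\<lambda>i. f (rray i)"] by (subst x) (simp add: rpairing_sum rpairing_scale)
  then show ?thesis using x by simp
qed

lemma rpairing_dual_cone:
  assumes "\<sigma> \<in> \<Sigma>" "i \<in> \<sigma>"
  shows "rpairing (dual \<sigma> i) (\<Sum>k\<in>\<sigma>. c k *\<^sub>R rray k) = c i"
proof -
  have "rpairing (dual \<sigma> i) (\<Sum>k\<in>\<sigma>. c k *\<^sub>R rray k) = (\<Sum>k\<in>\<sigma>. if k = i then c k else 0)"
    unfolding rpairing_sum rpairing_scale rpairing_rray
    by (rule sum.cong) (use assms pr_dual in auto)
  then show ?thesis using assms by simp
qed

lemma in_max_cone_iff:
  assumes "max_cone \<sigma>"
  shows "x \<in> fan_cone ray \<sigma> \<longleftrightarrow> (\<forall>i\<in>\<sigma>. 0 \<le> rpairing (dual \<sigma> i) x)"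
  using max_cone_expand[OF assms, of x] rpairing_dual_cone[OF max_coneD[OF assms]]
  unfolding fan_cone_eq by auto

lemma closed_max_cone: "max_cone \<sigma> \<Longrightarrow> closed (fan_cone ray \<sigma>)"
proof -
  assume s: "max_cone \<sigma>"
  have "fan_cone ray \<sigma> = (\<Inter>i\<in>\<sigma>. {x. 0 \<le> rpairing (dual \<sigma> i) x})"
    using in_max_cone_iff[OF s] by auto
  moreover have "closed {x. 0 \<le> rpairing m x}" for m
    using continuous_rpairing by (intro closed_Collect_le continuous_intros) auto
  ultimately show ?thesis by auto
qed

lemma card_cone_le: "\<sigma> \<in> \<Sigma> \<Longrightarrow> card \<sigma> \<le> CARD('d)"
proof -
  assume "\<sigma> \<in> \<Sigma>"
  then obtain f :: "'n \<Rightarrow> 'd" where "inj_on f \<sigma>" using smooth_matrix by metis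
  then show ?thesis by (rule card_inj_on_le) auto
qed

text \<open>The complement of the closed union of the maximal cones is open, and by completeness it
  is covered by cones of smaller dimension. These are negligible, so it is empty.\<close>

lemma max_cones_cover: "\<exists>\<sigma>. max_cone \<sigma> \<and> x \<in> fan_cone ray \<sigma>"
proof -
  define U where "U = (\<Union>\<sigma>\<in>{\<sigma>. max_cone \<sigma>}. fan_cone ray \<sigma>)"
  have "closed U" unfolding U_def by (intro closed_UN) (auto simp: closed_max_cone)
  then have op: "open (- U)" by (rule open_Compl)
  have "- U \<subseteq> (\<Union>\<sigma>\<in>\<Sigma> - {\<sigma>. max_cone \<sigma>}. fan_cone ray \<sigma>)"
    using fan_complete by (auto simp: U_def)
  moreover have "negligible (\<Union>((\<lambda>\<sigma>. fan_cone ray \<sigma>) ` (\<Sigma> - {\<sigma>. max_cone \<sigma>})))"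
  proof (rule negligible_Union)
    fix T assume "T \<in> (\<lambda>\<sigma>. fan_cone ray \<sigma>) ` (\<Sigma> - {\<sigma>. max_cone \<sigma>})"
    then obtain \<sigma> where s: "\<sigma> \<in> \<Sigma>" "\<not> max_cone \<sigma>" "T = fan_cone ray \<sigma>" by blast
    have "card \<sigma> < CARD('d)" using card_cone_le[OF s(1)] s by (auto simp: max_cone_def)
    moreover have "T \<subseteq> span (rray ` \<sigma>)"
      unfolding s(3) fan_cone_eq by (auto intro!: span_sum span_scale intro: span_base)
    then have "dim T \<le> card (rray ` \<sigma>)" by (intro dim_le_card) auto
    moreover have "card (rray ` \<sigma>) \<le> card \<sigma>" by (rule card_image_le) simp
    ultimately show "negligible T" by (intro negligible_lowdim) simp
  qed simp
  ultimately have "negligible (- U)" by (rule negligible_subset[rotated])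
  then have "- U = {}" using open_not_negligible op by blast
  then show ?thesis by (auto simp: U_def)
qed

text \<open>The sum of the rays lies in the relative interior of \<tau>, and the two cones meet in
  the common face \<tau> \<inter> \<sigma>; by uniqueness of coordinates in \<tau> this face is all
  of \<tau>.\<close>

lemma sum_rays_in_cone:
  assumes "\<tau> \<in> \<Sigma>" "max_cone \<sigma>" "(\<Sum>i\<in>\<tau>. rray i) \<in> fan_cone ray \<sigma>"
  shows "\<tau> \<subseteq> \<sigma>"
proof
  fix i assume i: "i \<in> \<tau>"
  have "(\<Sum>i\<in>\<tau>. rray i) = (\<Sum>i\<in>\<tau>. 1 *\<^sub>R rray i)" by simp
  then have "(\<Sum>i\<in>\<tau>. rray i) \<in> fan_cone ray \<tau>"
    unfolding fan_cone_eq by (intro CollectI exI[of _ "\<lambda>_. 1"]) simp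
  then have "(\<Sum>i\<in>\<tau>. rray i) \<in> fan_cone ray (\<tau> \<inter> \<sigma>)"
    using assms fan_cone_Int max_coneD by blast
  then obtain c where c: "(\<Sum>i\<in>\<tau>. rray i) = (\<Sum>i\<in>\<tau> \<inter> \<sigma>. c i *\<^sub>R rray i)"
    unfolding fan_cone_eq by blast
  also have "\<dots> = (\<Sum>k\<in>\<tau>. (if k \<in> \<sigma> then c k else 0) *\<^sub>R rray k)"
    by (intro sum.mono_neutral_cong_left) auto
  finally have "rpairing (dual \<tau> i) (\<Sum>k\<in>\<tau>. 1 *\<^sub>R rray k) = (if i \<in> \<sigma> then c i else 0)"
    using rpairing_dual_cone[OF assms(1) i] by simp
  then show "i \<in> \<sigma>" using rpairing_dual_cone[OF assms(1) i, of "\<lambda>_. 1"] by (auto split: if_splits)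
qed

lemma cone_in_max_cone:
  assumes "\<tau> \<in> \<Sigma>"
  obtains \<sigma> where "max_cone \<sigma>" "\<tau> \<subseteq> \<sigma>"
  using max_cones_cover sum_rays_in_cone[OF assms] by blast

lemma ray_notin_max_cone:
  assumes "max_cone \<sigma>" "j \<notin> \<sigma>"
  obtains i where "i \<in> \<sigma>" "pr (dual \<sigma> i) j < 0"
proof -
  have "rray j \<notin> fan_cone ray \<sigma>"
    using sum_rays_in_cone[OF ray_in_fan assms(1), of j] assms(2) by auto
  then show ?thesis using that unfolding in_max_cone_iff[OF assms(1)] rpairing_rray by auto
qed

text \<open>Finitely many maximal cones cover a sequence of points beyond the facet opposite to
  \<open>i\<close> that converges to an interior point of the facet. One cone contains infinitely
  many of them, hence the limit, hence the facet, and it differs from \<sigma>.\<close>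

lemma neighbour:
  assumes s: "max_cone \<sigma>" and i: "i \<in> \<sigma>"
  obtains i' where "i' \<notin> \<sigma>" "max_cone (insert i' (\<sigma> - {i}))" "pr (dual \<sigma> i) i' = - 1"
proof -
  define \<tau> where "\<tau> = \<sigma> - {i}"
  have \<tau>: "\<tau> \<in> \<Sigma>" using face_in_fan[OF max_coneD[OF s]] by (auto simp: \<tau>_def)
  \<comment> \<open>The sum of the rays of the facet is its interior point; subtracting multiples of
    \<open>rray i\<close> moves it out of \<sigma>.\<close>
  define p where "p = (\<lambda>n. (\<Sum>k\<in>\<tau>. rray k) - (1 / real (Suc n)) *\<^sub>R rray i)"
  have pe: "rpairing (dual \<sigma> i) (p n) = - 1 / real (Suc n)" for n
  proof -
    have "rpairing (dual \<sigma> i) (\<Sum>k\<in>\<tau>. rray k) = 0"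
      using pr_dual[OF max_coneD[OF s] i] unfolding rpairing_sum rpairing_rray
      by (intro sum.neutral) (auto simp: \<tau>_def)
    then show ?thesis
      using pr_dual[OF max_coneD[OF s] i i] by (simp add: p_def rpairing_diff rpairing_scale rpairing_rray)
  qed
  have "\<exists>\<sigma>'\<in>{\<sigma>'. max_cone \<sigma>'}. infinite {n\<in>UNIV. p n \<in> fan_cone ray \<sigma>'}"
    by (rule pigeonhole_infinite_rel) (use max_cones_cover in auto)
  then obtain \<sigma>' where s': "max_cone \<sigma>'" and inf: "infinite {n. p n \<in> fan_cone ray \<sigma>'}" by auto
  have "(\<Sum>k\<in>\<tau>. rray k) \<in> fan_cone ray \<sigma>'"
    unfolding in_max_cone_iff[OF s']
  proof (rule ballI, rule ccontr)
    fix k assume k: "k \<in> \<sigma>'" and neg: "\<not> 0 \<le> rpairing (dual \<sigma>' k) (\<Sum>k\<in>\<tau>. rray k)"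
    define \<alpha> where "\<alpha> = rpairing (dual \<sigma>' k) (\<Sum>k\<in>\<tau>. rray k)"
    define \<beta> where "\<beta> = rpairing (dual \<sigma>' k) (rray i)"
    obtain N :: nat where N: "\<bar>\<beta>\<bar> / (- \<alpha>) < real N" using reals_Archimedean2 by blast
    obtain n where n: "n > N" "p n \<in> fan_cone ray \<sigma>'"
      using inf unfolding infinite_nat_iff_unbounded by auto
    have "0 \<le> \<alpha> - 1 / real (Suc n) * \<beta>"
      using n(2) k unfolding in_max_cone_iff[OF s'] p_def
      by (auto simp: rpairing_diff rpairing_scale \<alpha>_def \<beta>_def)
    then have "0 \<le> real (Suc n) * \<alpha> - \<beta>" by (simp add: field_simps)
    moreover have "\<bar>\<beta>\<bar> < real (Suc n) * (- \<alpha>)"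
    proof -
      have "0 < - \<alpha>" using neg by (simp add: \<alpha>_def)
      then have "\<bar>\<beta>\<bar> < real N * (- \<alpha>)" using N pos_divide_less_eq by blast
      also have "\<dots> \<le> real (Suc n) * (- \<alpha>)" using n(1) neg by (intro mult_right_mono) (auto simp: \<alpha>_def)
      finally show ?thesis .
    qed
    ultimately show False by simp
  qed
  then have sub: "\<tau> \<subseteq> \<sigma>'" by (rule sum_rays_in_cone[OF \<tau> s'])
  obtain n where n: "p n \<in> fan_cone ray \<sigma>'" using inf not_finite_existsD by auto
  have "i \<notin> \<sigma>'"
  proof
    assume "i \<in> \<sigma>'"
    then have "\<sigma> \<subseteq> \<sigma>'" using sub by (auto simp: \<tau>_def)
    then have "\<sigma> = \<sigma>'" using s s' by (intro card_subset_eq) (auto simp: max_cone_def)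
    then have "0 \<le> rpairing (dual \<sigma> i) (p n)" using n in_max_cone_iff[OF s] i by auto
    then show False unfolding pe by simp
  qed
  have "card \<tau> < card \<sigma>'" using s s' i by (simp add: \<tau>_def max_cone_def)
  then obtain i' where i': "i' \<in> \<sigma>'" "i' \<notin> \<tau>" using sub by (metis card_mono finite not_less subsetI)
  then have "i' \<notin> \<sigma>" using \<open>i \<notin> \<sigma>'\<close> by (auto simp: \<tau>_def)
  have "card (insert i' \<tau>) = card \<sigma>'"
    using i'(2) s s' i card_gt_0_iff[of \<sigma>] by (auto simp: \<tau>_def max_cone_def)
  then have eq: "insert i' \<tau> = \<sigma>'" using i'(1) sub by (intro card_subset_eq) auto
  obtain b where b: "\<And>k. k \<in> \<sigma>' \<Longrightarrow> 0 \<le> b k" "p n = (\<Sum>k\<in>\<sigma>'. b k *\<^sub>R rray k)"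
    using n unfolding fan_cone_eq by blast
  have "rpairing (dual \<sigma> i) (p n) = (\<Sum>k\<in>\<tau>. b k * rpairing (dual \<sigma> i) (rray k)) + b i' * pr (dual \<sigma> i) i'"
    unfolding b(2) eq[symmetric] using i'(2) by (simp add: rpairing_add rpairing_scale rpairing_sum rpairing_rray)
  also have "(\<Sum>k\<in>\<tau>. b k * rpairing (dual \<sigma> i) (rray k)) = 0"
    using pr_dual[OF max_coneD[OF s] i] by (intro sum.neutral) (auto simp: \<tau>_def rpairing_rray)
  finally have "- 1 / real (Suc n) = b i' * real_of_int (pr (dual \<sigma> i) i')" unfolding pe by simp
  moreover have "- 1 / real (Suc n) < 0" by (rule divide_neg_pos) auto
  ultimately have "b i' * real_of_int (pr (dual \<sigma> i) i') < 0" by linarith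
  then have neg: "pr (dual \<sigma> i) i' < 0" using b(1)[OF i'(1)] by (auto simp: mult_less_0_iff)
  \<comment> \<open>Smoothness on both sides: \<open>e\<close> vanishes on the common facet and is
    thus an integral multiple of \<open>dual \<sigma> i\<close>. At \<open>i'\<close> the factors
    multiply to 1, so the negative integer found above is -1.\<close>
  define e where "e = dual \<sigma>' i'"
  have "e - pr e i *s dual \<sigma> i = 0"
  proof (rule max_cone_separates[OF s])
    fix k assume k: "k \<in> \<sigma>"
    have "pr e k = 0" if "k \<noteq> i"
      using pr_dual[OF max_coneD[OF s'] i'(1), of k] k that sub i'(2) by (auto simp: e_def \<tau>_def)
    then show "pr (e - pr e i *s dual \<sigma> i) k = 0"
      using pr_dual[OF max_coneD[OF s] i k] by (auto simp: pairing_diff_left pairing_scale_left)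
  qed
  then have "pr e i' = pr e i * pr (dual \<sigma> i) i'"
    by (metis pairing_scale_left eq_iff_diff_eq_0)
  moreover have "pr e i' = 1" using pr_dual[OF max_coneD[OF s'] i'(1) i'(1)] by (simp add: e_def)
  ultimately have "pr e i * pr (dual \<sigma> i) i' = 1" by simp
  then have "pr (dual \<sigma> i) i' = - 1" using neg zmult_eq_1_iff by fastforce
  then show ?thesis using that \<open>i' \<notin> \<sigma>\<close> s' eq by (auto simp: \<tau>_def)
qed

end

section \<open>Degrees and vertices\<close>

text \<open>Negative entries are truncated to 0, so degrees are preserved only for nonnegative
  functions. Integer-valued functions are needed because vertices are moved by characters.\<close>

definition expo :: "('n::finite \<Rightarrow> int) \<Rightarrow> 'n \<Rightarrow>\<^sub>0 nat"
  where "expo a = Abs_poly_mapping (\<lambda>i. nat (a i))"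

lemma lookup_expo: "lookup (expo a) i = nat (a i)"
  by (simp add: expo_def)

lemma expo_lookup: "expo (\<lambda>i. int (lookup a i)) = a"
  by (rule poly_mapping_eqI) (simp add: lookup_expo)

context toric
begin

text \<open>The function \<open>vx \<sigma> w\<close> is the torus invariant divisor of class \<open>w\<close> that is trivial on the chart
  of the maximal cone \<open>\<sigma>\<close>; the elements of \<open>Pset w\<close> are the lattice points of the polytope of \<open>w\<close>,
  given by their distances to the facets, and \<open>vx \<sigma> w\<close> is its vertex belonging to \<open>\<sigma>\<close> if \<open>w\<close> is nef.\<close>

definition dg :: "('n \<Rightarrow> int) \<Rightarrow> int^'s"
  where "dg a = (\<Sum>i\<in>UNIV. a i *s grd i)"

definition vx :: "'n set \<Rightarrow> int^'s \<Rightarrow> 'n \<Rightarrow> int"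
  where "vx \<sigma> w = (SOME a. dg a = w \<and> (\<forall>i\<in>\<sigma>. a i = 0))"

definition Pset :: "int^'s \<Rightarrow> ('n \<Rightarrow> int) set"
  where "Pset w = {a. (\<forall>i. 0 \<le> a i) \<and> dg a = w}"

lemma dg_add: "dg (\<lambda>i. a i + b i) = dg a + dg b"
  by (simp add: dg_def vec.scale_left_distrib sum.distrib)

lemma dg_diff: "dg (\<lambda>i. a i - b i) = dg a - dg b"
  by (simp add: dg_def vec.scale_left_diff_distrib sum_subtractf)

lemma dg_scale: "dg (\<lambda>i. c * a i) = c *s dg a"
  by (simp add: dg_def vec_eq_iff sum_distrib_left mult.assoc)

lemma dg_eq_0_iff: "dg a = 0 \<longleftrightarrow> (\<exists>m. \<forall>i. a i = pr m i)"
proof -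
  have "\<forall>a. (\<Sum>i\<in>UNIV. a i *s grd i) = 0 \<longleftrightarrow> (\<exists>m. \<forall>i. a i = pr m i)"
    using grading unfolding picard_grading_def by (elim conjE)
  from this[THEN spec, of a] show ?thesis unfolding dg_def .
qed

lemma dg_pr: "dg (pr m) = 0"
  unfolding dg_eq_0_iff by (rule exI[of _ m]) simp

lemma dg_eq_iff: "dg a = dg b \<longleftrightarrow> (\<exists>m. \<forall>i. a i = b i + pr m i)"
proof -
  have "dg a = dg b \<longleftrightarrow> (\<exists>m. \<forall>i. a i - b i = pr m i)"
    using dg_diff[of a b] dg_eq_0_iff[of "\<lambda>i. a i - b i"] by simp
  then show ?thesis by (simp add: algebra_simps)
qed

lemma dg_surj: "\<exists>a. dg a = w"
  using grading unfolding picard_grading_def dg_def by metis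

lemma max_cone_unique:
  assumes "max_cone \<sigma>" "dg a = dg b" "\<And>i. i \<in> \<sigma> \<Longrightarrow> a i = b i"
  shows "a = b"
proof -
  obtain m where m: "\<And>i. a i = b i + pr m i" using assms(2) dg_eq_iff by blast
  then have "m = 0" using assms by (intro max_cone_separates[OF assms(1)]) force
  then show ?thesis using m by auto
qed

lemma sum_dual:
  assumes "max_cone \<sigma>" "k \<in> \<sigma>"
  shows "(\<Sum>i\<in>\<sigma>. c i * pr (dual \<sigma> i) k) = c k"
proof -
  have "(\<Sum>i\<in>\<sigma>. c i * pr (dual \<sigma> i) k) = (\<Sum>i\<in>\<sigma>. if i = k then c i else 0)"
    by (rule sum.cong) (use assms pr_dual[OF max_coneD[OF assms(1)]] in auto)
  then show ?thesis using assms(2) by simp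
qed

lemma dg_sum_dual: "dg (\<lambda>j. \<Sum>i\<in>\<sigma>. c i * pr (dual \<sigma> i) j) = 0"
proof -
  have "(\<lambda>j. \<Sum>i\<in>\<sigma>. c i * pr (dual \<sigma> i) j) = pr (\<Sum>i\<in>\<sigma>. c i *s dual \<sigma> i)"
    by (simp add: pairing_sum_left pairing_scale_left)
  then show ?thesis by (simp add: dg_pr)
qed

lemma vx_exists:
  assumes "max_cone \<sigma>"
  shows "\<exists>a. dg a = w \<and> (\<forall>i\<in>\<sigma>. a i = 0)"
proof -
  obtain b where b: "dg b = w" using dg_surj by blast
  show ?thesis
  proof (intro exI conjI ballI)
    show "dg (\<lambda>j. b j - (\<Sum>i\<in>\<sigma>. b i * pr (dual \<sigma> i) j)) = w"
      by (simp add: dg_diff dg_sum_dual b)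
    show "b k - (\<Sum>i\<in>\<sigma>. b i * pr (dual \<sigma> i) k) = 0" if "k \<in> \<sigma>" for k
      using sum_dual[OF assms that] by simp
  qed
qed

lemma dg_vx: "max_cone \<sigma> \<Longrightarrow> dg (vx \<sigma> w) = w"
  using someI_ex[OF vx_exists[of \<sigma> w], folded vx_def] by simp

lemma vx_cone: "max_cone \<sigma> \<Longrightarrow> i \<in> \<sigma> \<Longrightarrow> vx \<sigma> w i = 0"
  using someI_ex[OF vx_exists[of \<sigma> w], folded vx_def] by simp

lemma vx_eqI: "max_cone \<sigma> \<Longrightarrow> dg a = w \<Longrightarrow> (\<And>i. i \<in> \<sigma> \<Longrightarrow> a i = 0) \<Longrightarrow> a = vx \<sigma> w"
  by (rule max_cone_unique) (auto simp: dg_vx vx_cone)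

lemma vx_add: "max_cone \<sigma> \<Longrightarrow> vx \<sigma> (w + w') = (\<lambda>i. vx \<sigma> w i + vx \<sigma> w' i)"
  by (rule vx_eqI[symmetric]) (auto simp: dg_add dg_vx vx_cone)

lemma vx_scale: "max_cone \<sigma> \<Longrightarrow> vx \<sigma> (c *s w) = (\<lambda>i. c * vx \<sigma> w i)"
  by (rule vx_eqI[symmetric]) (auto simp: dg_scale dg_vx vx_cone)

lemma vx_0: "max_cone \<sigma> \<Longrightarrow> vx \<sigma> 0 = (\<lambda>i. 0)"
  by (rule vx_eqI[symmetric]) (auto simp: dg_def)

lemma vx_sum: "max_cone \<sigma> \<Longrightarrow> vx \<sigma> (\<Sum>x\<in>A. f x) i = (\<Sum>x\<in>A. vx \<sigma> (f x) i)"
  by (induction A rule: infinite_finite_induct) (simp_all add: vx_0 vx_add)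

text \<open>Affine coordinates at the vertex of \<sigma>: the values of \<open>a\<close> on \<sigma>
  are its coefficients along the edge directions.\<close>

lemma expand:
  assumes "max_cone \<sigma>" "dg a = w"
  shows "a j = vx \<sigma> w j + (\<Sum>i\<in>\<sigma>. a i * pr (dual \<sigma> i) j)"
proof -
  have "a = (\<lambda>j. vx \<sigma> w j + (\<Sum>i\<in>\<sigma>. a i * pr (dual \<sigma> i) j))"
    by (rule max_cone_unique[OF assms(1)])
      (simp_all add: dg_add dg_sum_dual dg_vx assms vx_cone sum_dual)
  then show ?thesis by metis
qed

text \<open>The vertex moves along edge \<open>i\<close> until the coordinate of \<open>i'\<close>
  vanishes. That coordinate drops by 1 per step, so the edge has lattice length
  \<open>vx \<sigma> w i'\<close>.\<close>

lemma vx_neighbour: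
  assumes "max_cone \<sigma>" "i \<in> \<sigma>" "max_cone (insert i' (\<sigma> - {i}))" "pr (dual \<sigma> i) i' = - 1"
  shows "vx (insert i' (\<sigma> - {i})) w = (\<lambda>j. vx \<sigma> w j + vx \<sigma> w i' * pr (dual \<sigma> i) j)"
proof (rule vx_eqI[OF assms(3), symmetric])
  show "dg (\<lambda>j. vx \<sigma> w j + vx \<sigma> w i' * pr (dual \<sigma> i) j) = w"
    using assms(1) by (simp add: dg_add dg_scale dg_pr dg_vx)
  fix k assume "k \<in> insert i' (\<sigma> - {i})"
  then show "vx \<sigma> w k + vx \<sigma> w i' * pr (dual \<sigma> i) k = 0"
    using assms pr_dual[OF max_coneD[OF assms(1)] assms(2), of k] by (auto simp: vx_cone)
qed

text \<open>By completeness minus the sum of all rays lies in a cone, which gives a relation among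
  the rays with all coefficients at least 1. The weighted sum of coordinates then depends on the
  class only and bounds all points of its polytope.\<close>

lemma positive_relation:
  obtains l :: "'n \<Rightarrow> real" where "\<And>i. 1 \<le> l i"
    "\<And>a b. dg a = dg b \<Longrightarrow> (\<Sum>i\<in>UNIV. l i * real_of_int (a i)) = (\<Sum>i\<in>UNIV. l i * real_of_int (b i))"
proof -
  obtain \<sigma> where s: "max_cone \<sigma>" "- (\<Sum>i\<in>UNIV. rray i) \<in> fan_cone ray \<sigma>" using max_cones_cover by blast
  then obtain c where c: "\<And>i. i \<in> \<sigma> \<Longrightarrow> 0 \<le> c i" "- (\<Sum>i\<in>UNIV. rray i) = (\<Sum>i\<in>\<sigma>. c i *\<^sub>R rray i)"
    unfolding fan_cone_eq by blast
  define l where "l = (\<lambda>i. 1 + (if i \<in> \<sigma> then c i else 0))"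
  have "(\<Sum>i\<in>UNIV. l i *\<^sub>R rray i) = (\<Sum>i\<in>UNIV. rray i) + (\<Sum>i\<in>UNIV. (if i \<in> \<sigma> then c i else 0) *\<^sub>R rray i)"
    by (simp add: l_def scaleR_add_left sum.distrib)
  also have "(\<Sum>i\<in>UNIV. (if i \<in> \<sigma> then c i else 0) *\<^sub>R rray i) = (\<Sum>i\<in>\<sigma>. c i *\<^sub>R rray i)"
    by (rule sum.mono_neutral_cong_right) auto
  finally have l0: "(\<Sum>i\<in>UNIV. l i *\<^sub>R rray i) = 0" unfolding c(2)[symmetric] by simp
  have "(\<Sum>i\<in>UNIV. l i * real_of_int (a i)) = (\<Sum>i\<in>UNIV. l i * real_of_int (b i))" if ab: "dg a = dg b" for a b
  proof -
    obtain m where m: "\<And>i. a i = b i + pr m i" using ab dg_eq_iff by blast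
    have "0 = rpairing m (\<Sum>i\<in>UNIV. l i *\<^sub>R rray i)" unfolding l0 by (simp add: rpairing_def)
    also have "\<dots> = (\<Sum>i\<in>UNIV. l i * real_of_int (pr m i))"
      by (simp add: rpairing_sum rpairing_scale rpairing_rray)
    finally show ?thesis by (simp add: m distrib_left sum.distrib)
  qed
  moreover have "1 \<le> l i" for i using c(1) by (simp add: l_def)
  ultimately show ?thesis using that by blast
qed

lemma finite_Pset: "finite (Pset w)"
proof -
  obtain l where l: "\<And>i. 1 \<le> l i"
    "\<And>a b. dg a = dg b \<Longrightarrow> (\<Sum>i\<in>UNIV. l i * real_of_int (a i)) = (\<Sum>i\<in>UNIV. l i * real_of_int (b i))"
    using positive_relation by metis
  obtain b where b: "dg b = w" using dg_surj by blast
  define N where "N = (\<Sum>i\<in>UNIV. l i * real_of_int (b i))"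
  have "a i \<in> {0..\<lceil>N\<rceil>}" if a: "a \<in> Pset w" for a i
  proof -
    have "real_of_int (a i) \<le> l i * real_of_int (a i)"
      using mult_right_mono[OF l(1)[of i], of "real_of_int (a i)"] a by (simp add: Pset_def)
    also have "\<dots> \<le> (\<Sum>i\<in>UNIV. l i * real_of_int (a i))"
    proof (rule member_le_sum)
      show "0 \<le> l x * real_of_int (a x)" for x
        using l(1)[of x] a by (intro mult_nonneg_nonneg) (auto simp: Pset_def)
    qed auto
    also have "\<dots> = N" using l(2)[of a b] a b by (simp add: Pset_def N_def)
    finally show ?thesis using a by (auto simp: Pset_def) linarith
  qed
  then have "Pset w \<subseteq> PiE UNIV (\<lambda>_. {0..\<lceil>N\<rceil>})" by (auto simp: PiE_def Pi_def)
  then show ?thesis by (rule finite_subset) (auto intro: finite_PiE)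
qed

lemma mon_deg_eq: "mon_deg grd p = dg (\<lambda>i. int (lookup p i))"
  by (simp add: mon_deg_def dg_def)

lemma mon_deg_expo: "(\<And>i. 0 \<le> a i) \<Longrightarrow> mon_deg grd (expo a) = dg a"
  by (simp add: mon_deg_eq lookup_expo)

lemma lookup_Pset: "mon_deg grd p = w \<Longrightarrow> (\<lambda>i. int (lookup p i)) \<in> Pset w"
  by (simp add: Pset_def mon_deg_eq)

lemma finite_degree: "finite {p. mon_deg grd p = w}"
proof -
  have "{p. mon_deg grd p = w} \<subseteq> expo ` Pset w"
    using lookup_Pset expo_lookup by (metis (mono_tags, lifting) image_eqI mem_Collect_eq subsetI)
  then show ?thesis using finite_Pset finite_surj by blast
qed

lemma graded_piece_span: "graded_piece grd w \<subseteq> cvec_span (xmon ` {p. mon_deg grd p = w})"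
  by (simp add: graded_piece_eq_mspace mspace_subset_span)

text \<open>Convexity of the support function, or global generation: every vertex divisor is
  effective. Given an ample class, this is nefness by \<open>convex_nef\<close> and
  \<open>nef_convex\<close>.\<close>

definition convex_class :: "int^'s \<Rightarrow> bool"
  where "convex_class w \<longleftrightarrow> (\<forall>\<sigma> j. max_cone \<sigma> \<longrightarrow> 0 \<le> vx \<sigma> w j)"

text \<open>Strict convexity of the support function, the numerical form in which ampleness is
  used.\<close>

definition strict_class :: "int^'s \<Rightarrow> bool"
  where "strict_class w \<longleftrightarrow> (\<forall>\<sigma> j. max_cone \<sigma> \<and> j \<notin> \<sigma> \<longrightarrow> 1 \<le> vx \<sigma> w j)"

lemma strict_convex: "strict_class w \<Longrightarrow> convex_class w"
  unfolding strict_class_def convex_class_def by (metis order.trans vx_cone order_refl zero_le_one)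

text \<open>Move from \<open>w\<close> towards the strictly convex \<open>v\<close> until the class becomes convex. If the vertex
  of \<open>\<sigma>\<close> then lies on the facet of a ray \<open>j \<notin> \<sigma>\<close>, all adjacent vertices are on the right side
  of this facet, so that the ray \<open>j\<close> lies in the cone \<open>\<sigma>\<close>, which is absurd.\<close>

lemma convex_of_neighbours:
  assumes v: "strict_class v"
    and w: "\<And>\<sigma> i i'. max_cone \<sigma> \<Longrightarrow> i \<in> \<sigma> \<Longrightarrow> i' \<notin> \<sigma> \<Longrightarrow> max_cone (insert i' (\<sigma> - {i})) \<Longrightarrow>
      pr (dual \<sigma> i) i' = - 1 \<Longrightarrow> 0 \<le> vx \<sigma> w i'"
  shows "convex_class w"
proof (rule ccontr)
  assume "\<not> convex_class w"
  then obtain \<sigma>0 j0 where n: "max_cone \<sigma>0" "vx \<sigma>0 w j0 < 0"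
    unfolding convex_class_def by (meson not_le)
  define P where "P = {(\<sigma>, j). max_cone \<sigma> \<and> j \<notin> \<sigma>}"
  \<comment> \<open>The multiple of \<open>v\<close> that must be added to make this one coordinate
    nonnegative; the maximum \<open>l\<close> is the moment at which \<open>w + l v\<close> becomes
    convex.\<close>
  define f where "f = (\<lambda>(\<sigma>, j). - real_of_int (vx \<sigma> w j) / real_of_int (vx \<sigma> v j))"
  define l where "l = Max (f ` P)"
  have n0: "(\<sigma>0, j0) \<in> P" using n vx_cone by (force simp: P_def)
  have fin: "finite (f ` P)" by simp
  have "0 < real_of_int (vx \<sigma>0 v j0)" using v n(1) n0 by (force simp: strict_class_def P_def)
  then have "f (\<sigma>0, j0) > 0" unfolding f_def prod.case using n(2) by (intro divide_pos_pos) auto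
  then have lpos: "l > 0" using n0 fin unfolding l_def by (meson Max_ge image_eqI less_le_trans)
  have "l \<in> f ` P" using n0 fin unfolding l_def by (intro Max_in) auto
  then obtain \<sigma> j where sj: "max_cone \<sigma>" "j \<notin> \<sigma>" "l = f (\<sigma>, j)" by (auto simp: P_def)
  define D where "D = (\<lambda>\<sigma> j. real_of_int (vx \<sigma> w j) + l * real_of_int (vx \<sigma> v j))"
  have Dnn: "0 \<le> D \<tau> k" if "max_cone \<tau>" for \<tau> k
  proof (cases "k \<in> \<tau>")
    case True
    then show ?thesis using that by (simp add: D_def vx_cone)
  next
    case False
    then have "f (\<tau>, k) \<le> l" using fin that unfolding l_def by (intro Max_ge) (auto simp: P_def)
    moreover have "0 < real_of_int (vx \<tau> v k)" using v that False by (force simp: strict_class_def)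
    ultimately show ?thesis by (simp add: f_def D_def field_simps)
  qed
  have "0 < real_of_int (vx \<sigma> v j)" using v sj by (force simp: strict_class_def)
  then have D0: "D \<sigma> j = 0" by (simp add: D_def sj(3) f_def)
  obtain i where i: "i \<in> \<sigma>" "pr (dual \<sigma> i) j < 0" using ray_notin_max_cone sj by blast
  obtain i' where i': "i' \<notin> \<sigma>" "max_cone (insert i' (\<sigma> - {i}))" "pr (dual \<sigma> i) i' = - 1"
    using neighbour[OF sj(1) i(1)] .
  have "0 < real_of_int (vx \<sigma> v i')" using v sj(1) i'(1) by (force simp: strict_class_def)
  then have t: "D \<sigma> i' > 0"
    using w[OF sj(1) i(1) i'] lpos by (simp add: D_def add_nonneg_pos)
  have "D (insert i' (\<sigma> - {i})) j = D \<sigma> j + D \<sigma> i' * real_of_int (pr (dual \<sigma> i) j)"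
    by (simp add: D_def vx_neighbour[OF sj(1) i(1) i'(2,3)] algebra_simps)
  also have "\<dots> < 0" using t i(2) D0 by (simp add: mult_pos_neg)
  finally show False using Dnn[OF i'(2), of j] by simp
qed

end

section \<open>Ample classes\<close>

lemma eval_poly_nonzero_key:
  assumes "eval_poly f (\<lambda>i. if i \<in> \<sigma> then 0 else 1) \<noteq> 0"
  obtains a where "a \<in> keys f" "keys a \<inter> \<sigma> = {}"
proof -
  obtain a where a: "a \<in> keys f" "(\<Prod>i\<in>keys a. (if i \<in> \<sigma> then 0 else 1 :: complex) ^ lookup a i) \<noteq> 0"
    using assms unfolding eval_poly_def by (metis (no_types, lifting) mult_zero_right sum.neutral)
  have "i \<notin> \<sigma>" if i: "i \<in> keys a" for i
  proof -
    have "(if i \<in> \<sigma> then 0 else 1 :: complex) ^ lookup a i \<noteq> 0" using a(2) i by (meson finite_keys prod_zero)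
    then show ?thesis using i by (auto simp: in_keys_iff)
  qed
  then show ?thesis using that a(1) by blast
qed

lemma keys_var_act:
  assumes "b \<in> keys (var i \<diamondop> f)"
  obtains a where "a \<in> keys f" "a = b + Poly_Mapping.single i 1"
proof -
  define e where "e = Poly_Mapping.single i (1 :: nat)"
  define t where "t = (\<lambda>b. if \<forall>k. lookup e k \<le> lookup b k
     then Poly_Mapping.single (b - e)
            (lookup (var i) e * lookup f b *
             (\<Prod>k\<in>UNIV. fact (lookup b k) / fact (lookup b k - lookup e k)))
     else 0)"
  have "var i \<diamondop> f = (\<Sum>b\<in>keys f. t b)"
  proof -
    have "keys (var i :: 'a cpoly) = {e}" unfolding var_def e_def by (rule keys_single[THEN trans]) simp
    then show ?thesis unfolding act_def t_def by (simp only: sum.insert[OF finite.emptyI] sum.empty empty_iff not_False_eq_True add_0_right)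
  qed
  then have "b \<in> (\<Union>a\<in>keys f. keys (t a))" using assms keys_sum[of t "keys f"] by auto
  then obtain a where a: "a \<in> keys f" "b \<in> keys (t a)" by blast
  have le: "\<forall>k. lookup e k \<le> lookup a k" using a(2) by (auto simp: t_def split: if_splits)
  then have "b = a - e" using a(2) by (auto simp: t_def split: if_splits)
  then have "a = b + e" using le by (intro poly_mapping_eqI) (simp add: lookup_add lookup_minus)
  then show ?thesis using that a(1) by (simp add: e_def)
qed

lemma prod_var: "finite A \<Longrightarrow> (\<Prod>i\<in>A. var i) = xmon (\<Sum>i\<in>A. Poly_Mapping.single i 1)"
  by (induction A rule: finite_induct) (simp_all add: var_def mult_single)

lemma prod_var_expo:
  "(\<Prod>i\<in>-\<sigma>. var i) = (xmon (expo (\<lambda>i. if i \<in> \<sigma> then 0 else 1)) :: 'n::finite cpoly)"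
proof -
  have "(\<Sum>i\<in>-\<sigma>. Poly_Mapping.single i 1) = expo (\<lambda>i :: 'n. if i \<in> \<sigma> then 0 else 1)"
    by (rule poly_mapping_eqI)
      (auto simp: lookup_sum lookup_single when_def lookup_expo)
  then show ?thesis by (simp add: prod_var)
qed

lemma expo_add: "(\<And>i. 0 \<le> a i) \<Longrightarrow> (\<And>i. 0 \<le> b i) \<Longrightarrow> expo (\<lambda>i. a i + b i) = expo a + expo b"
  by (rule poly_mapping_eqI) (simp add: lookup_expo lookup_add nat_add_distrib)

text \<open>The monomial that is nonzero exactly on the affine chart of \<sigma>. Over the cones of
  the fan these monomials generate the irrelevant ideal.\<close>

definition bmon :: "'n::finite set \<Rightarrow> 'n cpoly"
  where "bmon \<sigma> = xmon (expo (\<lambda>i. if i \<in> \<sigma> then 0 else 1))"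

lemma bmon_power: "bmon \<sigma> ^ N = xmon (expo (\<lambda>i. if i \<in> \<sigma> then 0 else int N))"
proof (induction N)
  case 0
  have "expo (\<lambda>i. if i \<in> \<sigma> then 0 else int 0) = 0"
    by (rule poly_mapping_eqI) (simp add: lookup_expo)
  then show ?case by simp
next
  case (Suc N)
  have "expo (\<lambda>i. if i \<in> \<sigma> then 0 else int (Suc N))
      = expo (\<lambda>i. (if i \<in> \<sigma> then 0 else 1) + (if i \<in> \<sigma> then 0 else int N))"
    by (rule arg_cong[of _ _ expo]) auto
  also have "\<dots> = expo (\<lambda>i. if i \<in> \<sigma> then 0 else 1) + expo (\<lambda>i. if i \<in> \<sigma> then 0 else int N)"
    by (rule expo_add) auto
  finally show ?case using Suc by (simp add: bmon_def xmon_mult)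
qed

lemma xmon_dvd_bmon_power:
  assumes "keys a \<inter> \<sigma> = {}"
  obtains N where "xmon a dvd bmon \<sigma> ^ N"
proof -
  define N where "N = (\<Sum>i\<in>UNIV. lookup a i)"
  have le: "lookup a i \<le> N" for i unfolding N_def by (rule member_le_sum) auto
  have "expo (\<lambda>i. if i \<in> \<sigma> then 0 else int N) = a + (expo (\<lambda>i. if i \<in> \<sigma> then 0 else int N) - a)"
  proof (rule poly_mapping_eqI)
    fix k
    have "k \<in> \<sigma> \<Longrightarrow> lookup a k = 0" using assms by (auto simp: in_keys_iff)
    then show "lookup (expo (\<lambda>i. if i \<in> \<sigma> then 0 else int N)) k
        = lookup (a + (expo (\<lambda>i. if i \<in> \<sigma> then 0 else int N) - a)) k"
      using le[of k] by (simp add: lookup_add lookup_minus lookup_expo)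
  qed
  then have "bmon \<sigma> ^ N = xmon a * xmon (expo (\<lambda>i. if i \<in> \<sigma> then 0 else int N) - a)"
    unfolding bmon_power xmon_mult by simp
  then show ?thesis using that by (metis dvd_triv_left)
qed

lemma irrelevant_ideal_eq: "irrelevant_ideal \<Sigma> = ideal_gen (bmon ` \<Sigma>)"
  unfolding irrelevant_ideal_def prod_var_expo bmon_def by (rule arg_cong[of _ _ ideal_gen]) auto

lemma bmon_in_irrelevant: "\<sigma> \<in> \<Sigma> \<Longrightarrow> bmon \<sigma> \<in> irrelevant_ideal \<Sigma>"
  unfolding irrelevant_ideal_eq by (rule ring_ideal.span_base) simp

lemma bmon_dvd: "\<tau> \<subseteq> \<sigma> \<Longrightarrow> bmon \<sigma> dvd bmon \<tau>"
proof -
  assume s: "\<tau> \<subseteq> \<sigma>"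
  have "expo (\<lambda>i. if i \<in> \<tau> then 0 else 1)
      = expo (\<lambda>i. (if i \<in> \<sigma> then 0 else 1) + (if i \<in> \<sigma> - \<tau> then 1 else 0))"
    by (rule arg_cong[of _ _ expo]) (use s in \<open>auto intro!: ext\<close>)
  also have "\<dots> = expo (\<lambda>i. if i \<in> \<sigma> then 0 else 1) + expo (\<lambda>i. if i \<in> \<sigma> - \<tau> then 1 else 0)"
    by (rule expo_add) auto
  finally show ?thesis unfolding bmon_def xmon_mult[symmetric] by (metis dvd_triv_left xmon_mult)
qed

context toric
begin

lemma fixed_point_in_cox_space:
  assumes "\<sigma> \<in> \<Sigma>"
  shows "(\<lambda>i. if i \<in> \<sigma> then 0 else 1) \<in> cox_space \<Sigma>"
proof -
  have "eval_poly (bmon \<sigma>) (\<lambda>i. if i \<in> \<sigma> then 0 else 1) = 1"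
    by (auto simp: eval_poly_def bmon_def in_keys_iff lookup_expo intro!: prod.neutral split: if_splits)
  then show ?thesis unfolding cox_space_def
    by (intro CollectI bexI[OF _ bmon_in_irrelevant[OF assms]]) simp
qed

text \<open>Tangent vectors at the torus fixed point of \<open>\<sigma>\<close> are separated, so that the lattice points
  next to the vertex on the edges starting there belong to the polytope of \<open>w\<close>.\<close>

lemma very_ample_edge:
  assumes w: "very_ample ray \<Sigma> grd w" and s: "max_cone \<sigma>" and i: "i \<in> \<sigma>"
  shows "0 \<le> vx \<sigma> w j + pr (dual \<sigma> i) j"
proof -
  define \<xi> where "\<xi> = (\<lambda>i. if i \<in> \<sigma> then 0 else 1 :: complex)"
  define \<omega> where "\<omega> = (\<lambda>k. if k = i then 1 else 0 :: complex)"
  have dd: "dir_deriv f \<xi> \<omega> = eval_poly (var i \<diamondop> f) \<xi>" for f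
  proof -
    have "dir_deriv f \<xi> \<omega> = (\<Sum>k\<in>UNIV. if k = i then eval_poly (var k \<diamondop> f) \<xi> else 0)"
      unfolding dir_deriv_def \<omega>_def by (rule sum.cong) auto
    then show ?thesis by simp
  qed
  have sep: "\<forall>\<xi>\<in>cox_space \<Sigma>. \<forall>\<omega>.
       (\<exists>c. \<forall>f\<in>graded_piece grd w. dir_deriv f \<xi> \<omega> = c * eval_poly f \<xi>)
       \<longrightarrow> (\<exists>l\<in>cox_lie ray. \<omega> = (\<lambda>i. l i * \<xi> i))"
    using w unfolding very_ample_def by (elim conjE)
  have "\<not> (\<exists>l\<in>cox_lie ray. \<omega> = (\<lambda>i. l i * \<xi> i))"
  proof
    assume "\<exists>l\<in>cox_lie ray. \<omega> = (\<lambda>i. l i * \<xi> i)"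
    then obtain l where "\<omega> i = l i * \<xi> i" by (metis (mono_tags))
    then show False using i by (simp add: \<omega>_def \<xi>_def)
  qed
  moreover have "\<xi> \<in> cox_space \<Sigma>" unfolding \<xi>_def using fixed_point_in_cox_space[OF max_coneD[OF s]] .
  ultimately have "\<not> (\<exists>c. \<forall>f\<in>graded_piece grd w. dir_deriv f \<xi> \<omega> = c * eval_poly f \<xi>)"
    using sep by blast
  \<comment> \<open>Taking the factor \<open>c\<close> to be 0 gives a section with nonzero
    derivative. One of its monomials has degree 1 in the variable \<open>i\<close> and involves no
    other variable of \<sigma>: it is the lattice point next to the vertex on edge
    \<open>i\<close>.\<close>
  then obtain f where f: "f \<in> graded_piece grd w" "dir_deriv f \<xi> \<omega> \<noteq> 0 * eval_poly f \<xi>" by metis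
  then have "eval_poly (var i \<diamondop> f) \<xi> \<noteq> 0" by (simp add: dd)
  then obtain b where b: "b \<in> keys (var i \<diamondop> f)" "keys b \<inter> \<sigma> = {}"
    unfolding \<xi>_def by (rule eval_poly_nonzero_key)
  obtain a where a: "a \<in> keys f" "a = b + Poly_Mapping.single i 1" using keys_var_act[OF b(1)] .
  have dga: "dg (\<lambda>i. int (lookup a i)) = w" using a(1) f(1) by (simp add: graded_piece_def mon_deg_eq)
  have la: "int (lookup a k) = (if k = i then 1 else 0)" if "k \<in> \<sigma>" for k
    using b(2) that a(2) by (auto simp: lookup_add lookup_single when_def in_keys_iff)
  have "int (lookup a j) = vx \<sigma> w j + (\<Sum>k\<in>\<sigma>. int (lookup a k) * pr (dual \<sigma> k) j)"
    by (rule expand[OF s dga])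
  also have "(\<Sum>k\<in>\<sigma>. int (lookup a k) * pr (dual \<sigma> k) j)
      = (\<Sum>k\<in>\<sigma>. if k = i then pr (dual \<sigma> i) j else 0)"
    by (rule sum.cong) (auto simp: la)
  also have "\<dots> = pr (dual \<sigma> i) j" using i by simp
  finally show ?thesis by (metis of_nat_0_le_iff)
qed

text \<open>Since the ray \<open>j\<close> is outside \<sigma>, its coordinate decreases along some
  edge. The next lattice point on this edge is still in the polytope of a very ample multiple, so
  the coordinate is positive at the vertex.\<close>

lemma ample_strict:
  assumes "ample ray \<Sigma> grd v"
  shows "strict_class v"
  unfolding strict_class_def
proof (intro allI impI)
  fix \<sigma> j assume "max_cone \<sigma> \<and> j \<notin> \<sigma>"
  then have s: "max_cone \<sigma>" "j \<notin> \<sigma>" by auto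
  obtain k :: nat where k: "k > 0" "very_ample ray \<Sigma> grd (int k *s v)"
    using assms by (auto simp: ample_def)
  obtain i where i: "i \<in> \<sigma>" "pr (dual \<sigma> i) j < 0" using ray_notin_max_cone[OF s] .
  have "0 < int k * vx \<sigma> v j"
    using very_ample_edge[OF k(2) s(1) i(1), of j] i(2) by (simp add: vx_scale[OF s(1)])
  then show "1 \<le> vx \<sigma> v j" using k(1) by (simp add: zero_less_mult_iff)
qed

section \<open>Hilbert functions under multiplication by a nonzerodivisor\<close>

lemma HF_mult:
  assumes I: "is_ideal I" and f: "f \<in> graded_piece grd d"
    and nzd: "\<And>g. g \<in> graded_piece grd w \<Longrightarrow> f * g \<in> I \<Longrightarrow> g \<in> I"
  shows "\<exists>E. E \<subseteq> graded_piece grd w \<and> card E = HF grd I w \<and>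
    inj_on ((*) f) E \<and>
    independent_mod (\<lambda>c p. const c * p) (graded_piece grd (w + d) \<inter> I) ((*) f ` E)"
proof -
  have sub: "cvec_subspace (graded_piece grd w \<inter> I)"
    unfolding graded_piece_eq_mspace
    by (intro cvec.subspace_inter cvec_subspace_mspace ideal_cvec_subspace I)
  \<comment> \<open>\<open>E\<close> lifts a basis of (S/I)_w; the hypothesis \<open>nzd\<close>
    carries its independence over to degree \<open>w + d\<close>.\<close>
  obtain E where E: "E \<subseteq> graded_piece grd w" "independent_mod (\<lambda>c p. const c * p) (graded_piece grd w \<inter> I) E"
      "card E + cvec_dim (graded_piece grd w \<inter> I) = cvec_dim (graded_piece grd w)"
      "\<And>g. g \<in> graded_piece grd w \<Longrightarrow> \<exists>c. g - (\<Sum>e\<in>E. const (c e) * e) \<in> graded_piece grd w \<inter> I"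
    by (rule cvec.exists_complement[OF sub Int_lower1 graded_piece_span finite_imageI[OF finite_degree]])
      (rule that, assumption+)
  have fE: "finite E" using E(2) by (simp add: independent_mod_def)
  have inj: "inj_on ((*) f) E"
  proof (rule inj_onI, rule ccontr)
    fix x y assume xy: "x \<in> E" "y \<in> E" "f * x = f * y" "x \<noteq> y"
    define c where "c = (\<lambda>e. if e = x then 1 else if e = y then - 1 else 0 :: complex)"
    have "(\<Sum>e\<in>E. const (c e) * e) = (\<Sum>e\<in>{x, y}. const (c e) * e)"
      using xy fE by (intro sum.mono_neutral_right) (auto simp: c_def const_def)
    also have "\<dots> = x + const (-1) * y" using xy(4) by (simp add: c_def const_1)
    also have "const (-1) * y = - y"
      by (intro poly_mapping_eqI) (simp add: lookup_const_mult)
    finally have s: "(\<Sum>e\<in>E. const (c e) * e) = x - y" by simp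
    have gp: "x - y \<in> graded_piece grd w"
      using xy E(1) cvec.subspace_diff[OF cvec_subspace_mspace] unfolding graded_piece_eq_mspace by blast
    moreover have "f * (x - y) = 0" using xy(3) by (simp add: right_diff_distrib)
    then have "x - y \<in> I" using nzd[OF gp] I by (simp add: is_ideal_iff)
    ultimately have "(\<Sum>e\<in>E. const (c e) * e) \<in> graded_piece grd w \<inter> I" using s by simp
    then have "\<forall>e\<in>E. c e = 0" using E(2) unfolding independent_mod_def by blast
    then show False using xy(1) by (auto simp: c_def)
  qed
  have "independent_mod (\<lambda>c p. const c * p) (graded_piece grd (w + d) \<inter> I) ((*) f ` E)"
    unfolding independent_mod_def
  proof (intro conjI allI impI)
    show "finite ((*) f ` E)" using fE by simp
    fix c assume c: "(\<Sum>e\<in>(*) f ` E. const (c e) * e) \<in> graded_piece grd (w + d) \<inter> I"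
    have "(\<Sum>e\<in>(*) f ` E. const (c e) * e) = (\<Sum>e\<in>E. const (c (f * e)) * (f * e))"
      using inj by (simp add: sum.reindex)
    also have "\<dots> = f * (\<Sum>e\<in>E. const (c (f * e)) * e)"
      unfolding sum_distrib_left by (rule sum.cong[OF refl], rule mult.left_commute)
    finally have fI: "f * (\<Sum>e\<in>E. const (c (f * e)) * e) \<in> I" using c by simp
    have "(\<Sum>e\<in>E. const (c (f * e)) * e) \<in> graded_piece grd w"
      using E(1) unfolding graded_piece_eq_mspace
      by (intro cvec.subspace_sum[OF cvec_subspace_mspace] cvec.subspace_scale[OF cvec_subspace_mspace]) blast
    then have "(\<Sum>e\<in>E. const (c (f * e)) * e) \<in> graded_piece grd w \<inter> I" using nzd fI by blast
    then have "\<forall>e\<in>E. c (f * e) = 0"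
      using E(2)[unfolded independent_mod_def, THEN conjunct2, THEN spec[of _ "\<lambda>e. c (f * e)"]] by blast
    then show "\<forall>e\<in>(*) f ` E. c e = 0" by blast
  qed
  moreover note inj
  moreover have "card E = HF grd I w" using E(3) by (simp add: HF_def)
  ultimately show ?thesis using E(1) by blast
qed

lemma dim_ideal_le: "cvec_dim (graded_piece grd w \<inter> I) \<le> cvec_dim (graded_piece grd w)"
  using cvec.dim_mono_of_span[OF inf_le1 graded_piece_span] finite_degree by blast

lemma subspace_ideal_piece: "is_ideal I \<Longrightarrow> cvec_subspace (graded_piece grd w \<inter> I)"
  unfolding graded_piece_eq_mspace
  by (intro cvec.subspace_inter cvec_subspace_mspace ideal_cvec_subspace)

text \<open>Multiplication by \<open>f\<close> is injective from (S/I)_w to (S/I)_(w+d). If the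
  target is not larger, it is also surjective.\<close>

lemma HF_mono:
  assumes I: "is_ideal I" and f: "f \<in> graded_piece grd d"
    and nzd: "\<And>g. g \<in> graded_piece grd w \<Longrightarrow> f * g \<in> I \<Longrightarrow> g \<in> I"
  shows "HF grd I w \<le> HF grd I (w + d)"
    and "HF grd I (w + d) \<le> HF grd I w \<Longrightarrow> g \<in> graded_piece grd (w + d) \<Longrightarrow>
      \<exists>h\<in>graded_piece grd w. g - f * h \<in> I"
proof -
  obtain E where E: "E \<subseteq> graded_piece grd w" "card E = HF grd I w" "inj_on ((*) f) E"
    "independent_mod (\<lambda>c p. const c * p) (graded_piece grd (w + d) \<inter> I) ((*) f ` E)"
    using HF_mult[OF I f nzd] by blast
  have fE: "(*) f ` E \<subseteq> graded_piece grd (w + d)"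
    using E(1) mult_graded_piece[OF f, of _ w] by (auto simp: add.commute[of d w])
  have fin: "finite (xmon ` {p. mon_deg grd p = w'})" for w' using finite_degree by blast
  have "card ((*) f ` E) + cvec_dim (graded_piece grd (w + d) \<inter> I) \<le> cvec_dim (graded_piece grd (w + d))"
    using cvec.card_independent_mod_le[OF E(4) subspace_ideal_piece[OF I] fE _ graded_piece_span fin] by simp
  then show "HF grd I w \<le> HF grd I (w + d)" using E(2) card_image[OF E(3)] by (simp add: HF_def)
  assume le: "HF grd I (w + d) \<le> HF grd I w" and g: "g \<in> graded_piece grd (w + d)"
  have "cvec_dim (graded_piece grd (w + d)) \<le> card ((*) f ` E) + cvec_dim (graded_piece grd (w + d) \<inter> I)"
    unfolding card_image[OF E(3)] using le E(2) by (simp add: HF_def)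
  then obtain c where c: "g - (\<Sum>e\<in>(*) f ` E. const (c e) * e) \<in> graded_piece grd (w + d) \<inter> I"
    using cvec.independent_mod_spans[OF E(4) subspace_ideal_piece[OF I] fE _ graded_piece_span fin _ g] by auto
  have "(\<Sum>e\<in>(*) f ` E. const (c e) * e) = (\<Sum>e\<in>E. const (c (f * e)) * (f * e))"
    using E(3) by (simp add: sum.reindex)
  also have "\<dots> = f * (\<Sum>e\<in>E. const (c (f * e)) * e)"
    unfolding sum_distrib_left by (rule sum.cong[OF refl], rule mult.left_commute)
  finally have "g - f * (\<Sum>e\<in>E. const (c (f * e)) * e) \<in> I" using c by simp
  moreover have "(\<Sum>e\<in>E. const (c (f * e)) * e) \<in> graded_piece grd w"
    using E(1) unfolding graded_piece_eq_mspace
    by (intro cvec.subspace_sum[OF cvec_subspace_mspace] cvec.subspace_scale[OF cvec_subspace_mspace]) blast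
  ultimately show "\<exists>h\<in>graded_piece grd w. g - f * h \<in> I" by blast
qed

end

section \<open>Nef classes and torus invariant curves\<close>

text \<open>The ideal of the orbit closure of the cone \<open>\<tau>\<close>.\<close>

definition coord_ideal :: "'n::finite set \<Rightarrow> 'n cpoly set"
  where "coord_ideal \<tau> = mspace {a. keys a \<inter> \<tau> \<noteq> {}}"

lemma keys_nat_add: "keys (a + b) = keys a \<union> keys (b :: 'n \<Rightarrow>\<^sub>0 nat)"
  by (auto simp: in_keys_iff lookup_add)

lemma coord_ideal_ideal: "is_ideal (coord_ideal \<tau>)"
  unfolding is_ideal_iff
proof (intro conjI ballI allI)
  show "0 \<in> coord_ideal \<tau>" by (simp add: coord_ideal_def mspace_def)
  show "f + g \<in> coord_ideal \<tau>" if "f \<in> coord_ideal \<tau>" "g \<in> coord_ideal \<tau>" for f g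
    using that cvec.subspace_add[OF cvec_subspace_mspace] unfolding coord_ideal_def by blast
  show "h * f \<in> coord_ideal \<tau>" if "f \<in> coord_ideal \<tau>" for h f
    using that keys_mult[of h f] unfolding coord_ideal_def mspace_def by (fastforce simp: keys_nat_add)
qed

lemma coord_ideal_homogeneous: "homogeneous_ideal grd (coord_ideal \<tau>)"
  unfolding homogeneous_ideal_def
  by (auto simp: coord_ideal_ideal)
    (auto simp: coord_ideal_def mspace_def in_keys_iff lookup_hcomponent subset_iff split: if_splits)

text \<open>The quotient is the polynomial ring in the variables outside \<tau>, a domain;
  \<open>r\<close> is the projection to it.\<close>

lemma coord_ideal_prime:
  assumes "f * g \<in> coord_ideal \<tau>"
  shows "f \<in> coord_ideal \<tau> \<or> g \<in> coord_ideal \<tau>"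
proof -
  define r where "r = (\<lambda>f :: 'a cpoly. \<Sum>a | a \<in> keys f \<and> keys a \<inter> \<tau> = {}. Poly_Mapping.single a (lookup f a))"
  have lr: "lookup (r f) a = (if keys a \<inter> \<tau> = {} then lookup f a else 0)" for f a
  proof -
    have "lookup (r f) a = (\<Sum>b | b \<in> keys f \<and> keys b \<inter> \<tau> = {}. if b = a then lookup f b else 0)"
      by (auto simp: r_def lookup_sum lookup_single when_def intro!: sum.cong)
    also have "\<dots> = (if keys a \<inter> \<tau> = {} then lookup f a else 0)" by (simp add: in_keys_iff)
    finally show ?thesis .
  qed
  have rem: "f - r f \<in> coord_ideal \<tau>" for f
    by (auto simp: coord_ideal_def mspace_def in_keys_iff lookup_minus lr split: if_splits)
  note id = coord_ideal_ideal[of \<tau>]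
  have "f * g - r f * r g = (f - r f) * g + r f * (g - r g)" by (simp add: algebra_simps)
  also have "\<dots> \<in> coord_ideal \<tau>"
    by (intro ideal_add[OF id] ideal_mult_right[OF id rem] ideal_mult_left[OF id rem])
  finally have "f * g - (f * g - r f * r g) \<in> coord_ideal \<tau>" using ideal_diff[OF id assms] by blast
  then have m: "r f * r g \<in> coord_ideal \<tau>" by simp
  have off: "keys a \<inter> \<tau> = {}" if "a \<in> keys (r f * r g)" for a
    using that keys_mult[of "r f" "r g"] by (force simp: in_keys_iff lr lookup_add split: if_splits)
  have "keys (r f * r g) = {}" using m off unfolding coord_ideal_def mspace_def by blast
  then have "r f = 0 \<or> r g = 0" using cpoly_mult_eq_0 by simp
  then show ?thesis using rem[of f] rem[of g] by auto
qed

lemma xmon_in_coord_ideal: "xmon a \<in> coord_ideal \<tau> \<longleftrightarrow> keys a \<inter> \<tau> \<noteq> {}"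
  by (simp add: coord_ideal_def mspace_def)

context toric
begin

lemma coord_ideal_relevant:
  assumes "\<sigma> \<in> \<Sigma>"
  shows "relevant_prime \<Sigma> grd (coord_ideal \<sigma>)"
proof -
  have b: "bmon \<sigma> \<notin> coord_ideal \<sigma>"
    by (auto simp: bmon_def xmon_in_coord_ideal in_keys_iff lookup_expo split: if_splits)
  then show ?thesis
    unfolding relevant_prime_def
    using coord_ideal_homogeneous coord_ideal_prime bmon_in_irrelevant[OF assms] by blast
qed

text \<open>The closed subset defined by \<open>P\<close> meets the chart of some maximal cone, as
  some generator of the irrelevant ideal is outside \<open>P\<close> and enlarging the cone replaces
  it by a divisor.\<close>

lemma relevant_max_cone:
  assumes P: "relevant_prime \<Sigma> grd P"
  obtains \<sigma> where "max_cone \<sigma>" "bmon \<sigma> \<notin> P"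
proof -
  have id: "is_ideal P" using P by (simp add: relevant_prime_def homogeneous_ideal_def)
  have "\<not> bmon ` \<Sigma> \<subseteq> P"
    using P ring_ideal.span_minimal[of "bmon ` \<Sigma>" P] id unfolding relevant_prime_def irrelevant_ideal_eq by blast
  then obtain \<tau> where \<tau>: "\<tau> \<in> \<Sigma>" "bmon \<tau> \<notin> P" by blast
  obtain \<sigma> where s: "max_cone \<sigma>" "\<tau> \<subseteq> \<sigma>" using cone_in_max_cone[OF \<tau>(1)] .
  have "bmon \<sigma> \<notin> P" using bmon_dvd[OF s(2)] \<tau>(2) ideal_mult_right[OF id] by (metis dvdE)
  then show ?thesis using that s(1) by blast
qed

text \<open>Such a monomial is invertible on the chart of \<sigma>, which the closed subset of
  \<open>P\<close> meets.\<close>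

lemma relevant_xmon:
  assumes P: "relevant_prime \<Sigma> grd P" and b: "bmon \<sigma> \<notin> P" and a: "keys a \<inter> \<sigma> = {}"
  shows "xmon a \<notin> P"
proof
  assume x: "xmon a \<in> P"
  have id: "is_ideal P" and prime: "\<And>f g. f * g \<in> P \<Longrightarrow> f \<in> P \<or> g \<in> P" and ne: "P \<noteq> UNIV"
    using P by (auto simp: relevant_prime_def homogeneous_ideal_def)
  obtain N where "xmon a dvd bmon \<sigma> ^ N" using xmon_dvd_bmon_power[OF a] .
  then have N: "bmon \<sigma> ^ N \<in> P" using x ideal_mult_right[OF id] by (metis dvdE)
  have "bmon \<sigma> ^ n \<notin> P" for n
  proof (induction n)
    case 0
    show ?case
    proof
      assume "bmon \<sigma> ^ 0 \<in> P"
      then have "f \<in> P" for f using ideal_mult_left[OF id, of 1 f] by simp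
      then show False using ne by auto
    qed
  next
    case (Suc n)
    then show ?case using prime[of "bmon \<sigma>" "bmon \<sigma> ^ n"] b by auto
  qed
  then show False using N by blast
qed

text \<open>For a convex class this is the section without zeros on the chart of \<sigma>.\<close>

definition vmon :: "'n set \<Rightarrow> int^'s \<Rightarrow> 'n cpoly"
  where "vmon \<sigma> w = xmon (expo (vx \<sigma> w))"

lemma keys_expo_vx: "max_cone \<sigma> \<Longrightarrow> keys (expo (vx \<sigma> w)) \<inter> \<sigma> = {}"
  by (auto simp: in_keys_iff lookup_expo vx_cone)

lemma vmon_graded:
  assumes "max_cone \<sigma>" "\<And>j. 0 \<le> vx \<sigma> w j"
  shows "vmon \<sigma> w \<in> graded_piece grd w"
  using assms by (simp add: vmon_def xmon_in_graded_piece mon_deg_expo dg_vx)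

text \<open>Some vertex monomial of \<open>w\<close> does not vanish identically on the curve.
  Multiplication by it is injective on S/P, so the difference of Hilbert functions defining
  \<open>e\<close> is nonnegative.\<close>

lemma convex_nef:
  assumes "convex_class w"
  shows "nef ray \<Sigma> grd w"
  unfolding nef_def
proof (intro allI impI)
  fix P e assume "irreducible_curve \<Sigma> grd P \<and> intersection_number ray \<Sigma> grd w P e"
  then have P: "relevant_prime \<Sigma> grd P" and "intersection_number ray \<Sigma> grd w P e"
    by (auto simp: irreducible_curve_def)
  then obtain A where "\<forall>\<^sub>F k in sequentially.
         int (HF grd P (w + int k *s A)) - int (HF grd P (int k *s A)) = e"
    by (auto simp: intersection_number_def)
  then obtain k :: nat where k: "int (HF grd P (w + int k *s A)) - int (HF grd P (int k *s A)) = e"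
    unfolding eventually_sequentially by blast
  have id: "is_ideal P" and prime: "\<And>f g. f * g \<in> P \<Longrightarrow> f \<in> P \<or> g \<in> P"
    using P by (auto simp: relevant_prime_def homogeneous_ideal_def)
  obtain \<sigma> where s: "max_cone \<sigma>" "bmon \<sigma> \<notin> P" using relevant_max_cone[OF P] .
  have "vmon \<sigma> w \<notin> P" unfolding vmon_def using relevant_xmon[OF P s(2) keys_expo_vx[OF s(1)]] .
  then have "HF grd P (int k *s A) \<le> HF grd P (int k *s A + w)"
    using assms s(1) prime
    by (intro HF_mono(1)[OF id vmon_graded[OF s(1)]]) (auto simp: convex_class_def)
  then show "0 \<le> e" using k by (simp add: add.commute)
qed

lemma eventually_convex:
  assumes v: "strict_class v"
  shows "\<exists>k0 :: nat. \<forall>k\<ge>k0. convex_class (w + int k *s v)"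
proof -
  define k0 where "k0 = nat (\<Sum>\<sigma>\<in>UNIV. \<Sum>j\<in>UNIV. \<bar>vx \<sigma> w j\<bar>)"
  have "convex_class (w + int k *s v)" if k: "k \<ge> k0" for k
    unfolding convex_class_def
  proof (intro allI impI)
    fix \<sigma> j assume s: "max_cone \<sigma>"
    show "0 \<le> vx \<sigma> (w + int k *s v) j"
    proof (cases "j \<in> \<sigma>")
      case True
      then show ?thesis using s by (simp add: vx_cone)
    next
      case False
      have "\<bar>vx \<sigma> w j\<bar> \<le> (\<Sum>j\<in>UNIV. \<bar>vx \<sigma> w j\<bar>)" by (rule member_le_sum) auto
      also have "\<dots> \<le> (\<Sum>\<sigma>\<in>UNIV. \<Sum>j\<in>UNIV. \<bar>vx \<sigma> w j\<bar>)"
        by (rule member_le_sum) (auto intro: sum_nonneg)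
      finally have "\<bar>vx \<sigma> w j\<bar> \<le> int k" using k by (simp add: k0_def)
      moreover have "int k * 1 \<le> int k * vx \<sigma> v j"
        using v s False by (intro mult_left_mono) (auto simp: strict_class_def)
      ultimately show ?thesis using s by (simp add: vx_add vx_scale)
    qed
  qed
  then show ?thesis by blast
qed

lemma HF_coord_ideal:
  "HF grd (coord_ideal \<tau>) w = card {a. mon_deg grd a = w \<and> keys a \<inter> \<tau> = {}}"
proof -
  let ?D = "{a. mon_deg grd a = w}"
  have "graded_piece grd w \<inter> coord_ideal \<tau> = mspace (?D \<inter> {a. keys a \<inter> \<tau> \<noteq> {}})"
    by (simp add: graded_piece_eq_mspace coord_ideal_def mspace_Int)
  then have "HF grd (coord_ideal \<tau>) w = card ?D - card (?D \<inter> {a. keys a \<inter> \<tau> \<noteq> {}})"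
    using finite_degree[of w] by (simp add: HF_def graded_piece_eq_mspace dim_mspace)
  also have "\<dots> = card (?D - ?D \<inter> {a. keys a \<inter> \<tau> \<noteq> {}})"
    using finite_degree[of w] by (intro card_Diff_subset[symmetric]) auto
  also have "?D - ?D \<inter> {a. keys a \<inter> \<tau> \<noteq> {}} = {a. mon_deg grd a = w \<and> keys a \<inter> \<tau> = {}}" by blast
  finally show ?thesis .
qed

end

text \<open>Two maximal cones with a common facet. The facet corresponds to a torus invariant curve
  joining the two fixed points.\<close>

locale wall = toric ray \<Sigma> grd
  for ray :: "'n::finite \<Rightarrow> int^'d" and \<Sigma> and grd :: "'n \<Rightarrow> int^'s" +
  fixes \<sigma> i i'
  assumes s: "max_cone \<sigma>" and i: "i \<in> \<sigma>" and i': "i' \<notin> \<sigma>"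
    and s': "max_cone (insert i' (\<sigma> - {i}))" and wall: "pr (dual \<sigma> i) i' = - 1"
begin

abbreviation "\<tau> \<equiv> \<sigma> - {i}"

text \<open>The coordinate is affine in \<open>k\<close> and nonnegative at both vertices of the
  edge, hence between them.\<close>

lemma vx_interpolate:
  assumes w: "convex_class w" and k: "0 \<le> k" "k \<le> vx \<sigma> w i'"
  shows "0 \<le> vx \<sigma> w j + k * pr (dual \<sigma> i) j"
proof (cases "0 \<le> pr (dual \<sigma> i) j")
  case True
  then show ?thesis using w s k(1) by (auto simp: convex_class_def)
next
  case False
  have "0 \<le> vx (insert i' (\<sigma> - {i})) w j" using w s' by (auto simp: convex_class_def)
  also have "\<dots> = vx \<sigma> w j + vx \<sigma> w i' * pr (dual \<sigma> i) j"
    by (simp add: vx_neighbour[OF s i s' wall])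
  also have "\<dots> \<le> vx \<sigma> w j + k * pr (dual \<sigma> i) j"
    using k(2) False by (simp add: mult_right_mono_neg)
  finally show ?thesis .
qed

text \<open>The monomials outside the ideal are the lattice points of an edge of length
  \<open>vx \<sigma> w i'\<close>; the 1 counts the second endpoint. The map \<open>H\<close>
  parametrizes the edge.\<close>

lemma HF_wall:
  assumes w: "convex_class w"
  shows "HF grd (coord_ideal \<tau>) w = nat (vx \<sigma> w i') + 1"
proof -
  define H where "H = (\<lambda>k. expo (\<lambda>j. vx \<sigma> w j + k * pr (dual \<sigma> i) j))"
  have lH: "int (lookup (H k) j) = vx \<sigma> w j + k * pr (dual \<sigma> i) j"
    if "k \<in> {0..vx \<sigma> w i'}" for k j
    using vx_interpolate[OF w, of k j] that by (simp add: H_def lookup_expo)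
  have pd: "pr (dual \<sigma> i) k = (if i = k then 1 else 0)" if "k \<in> \<sigma>" for k
    using pr_dual[OF max_coneD[OF s] i that] .
  have Hi: "int (lookup (H k) i) = k" if "k \<in> {0..vx \<sigma> w i'}" for k
    using lH[OF that, of i] pd[OF i] vx_cone[OF s i] by simp
  have "{a. mon_deg grd a = w \<and> keys a \<inter> \<tau> = {}} = H ` {0..vx \<sigma> w i'}"
  proof (intro equalityI subsetI)
    fix a assume "a \<in> {a. mon_deg grd a = w \<and> keys a \<inter> \<tau> = {}}"
    then have a: "dg (\<lambda>j. int (lookup a j)) = w" "\<And>k. k \<in> \<tau> \<Longrightarrow> lookup a k = 0"
      by (auto simp: mon_deg_eq in_keys_iff)
    have e: "int (lookup a j) = vx \<sigma> w j + int (lookup a i) * pr (dual \<sigma> i) j" for j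
    proof -
      have "int (lookup a j) = vx \<sigma> w j + (\<Sum>k\<in>\<sigma>. int (lookup a k) * pr (dual \<sigma> k) j)"
        by (rule expand[OF s a(1)])
      also have "(\<Sum>k\<in>\<sigma>. int (lookup a k) * pr (dual \<sigma> k) j)
          = (\<Sum>k\<in>\<sigma>. if k = i then int (lookup a i) * pr (dual \<sigma> i) j else 0)"
        by (rule sum.cong) (use a(2) in auto)
      finally show ?thesis using i by simp
    qed
    have "a = expo (\<lambda>j. int (lookup a j))" by (simp add: expo_lookup)
    also have "\<dots> = H (int (lookup a i))" unfolding H_def by (rule arg_cong[of _ _ expo]) (rule ext, rule e)
    finally have "a = H (int (lookup a i))" .
    moreover have "int (lookup a i) \<in> {0..vx \<sigma> w i'}" using e[of i'] wall by simp
    ultimately show "a \<in> H ` {0..vx \<sigma> w i'}" by blast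
  next
    fix a assume "a \<in> H ` {0..vx \<sigma> w i'}"
    then obtain k where k: "k \<in> {0..vx \<sigma> w i'}" "a = H k" by blast
    have "dg (\<lambda>j. vx \<sigma> w j + k * pr (dual \<sigma> i) j) = w"
      by (simp add: dg_add dg_scale dg_pr dg_vx[OF s])
    then have "mon_deg grd a = w" unfolding mon_deg_eq k(2) lH[OF k(1)] .
    moreover have "lookup a j = 0" if "j \<in> \<tau>" for j
      using lH[OF k(1), of j] pd[of j] that vx_cone[OF s, of j] k(2) by auto
    ultimately show "a \<in> {a. mon_deg grd a = w \<and> keys a \<inter> \<tau> = {}}" by (auto simp: in_keys_iff)
  qed
  moreover have "inj_on H {0..vx \<sigma> w i'}" using Hi by (metis inj_onI)
  moreover have "0 \<le> vx \<sigma> w i'" using w s by (simp add: convex_class_def)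
  ultimately show ?thesis unfolding HF_coord_ideal by (simp add: card_image nat_add_distrib)
qed

text \<open>Edge lengths are additive in the class. With \<open>v\<close> as auxiliary ample class,
  both degrees are eventually convex and \<open>HF_wall\<close> applies to each.\<close>

lemma intersection_number_wall:
  assumes v: "ample ray \<Sigma> grd v"
  shows "intersection_number ray \<Sigma> grd w (coord_ideal \<tau>) (vx \<sigma> w i')"
  unfolding intersection_number_def
proof (intro exI conjI)
  show "ample ray \<Sigma> grd v" by fact
  note st = ample_strict[OF v]
  obtain k1 where k1: "\<And>k. k \<ge> k1 \<Longrightarrow> convex_class (w + int k *s v)"
    using eventually_convex[OF st, of w] by blast
  obtain k2 where k2: "\<And>k. k \<ge> k2 \<Longrightarrow> convex_class (0 + int k *s v)"
    using eventually_convex[OF st, of 0] by blast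
  have "int (HF grd (coord_ideal \<tau>) (w + int k *s v)) - int (HF grd (coord_ideal \<tau>) (int k *s v))
      = vx \<sigma> w i'" if k: "k \<ge> max k1 k2" for k
  proof -
    have c: "convex_class (w + int k *s v)" "convex_class (int k *s v)" using k1[of k] k2[of k] k by auto
    then have "0 \<le> vx \<sigma> (w + int k *s v) i'" "0 \<le> vx \<sigma> (int k *s v) i'"
      using s by (auto simp: convex_class_def)
    then show ?thesis unfolding HF_wall[OF c(1)] HF_wall[OF c(2)] by (simp add: vx_add[OF s])
  qed
  then show "\<forall>\<^sub>F k in sequentially. int (HF grd (coord_ideal \<tau>) (w + int k *s v))
      - int (HF grd (coord_ideal \<tau>) (int k *s v)) = vx \<sigma> w i'"
    unfolding eventually_sequentially by blast
qed

end

context toric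
begin

text \<open>Serves to move homogeneous elements from degree \<open>w\<close> to a multiple of
  \<open>v\<close> by a factor outside \<open>R\<close>.\<close>

lemma eventually_vmon:
  assumes v: "strict_class v" and R: "relevant_prime \<Sigma> grd R" and s: "max_cone \<rho>" "bmon \<rho> \<notin> R"
  obtains m :: nat and g where "g \<in> graded_piece grd (int m *s v - w)" "g \<notin> R"
proof -
  obtain m where m: "\<And>k. k \<ge> m \<Longrightarrow> convex_class (- w + int k *s v)" using eventually_convex[OF v, of "- w"] by blast
  have e: "- w + int m *s v = int m *s v - w" by simp
  have "vmon \<rho> (- w + int m *s v) \<in> graded_piece grd (int m *s v - w)"
    unfolding e[symmetric] using m[of m] s(1) by (intro vmon_graded) (auto simp: convex_class_def)
  moreover have "vmon \<rho> (- w + int m *s v) \<notin> R"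
    unfolding vmon_def by (rule relevant_xmon[OF R s(2) keys_expo_vx[OF s(1)]])
  ultimately show ?thesis using that by blast
qed

end

context wall
begin

text \<open>For an ideal \<open>Q\<close> properly containing that of the curve, \<open>HF Q (n v)\<close> is bounded in \<open>n\<close>. So an
  element of \<open>R\<close> outside \<open>Q\<close> acts surjectively on \<open>S/Q\<close> between some degrees \<open>n v\<close>, and \<open>R\<close> contains
  a monomial that it must not contain.\<close>

lemma not_chain:
  assumes v: "strict_class v" and Q: "relevant_prime \<Sigma> grd Q" and R: "relevant_prime \<Sigma> grd R"
    and PQ: "coord_ideal \<tau> \<subset> Q" and QR: "Q \<subset> R"
  shows False
proof -
  have idQ: "is_ideal Q" and hQ: "homogeneous_ideal grd Q" and primeQ: "\<And>f g. f * g \<in> Q \<Longrightarrow> f \<in> Q \<or> g \<in> Q"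
    using Q by (auto simp: relevant_prime_def homogeneous_ideal_def)
  have idR: "is_ideal R" and hR: "homogeneous_ideal grd R"
    using R by (auto simp: relevant_prime_def homogeneous_ideal_def)
  note idP = coord_ideal_ideal[of \<tau>]
  obtain \<rho> where \<rho>: "max_cone \<rho>" "bmon \<rho> \<notin> R" using relevant_max_cone[OF R] .
  have nQP: "\<not> Q \<subseteq> coord_ideal \<tau>" and nRQ: "\<not> R \<subseteq> Q" using PQ QR by auto
  \<comment> \<open>Witnesses of the two strict inclusions are multiplied by elements outside
    \<open>R\<close>. This brings them into multiples of \<open>v\<close>, and by primality they
    remain outside the smaller ideal.\<close>
  obtain w f0 where f0: "f0 \<in> Q" "f0 \<in> graded_piece grd w" "f0 \<notin> coord_ideal \<tau>"
    using homogeneous_not_subset[OF hQ idP nQP] .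
  obtain m g0 where g0: "g0 \<in> graded_piece grd (int m *s v - w)" "g0 \<notin> R"
    using eventually_vmon[OF v R \<rho>, of w] .
  define f where "f = g0 * f0"
  have f: "f \<in> graded_piece grd (int m *s v)" "f \<in> Q" "f \<notin> coord_ideal \<tau>"
  proof -
    show "f \<in> graded_piece grd (int m *s v)"
      unfolding f_def using mult_graded_piece[OF g0(1) f0(2)] by simp
    show "f \<in> Q" unfolding f_def by (rule ideal_mult_left[OF idQ f0(1)])
    show "f \<notin> coord_ideal \<tau>" using coord_ideal_prime[of g0 f0 \<tau>] g0(2) f0(3) PQ QR unfolding f_def by blast
  qed
  obtain w' f1 where f1: "f1 \<in> R" "f1 \<in> graded_piece grd w'" "f1 \<notin> Q"
    using homogeneous_not_subset[OF hR idQ nRQ] .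
  obtain m' g1 where g1: "g1 \<in> graded_piece grd (int m' *s v - w')" "g1 \<notin> R"
    using eventually_vmon[OF v R \<rho>, of w'] .
  define g where "g = g1 * f1"
  have g: "g \<in> graded_piece grd (int m' *s v)" "g \<in> R" "g \<notin> Q"
  proof -
    show "g \<in> graded_piece grd (int m' *s v)"
      unfolding g_def using mult_graded_piece[OF g1(1) f1(2)] by simp
    show "g \<in> R" unfolding g_def by (rule ideal_mult_left[OF idR f1(1)])
    show "g \<notin> Q" using primeQ[of g1 f1] g1(2) f1(3) QR unfolding g_def by blast
  qed
  have add: "int (a + b) *s v = int a *s v + int b *s v" for a b :: nat
    by (simp add: vec.scale_left_distrib)
  have conv: "convex_class (int n *s v)" for n :: nat
    using strict_convex[OF v] by (auto simp: convex_class_def vx_scale)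
  define T where "T = vx \<sigma> v i'"
  have T0: "0 \<le> T" using strict_convex[OF v] s by (simp add: convex_class_def T_def)
  have HP: "HF grd (coord_ideal \<tau>) (int n *s v) = nat (int n * T) + 1" for n :: nat
    using HF_wall[OF conv[of n]] by (simp add: vx_scale[OF s] T_def)
  have fin: "finite (xmon ` {p. mon_deg grd p = w'})" for w' using finite_degree by blast
  define h where "h = (\<lambda>n :: nat. HF grd Q (int n *s v))"
  \<comment> \<open>Multiplication by \<open>f\<close> embeds S/P in degree \<open>n v\<close> into
    Q/P in degree \<open>(m + n) v\<close>. As the Hilbert function of S/P grows linearly with slope
    \<open>T\<close>, only \<open>m T\<close> remains for S/Q.\<close>
  have bound: "h (m + n) \<le> nat (int m * T)" for n
  proof -
    let ?d = "int (m + n) *s v"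
    obtain E where E: "E \<subseteq> graded_piece grd (int n *s v)" "card E = HF grd (coord_ideal \<tau>) (int n *s v)"
        "inj_on ((*) f) E"
        "independent_mod (\<lambda>c p. const c * p) (graded_piece grd (int n *s v + int m *s v) \<inter> coord_ideal \<tau>) ((*) f ` E)"
      using HF_mult[OF idP f(1), of "int n *s v"] coord_ideal_prime f(3) by blast
    have d: "int n *s v + int m *s v = ?d" by (simp add: add add.commute)
    have sub: "(*) f ` E \<subseteq> graded_piece grd ?d \<inter> Q"
      using E(1) mult_graded_piece[OF f(1), of _ "int n *s v"] ideal_mult_right[OF idQ f(2)]
      by (auto simp: add)
    have "card ((*) f ` E) + cvec_dim (graded_piece grd ?d \<inter> coord_ideal \<tau>) \<le> cvec_dim (graded_piece grd ?d \<inter> Q)"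
    proof (rule cvec.card_independent_mod_le[OF _ subspace_ideal_piece[OF idP] sub _ _ fin])
      show "independent_mod (\<lambda>c p. const c * p) (graded_piece grd ?d \<inter> coord_ideal \<tau>) ((*) f ` E)"
        using E(4) unfolding d .
      show "graded_piece grd ?d \<inter> coord_ideal \<tau> \<subseteq> graded_piece grd ?d \<inter> Q" using PQ by blast
      show "graded_piece grd ?d \<inter> Q \<subseteq> cvec_span (xmon ` {p. mon_deg grd p = ?d})"
        using graded_piece_span by blast
    qed
    then have "h (m + n) + HF grd (coord_ideal \<tau>) (int n *s v) \<le> HF grd (coord_ideal \<tau>) ?d"
      unfolding card_image[OF E(3)] E(2) h_def HF_def
      using dim_ideal_le[of ?d Q] by linarith
    then have "h (m + n) + nat (int n * T) \<le> nat (int (m + n) * T)" unfolding HP by simp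
    moreover have "nat (int (m + n) * T) = nat (int m * T) + nat (int n * T)"
      using T0 by (simp add: distrib_right nat_add_distrib)
    ultimately show ?thesis by simp
  qed
  have "\<exists>n. h (m + n + m') \<le> h (m + n)"
  proof (rule ccontr)
    assume "\<not> ?thesis"
    then have inc: "h (m + n) < h (m + n + m')" for n by (meson not_le)
    have "j \<le> h (m + j * m')" for j
    proof (induction j)
      case (Suc j)
      then show ?case using inc[of "j * m'"] by (simp add: algebra_simps)
    qed simp
    then show False using bound[of "Suc (nat (int m * T)) * m'"] by (meson Suc_n_not_le_n order.trans)
  qed
  then obtain n where n: "h (m + n + m') \<le> h (m + n)" by blast
  let ?n = "m + n"
  have nzd: "q \<in> Q" if "g * q \<in> Q" for q using primeQ[OF that] g(3) by blast
  have "vmon \<rho> (int ?n *s v + int m' *s v) \<in> graded_piece grd (int ?n *s v + int m' *s v)"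
    using conv[of "?n + m'"] \<rho>(1) unfolding add[symmetric]
    by (intro vmon_graded) (auto simp: convex_class_def)
  then obtain q where q: "vmon \<rho> (int ?n *s v + int m' *s v) - g * q \<in> Q"
    using HF_mono(2)[OF idQ g(1) nzd, of "int ?n *s v"] n unfolding h_def add by blast
  have "vmon \<rho> (int ?n *s v + int m' *s v)
      = (vmon \<rho> (int ?n *s v + int m' *s v) - g * q) + g * q" by simp
  also have "\<dots> \<in> R" using q QR ideal_mult_right[OF idR g(2)] by (intro ideal_add[OF idR]) auto
  finally show False using relevant_xmon[OF R \<rho>(2) keys_expo_vx[OF \<rho>(1)]] unfolding vmon_def by blast
qed

lemma irreducible_curve_wall:
  assumes v: "strict_class v"
  shows "irreducible_curve \<Sigma> grd (coord_ideal \<tau>)"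
  unfolding irreducible_curve_def
proof (intro conjI)
  have "\<tau> \<in> \<Sigma>" using face_in_fan[OF max_coneD[OF s]] by blast
  then show "relevant_prime \<Sigma> grd (coord_ideal \<tau>)" by (rule coord_ideal_relevant)
  have "coord_ideal \<tau> \<subseteq> coord_ideal \<sigma>" by (auto simp: coord_ideal_def mspace_def)
  moreover have "xmon (Poly_Mapping.single i 1) \<in> coord_ideal \<sigma>"
    "xmon (Poly_Mapping.single i 1) \<notin> coord_ideal \<tau>"
    using i by (auto simp: xmon_in_coord_ideal)
  ultimately have "coord_ideal \<tau> \<subset> coord_ideal \<sigma>" by blast
  then show "\<exists>Q. relevant_prime \<Sigma> grd Q \<and> coord_ideal \<tau> \<subset> Q"
    using coord_ideal_relevant[OF max_coneD[OF s]] by blast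
  show "\<not> (\<exists>Q R. relevant_prime \<Sigma> grd Q \<and> relevant_prime \<Sigma> grd R \<and> coord_ideal \<tau> \<subset> Q \<and> Q \<subset> R)"
    using not_chain[OF v] by blast
qed

end

context toric
begin

lemma wallI:
  assumes "max_cone \<sigma>" "i \<in> \<sigma>" "i' \<notin> \<sigma>" "max_cone (insert i' (\<sigma> - {i}))" "pr (dual \<sigma> i) i' = - 1"
  shows "wall ray \<Sigma> grd \<sigma> i i'"
  using assms by (intro wall.intro wall_axioms.intro toric_axioms)

text \<open>On the curve of a wall, the intersection number is the vertex coordinate at the adjacent
  ray; these coordinates are all that \<open>convex_of_neighbours\<close> asks for.\<close>

lemma nef_convex:
  assumes v: "ample ray \<Sigma> grd v" and w: "nef ray \<Sigma> grd w"
  shows "convex_class w"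
proof (rule convex_of_neighbours[OF ample_strict[OF v]])
  fix \<sigma> i i'
  assume a: "max_cone \<sigma>" "i \<in> \<sigma>" "i' \<notin> \<sigma>" "max_cone (insert i' (\<sigma> - {i}))" "pr (dual \<sigma> i) i' = - 1"
  interpret wall ray \<Sigma> grd \<sigma> i i' by (rule wallI[OF a])
  show "0 \<le> vx \<sigma> w i'"
    using w irreducible_curve_wall[OF ample_strict[OF v]] intersection_number_wall[OF v]
    unfolding nef_def by blast
qed

text \<open>Every edge of the polytope of a strict class has length at least 1, so it contains the
  first lattice point after the vertex.\<close>

lemma edge_nonneg:
  assumes c: "strict_class c" and s: "max_cone \<sigma>" and i: "i \<in> \<sigma>"
  shows "0 \<le> vx \<sigma> c j + pr (dual \<sigma> i) j"
proof -
  obtain i' where i': "i' \<notin> \<sigma>" "max_cone (insert i' (\<sigma> - {i}))" "pr (dual \<sigma> i) i' = - 1"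
    using neighbour[OF s i] .
  interpret wall ray \<Sigma> grd \<sigma> i i' by (rule wallI[OF s i i'])
  have "1 \<le> vx \<sigma> c i'" using c s i'(1) by (simp add: strict_class_def)
  then show ?thesis using vx_interpolate[OF strict_convex[OF c], of 1 j] by simp
qed

text \<open>The ample class \<open>v\<close> is nef, hence a combination of \<open>C\<close>. A
  coordinate that is positive for \<open>v\<close> is positive for some generator, and it is
  negative for none.\<close>

lemma generating_set_strict:
  assumes v: "ample ray \<Sigma> grd v" and C: "minimal_generating_set C (nef_semigroup ray \<Sigma> grd)"
  shows "strict_class (\<Sum>c\<in>C. c)"
  unfolding strict_class_def
proof (intro allI impI)
  fix \<sigma> j assume "max_cone \<sigma> \<and> j \<notin> \<sigma>"
  then have s: "max_cone \<sigma>" and j: "j \<notin> \<sigma>" by auto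
  have fC: "finite C" and span: "nat_span C = nef_semigroup ray \<Sigma> grd"
    using C by (auto simp: minimal_generating_set_def)
  have nn: "0 \<le> vx \<sigma> c j" if c: "c \<in> C" for c
  proof -
    have "(\<Sum>x\<in>C. int (if x = c then 1 else 0) *s x) = (\<Sum>x\<in>C. if x = c then c else 0)"
      by (rule sum.cong) auto
    also have "\<dots> = c" using c fC by simp
    finally have e: "(\<Sum>x\<in>C. int (if x = c then 1 else 0) *s x) = c" .
    have "c \<in> nat_span C" unfolding nat_span_def
      by (intro CollectI exI[of _ "\<lambda>x. if x = c then 1 else 0"] conjI TrueI) (rule e[symmetric])
    then have "nef ray \<Sigma> grd c" unfolding span nef_semigroup_def by simp
    then show ?thesis using nef_convex[OF v] s by (simp add: convex_class_def)
  qed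
  have "v \<in> nat_span C"
    unfolding span nef_semigroup_def using convex_nef[OF strict_convex[OF ample_strict[OF v]]] by simp
  then obtain a where a: "v = (\<Sum>c\<in>C. int (a c) *s c)" by (auto simp: nat_span_def)
  have "1 \<le> vx \<sigma> v j" using ample_strict[OF v] s j by (simp add: strict_class_def)
  also have "vx \<sigma> v j = (\<Sum>c\<in>C. int (a c) * vx \<sigma> c j)"
    by (simp add: a vx_sum[OF s] vx_scale[OF s])
  finally have "(\<Sum>c\<in>C. int (a c) * vx \<sigma> c j) \<noteq> 0" by simp
  then obtain c where c: "c \<in> C" "vx \<sigma> c j \<noteq> 0" by (metis (no_types, lifting) mult_zero_right sum.neutral)
  have "1 \<le> vx \<sigma> c j" using nn[OF c(1)] c(2) by simp
  also have "\<dots> \<le> (\<Sum>c\<in>C. vx \<sigma> c j)" using nn by (intro member_le_sum[OF c(1)] fC) auto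
  finally show "1 \<le> vx \<sigma> (\<Sum>c\<in>C. c) j" by (simp add: vx_sum[OF s])
qed

end

section \<open>Decomposing monomials of large degree\<close>

context toric
begin

text \<open>Exponents of the products of a monomial of degree \<open>u\<close> and \<open>k\<close>
  monomials of degree \<open>c\<close>; in low degrees they may form a proper subset of the lattice
  points of degree u + k c.\<close>

primrec Wset :: "int^'s \<Rightarrow> int^'s \<Rightarrow> nat \<Rightarrow> ('n \<Rightarrow> int) set"
  where "Wset u c 0 = Pset u"
  | "Wset u c (Suc k) = {\<lambda>j. a j + b j | a b. a \<in> Wset u c k \<and> b \<in> Pset c}"

lemma Wset_SucI: "a \<in> Wset u c k \<Longrightarrow> b \<in> Pset c \<Longrightarrow> (\<lambda>j. a j + b j) \<in> Wset u c (Suc k)"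
  by auto

lemma vx_Pset: "convex_class c \<Longrightarrow> max_cone \<sigma> \<Longrightarrow> vx \<sigma> c \<in> Pset c"
  by (simp add: Pset_def convex_class_def dg_vx)

text \<open>Start with the vertex of \<open>u\<close> and \<open>k\<close> copies of the vertex of
  \<open>c\<close>. A unit step along an edge replaces one copy by the next lattice point on that
  edge, so \<open>k\<close> copies pay for \<open>k\<close> steps.\<close>

lemma vertex_combination_in_Wset:
  assumes u: "convex_class u" and c: "strict_class c" and s: "max_cone \<sigma>"
    and n: "\<And>i. i \<in> \<sigma> \<Longrightarrow> 0 \<le> n i" "(\<Sum>i\<in>\<sigma>. n i) \<le> int k"
  shows "(\<lambda>j. vx \<sigma> u j + (\<Sum>i\<in>\<sigma>. n i * pr (dual \<sigma> i) j) + int k * vx \<sigma> c j) \<in> Wset u c k"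
  using n
proof (induction k arbitrary: n)
  case 0
  have "(\<Sum>i\<in>\<sigma>. n i) = 0" using 0 sum_nonneg[of \<sigma> n] by force
  then have "n i = 0" if "i \<in> \<sigma>" for i
    using that 0(1) by (simp add: sum_nonneg_eq_0_iff)
  then show ?case using vx_Pset[OF u s] by simp
next
  case (Suc k)
  show ?case
  proof (cases "(\<Sum>i\<in>\<sigma>. n i) \<le> int k")
    case True
    from Wset_SucI[OF Suc.IH[OF Suc.prems(1) True] vx_Pset[OF strict_convex[OF c] s]]
    show ?thesis by (simp add: algebra_simps)
  next
    case False
    then have "(\<Sum>i\<in>\<sigma>. n i) \<noteq> 0" by simp
    then obtain i where i: "i \<in> \<sigma>" "n i \<noteq> 0" by (metis sum.neutral)
    define n' where "n' = n(i := n i - 1)"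
    have "(\<Sum>k\<in>\<sigma>. n' k) = (\<Sum>k\<in>\<sigma>. n k - (if k = i then 1 else 0))"
      by (rule sum.cong) (auto simp: n'_def)
    also have "\<dots> = (\<Sum>k\<in>\<sigma>. n k) - 1" using i(1) by (simp add: sum_subtractf)
    finally have "(\<Sum>k\<in>\<sigma>. n' k) \<le> int k" using Suc.prems(2) by simp
    moreover have "0 \<le> n' k" if "k \<in> \<sigma>" for k
      using Suc.prems(1)[OF that] i(2) by (auto simp: n'_def)
    ultimately have IH: "(\<lambda>j. vx \<sigma> u j + (\<Sum>i\<in>\<sigma>. n' i * pr (dual \<sigma> i) j) + int k * vx \<sigma> c j) \<in> Wset u c k"
      by (intro Suc.IH)
    have e: "(\<lambda>j. vx \<sigma> c j + pr (dual \<sigma> i) j) \<in> Pset c"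
      using edge_nonneg[OF c s i(1)] by (simp add: Pset_def dg_add dg_vx[OF s] dg_pr)
    have "(\<Sum>k\<in>\<sigma>. n k * pr (dual \<sigma> k) j) = (\<Sum>k\<in>\<sigma>. n' k * pr (dual \<sigma> k) j) + pr (dual \<sigma> i) j" for j
    proof -
      have "(\<Sum>k\<in>\<sigma>. n k * pr (dual \<sigma> k) j)
          = (\<Sum>k\<in>\<sigma>. n' k * pr (dual \<sigma> k) j + (if k = i then pr (dual \<sigma> i) j else 0))"
        by (rule sum.cong) (auto simp: n'_def algebra_simps)
      then show ?thesis using i(1) by (simp add: sum.distrib)
    qed
    then show ?thesis using Wset_SucI[OF IH e] by (simp add: algebra_simps)
  qed
qed

lemma Pset_near_vertex:
  assumes u: "convex_class u" and c: "strict_class c" and s: "max_cone \<sigma>"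
    and x: "x \<in> Pset (u + int k *s c)" "(\<Sum>i\<in>\<sigma>. x i) \<le> int k"
  shows "x \<in> Wset u c k"
proof -
  have "x = (\<lambda>j. vx \<sigma> u j + (\<Sum>i\<in>\<sigma>. x i * pr (dual \<sigma> i) j) + int k * vx \<sigma> c j)"
  proof
    fix j
    have "x j = vx \<sigma> (u + int k *s c) j + (\<Sum>i\<in>\<sigma>. x i * pr (dual \<sigma> i) j)"
      using x(1) by (intro expand[OF s]) (simp add: Pset_def)
    then show "x j = vx \<sigma> u j + (\<Sum>i\<in>\<sigma>. x i * pr (dual \<sigma> i) j) + int k * vx \<sigma> c j"
      by (simp add: vx_add[OF s] vx_scale[OF s])
  qed
  also have "\<dots> \<in> Wset u c k"
    using x by (intro vertex_combination_in_Wset[OF u c s]) (auto simp: Pset_def)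
  finally show ?thesis .
qed

text \<open>The rays whose coordinates are small compared with \<open>k\<close> span a cone: evaluate the lattice
  point, relative to the vertex of a maximal cone containing the sum of these rays, at this sum.\<close>

lemma Pset_contains_vertex:
  assumes u: "convex_class u" and c: "strict_class c"
  obtains k0 where "\<And>k x. k \<ge> k0 \<Longrightarrow> x \<in> Pset (u + int k *s c) \<Longrightarrow>
    \<exists>\<sigma>. max_cone \<sigma> \<and> (\<forall>j. vx \<sigma> c j \<le> x j)"
proof -
  \<comment> \<open>Bounds all vertex coordinates of \<open>c\<close>, so a coordinate of
    \<open>x\<close> that is at least \<open>N\<close> never obstructs the subtraction of a
    vertex.\<close>
  define N where "N = (\<Sum>\<sigma>\<in>UNIV. \<Sum>j\<in>UNIV. \<bar>vx \<sigma> c j\<bar>)"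
  have N: "vx \<sigma> c j \<le> N" for \<sigma> j
  proof -
    have "vx \<sigma> c j \<le> \<bar>vx \<sigma> c j\<bar>" by simp
    also have "\<dots> \<le> (\<Sum>j\<in>UNIV. \<bar>vx \<sigma> c j\<bar>)" by (rule member_le_sum) auto
    also have "\<dots> \<le> N" unfolding N_def by (rule member_le_sum) (auto intro: sum_nonneg)
    finally show ?thesis .
  qed
  have N0: "0 \<le> N" unfolding N_def by (intro sum_nonneg) auto
  have "\<exists>\<sigma>. max_cone \<sigma> \<and> (\<forall>j. vx \<sigma> c j \<le> x j)"
    if k: "k \<ge> nat (N * int (CARD('n))) + 1" and x: "x \<in> Pset (u + int k *s c)" for k x
  proof -
    have xnn: "0 \<le> x j" for j using x by (simp add: Pset_def)
    define G where "G = {i. x i < N}"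
    obtain \<sigma> where s: "max_cone \<sigma>" "(\<Sum>i\<in>G. rray i) \<in> fan_cone ray \<sigma>" using max_cones_cover by blast
    obtain b where b: "\<And>i. i \<in> \<sigma> \<Longrightarrow> 0 \<le> b i" "(\<Sum>i\<in>G. rray i) = (\<Sum>i\<in>\<sigma>. b i *\<^sub>R rray i)"
      using s(2) unfolding fan_cone_eq by blast
    \<comment> \<open>The displacement of \<open>x\<close> from the vertex of \<sigma>. On the rays
      of \<sigma> it takes the values of \<open>x\<close>, so it is nonnegative on the whole cone,
      in particular at the sum of the rays in \<open>G\<close>.\<close>
    define p where "p = (\<Sum>i\<in>\<sigma>. x i *s dual \<sigma> i)"
    let ?w = "u + int k *s c"
    have xp: "x j = vx \<sigma> ?w j + pr p j" for j
      using expand[OF s(1), of x ?w j] x by (simp add: Pset_def p_def pairing_sum_left pairing_scale_left)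
    have vxnn: "0 \<le> vx \<sigma> ?w j" for j
      using u strict_convex[OF c] s(1) by (simp add: vx_add vx_scale convex_class_def)
    have "(\<Sum>j\<in>G. real_of_int (pr p j)) = rpairing p (\<Sum>i\<in>G. rray i)"
      by (simp add: rpairing_sum rpairing_rray)
    also have "\<dots> = (\<Sum>i\<in>\<sigma>. b i * real_of_int (pr p i))"
      unfolding b(2) by (simp add: rpairing_sum rpairing_scale rpairing_rray)
    also have "\<dots> = (\<Sum>i\<in>\<sigma>. b i * real_of_int (x i))"
      using xp vx_cone[OF s(1)] by (intro sum.cong) auto
    also have "\<dots> \<ge> 0" using b(1) xnn by (intro sum_nonneg mult_nonneg_nonneg) auto
    finally have "0 \<le> (\<Sum>j\<in>G. pr p j)" by (metis of_int_0_le_iff of_int_sum)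
    moreover have "(\<Sum>j\<in>G. x j) = (\<Sum>j\<in>G. vx \<sigma> ?w j + pr p j)"
      by (rule sum.cong[OF refl]) (rule xp)
    ultimately have "(\<Sum>j\<in>G. vx \<sigma> ?w j) \<le> (\<Sum>j\<in>G. x j)" by (simp only: sum.distrib)
    also have "\<dots> \<le> (\<Sum>j\<in>G. N)" by (rule sum_mono) (simp add: G_def)
    also have "\<dots> \<le> N * int (CARD('n))"
      using N0 card_mono[of UNIV G] by (simp add: mult.commute mult_left_mono)
    also have "\<dots> < int k" using k by linarith
    finally have lt: "(\<Sum>j\<in>G. vx \<sigma> ?w j) < int k" .
    \<comment> \<open>By strictness a ray of \<open>G\<close> outside \<sigma> would contribute at
      least \<open>k\<close> to a sum just shown to be smaller.\<close>
    have "G \<subseteq> \<sigma>"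
    proof (rule subsetI, rule ccontr)
      fix j assume j: "j \<in> G" "j \<notin> \<sigma>"
      have "int k * 1 \<le> int k * vx \<sigma> c j"
        using c s(1) j(2) by (intro mult_left_mono) (auto simp: strict_class_def)
      also have "\<dots> \<le> vx \<sigma> ?w j"
        using u s(1) by (simp add: vx_add[OF s(1)] vx_scale[OF s(1)] convex_class_def)
      also have "\<dots> \<le> (\<Sum>j\<in>G. vx \<sigma> ?w j)" using vxnn by (intro member_le_sum[OF j(1)]) auto
      finally show False using lt by simp
    qed
    then have "vx \<sigma> c j \<le> x j" for j
    proof (cases "j \<in> \<sigma>")
      case True
      then show ?thesis using xnn vx_cone[OF s(1)] by simp
    next
      case False
      then have "j \<notin> G" using \<open>G \<subseteq> \<sigma>\<close> by blast
      then have "N \<le> x j" by (simp add: G_def)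
      then show ?thesis using N[of \<sigma> j] by simp
    qed
    then show ?thesis using s(1) by blast
  qed
  then show ?thesis using that by blast
qed

lemma Wset_add_multiple:
  assumes "convex_class c" "max_cone \<sigma>" "x \<in> Wset u c k"
  shows "(\<lambda>j. x j + int n * vx \<sigma> c j) \<in> Wset u c (k + n)"
proof (induction n)
  case (Suc n)
  from Wset_SucI[OF Suc vx_Pset[OF assms(1,2)]] show ?case by (simp add: algebra_simps)
qed (simp add: assms)

lemma Wset_add_vertices:
  assumes "convex_class c" "finite A" "\<And>\<sigma>. \<sigma> \<in> A \<Longrightarrow> max_cone \<sigma>" "x \<in> Wset u c k"
  shows "(\<lambda>j. x j + (\<Sum>\<sigma>\<in>A. int (f \<sigma>) * vx \<sigma> c j)) \<in> Wset u c (k + (\<Sum>\<sigma>\<in>A. f \<sigma>))"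
  using assms(2,3)
proof (induction A rule: finite_induct)
  case (insert \<sigma> A)
  have "(\<lambda>j. x j + (\<Sum>\<sigma>\<in>A. int (f \<sigma>) * vx \<sigma> c j)) \<in> Wset u c (k + (\<Sum>\<sigma>\<in>A. f \<sigma>))"
    using insert by simp
  from Wset_add_multiple[OF assms(1) _ this, of \<sigma> "f \<sigma>"] insert
  show ?case by (simp add: algebra_simps)
qed (simp add: assms)

text \<open>Vertices of \<open>c\<close> are subtracted until degree u + k0 c, where only finitely
  many remainders \<open>x0\<close> exist; \<open>N0\<close> bounds their coordinate sums. If
  \<open>k\<close> is large, some vertex was subtracted at least \<open>N0\<close> times, by the
  pigeonhole principle.\<close>

lemma Pset_eventually_Wset:
  assumes u: "convex_class u" and c: "strict_class c"
  obtains k1 where "\<And>k. k \<ge> k1 \<Longrightarrow> Pset (u + int k *s c) \<subseteq> Wset u c k"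
proof -
  obtain k0 where k0: "\<And>k x. k \<ge> k0 \<Longrightarrow> x \<in> Pset (u + int k *s c) \<Longrightarrow>
    \<exists>\<sigma>. max_cone \<sigma> \<and> (\<forall>j. vx \<sigma> c j \<le> x j)" using Pset_contains_vertex[OF u c] by blast
  define M where "M = {\<sigma>. max_cone \<sigma>}"
  have scale_add: "int (a + b) *s c = int a *s c + int b *s c" for a b :: nat
    by (simp add: vec.scale_left_distrib)
  have dec: "\<exists>f x0. x0 \<in> Pset (u + int k0 *s c) \<and> (\<Sum>\<sigma>\<in>M. f \<sigma>) = m \<and>
      (\<forall>j. x j = x0 j + (\<Sum>\<sigma>\<in>M. int (f \<sigma>) * vx \<sigma> c j))"
    if "x \<in> Pset (u + int (k0 + m) *s c)" for m x
    using that
  proof (induction m arbitrary: x)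
    case 0
    then show ?case by (intro exI[of _ "\<lambda>_. 0 :: nat"] exI[of _ x]) simp
  next
    case (Suc m)
    obtain \<sigma> where s: "max_cone \<sigma>" "\<And>j. vx \<sigma> c j \<le> x j"
      using k0[OF _ Suc.prems] by auto
    have "u + int (k0 + Suc m) *s c - c = u + int (k0 + m) *s c"
      using scale_add[of "k0 + m" 1] by simp
    then have "(\<lambda>j. x j - vx \<sigma> c j) \<in> Pset (u + int (k0 + m) *s c)"
      using Suc.prems s by (simp add: Pset_def dg_diff dg_vx del: add_Suc_right)
    from Suc.IH[OF this] obtain f x0 where f: "x0 \<in> Pset (u + int k0 *s c)" "(\<Sum>\<sigma>\<in>M. f \<sigma>) = m"
      "\<And>j. x j - vx \<sigma> c j = x0 j + (\<Sum>\<sigma>\<in>M. int (f \<sigma>) * vx \<sigma> c j)" by blast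
    define f' where "f' = f(\<sigma> := f \<sigma> + 1)"
    have sM: "\<sigma> \<in> M" using s(1) by (simp add: M_def)
    have "(\<Sum>\<rho>\<in>M. f' \<rho>) = (\<Sum>\<rho>\<in>M. f \<rho> + (if \<rho> = \<sigma> then 1 else 0))"
      by (rule sum.cong) (auto simp: f'_def)
    then have 1: "(\<Sum>\<rho>\<in>M. f' \<rho>) = Suc m" using sM f(2) by (simp add: sum.distrib)
    have 2: "x j = x0 j + (\<Sum>\<rho>\<in>M. int (f' \<rho>) * vx \<rho> c j)" for j
    proof -
      have "(\<Sum>\<rho>\<in>M. int (f' \<rho>) * vx \<rho> c j)
          = (\<Sum>\<rho>\<in>M. int (f \<rho>) * vx \<rho> c j + (if \<rho> = \<sigma> then vx \<sigma> c j else 0))"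
        by (rule sum.cong) (auto simp: f'_def algebra_simps)
      then show ?thesis using sM f(3)[of j] by (simp add: sum.distrib)
    qed
    show ?case using f(1) 1 2 by blast
  qed
  define N0 where "N0 = nat (\<Sum>x0\<in>Pset (u + int k0 *s c). \<Sum>i\<in>UNIV. x0 i)"
  have N0: "(\<Sum>i\<in>\<sigma>. x0 i) \<le> int N0" if x0: "x0 \<in> Pset (u + int k0 *s c)" for x0 \<sigma>
  proof -
    have "(\<Sum>i\<in>\<sigma>. x0 i) \<le> (\<Sum>i\<in>UNIV. x0 i)" using x0 by (intro sum_mono2) (auto simp: Pset_def)
    also have "\<dots> \<le> (\<Sum>x0\<in>Pset (u + int k0 *s c). \<Sum>i\<in>UNIV. x0 i)"
      by (rule member_le_sum[OF x0 _ finite_Pset]) (auto simp: Pset_def intro!: sum_nonneg)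
    finally show ?thesis by (simp add: N0_def)
  qed
  have "M \<noteq> {}" using max_cones_cover by (auto simp: M_def)
  then have cM: "card M > 0" by (simp add: card_gt_0_iff)
  have "Pset (u + int k *s c) \<subseteq> Wset u c k" if k: "k \<ge> k0 + card M * N0" for k
  proof
    fix x assume x: "x \<in> Pset (u + int k *s c)"
    define m where "m = k - k0"
    have km: "k = k0 + m" "card M * N0 \<le> m" using k by (auto simp: m_def)
    obtain f x0 where f: "x0 \<in> Pset (u + int k0 *s c)" "(\<Sum>\<sigma>\<in>M. f \<sigma>) = m"
      "\<And>j. x j = x0 j + (\<Sum>\<sigma>\<in>M. int (f \<sigma>) * vx \<sigma> c j)" using dec[of x m] x km(1) by blast
    have "\<exists>\<sigma>\<in>M. N0 \<le> f \<sigma>"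
    proof (rule ccontr)
      assume "\<not> ?thesis"
      then have "(\<Sum>\<sigma>\<in>M. f \<sigma>) < of_nat (card M) * N0"
        using cM by (intro sum_bounded_above_strict) (auto simp: not_le)
      then show False using f(2) km(2) by simp
    qed
    then obtain \<sigma> where s: "\<sigma> \<in> M" "N0 \<le> f \<sigma>" by blast
    have sm: "max_cone \<sigma>" using s(1) by (simp add: M_def)
    \<comment> \<open>The remainder plus all copies of the frequent vertex. These copies vanish on
      \<sigma>, so the edge coordinates of \<open>y\<close> still sum to at most \<open>N0\<close>,
      and \<open>y\<close> is near enough to this vertex to decompose. The other vertices are then
      added back.\<close>
    define y where "y = (\<lambda>j. x0 j + int (f \<sigma>) * vx \<sigma> c j)"
    have "y \<in> Wset u c (k0 + f \<sigma>)"
    proof (rule Pset_near_vertex[OF u c sm])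
      have "0 \<le> vx \<sigma> c j" for j using strict_convex[OF c] sm by (simp add: convex_class_def)
      then show "y \<in> Pset (u + int (k0 + f \<sigma>) *s c)"
        using f(1) unfolding y_def Pset_def scale_add by (simp add: dg_add dg_scale dg_vx[OF sm] add.assoc)
      have "(\<Sum>i\<in>\<sigma>. y i) = (\<Sum>i\<in>\<sigma>. x0 i)" by (rule sum.cong) (auto simp: y_def vx_cone[OF sm])
      then show "(\<Sum>i\<in>\<sigma>. y i) \<le> int (k0 + f \<sigma>)" using N0[OF f(1), of \<sigma>] s(2) by simp
    qed
    then have "(\<lambda>j. y j + (\<Sum>\<rho>\<in>M - {\<sigma>}. int (f \<rho>) * vx \<rho> c j))
        \<in> Wset u c (k0 + f \<sigma> + (\<Sum>\<rho>\<in>M - {\<sigma>}. f \<rho>))"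
      by (intro Wset_add_vertices[OF strict_convex[OF c]]) (auto simp: M_def)
    also have "k0 + f \<sigma> + (\<Sum>\<rho>\<in>M - {\<sigma>}. f \<rho>) = k"
      using f(2) km(1) s(1) sum.remove[of M \<sigma> f] by simp
    also have "(\<lambda>j. y j + (\<Sum>\<rho>\<in>M - {\<sigma>}. int (f \<rho>) * vx \<rho> c j)) = x"
    proof
      fix j
      show "y j + (\<Sum>\<rho>\<in>M - {\<sigma>}. int (f \<rho>) * vx \<rho> c j) = x j"
        using s(1) sum.remove[of M \<sigma> "\<lambda>\<rho>. int (f \<rho>) * vx \<rho> c j"] f(3)[of j] by (simp add: y_def)
    qed
    finally show "x \<in> Wset u c k" .
  qed
  then show ?thesis using that by blast
qed

end

section \<open>Ideals agreeing in two degrees\<close>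

lemma telescope:
  fixes p q s t h l :: "'a::comm_ring_1"
  shows "p * q - s * t * h = (p - t * l) * q + t * (l * q - s * h)"
  by (simp add: algebra_simps)

lemma poly_in_graded_piece:
  assumes "\<And>i. coeff P i \<in> graded_piece grd c"
  shows "poly P (const t) \<in> graded_piece grd c"
  using assms
proof (induction P)
  case 0
  then show ?case by (simp add: graded_piece_def)
next
  case (pCons a P)
  have "coeff P i \<in> graded_piece grd c" for i using pCons.prems[of "Suc i"] by simp
  then have "const t * poly P (const t) \<in> graded_piece grd c"
    using pCons.IH cvec.subspace_scale[OF cvec_subspace_mspace] unfolding graded_piece_eq_mspace by blast
  moreover have "a \<in> graded_piece grd c" using pCons.prems[of 0] by simp
  ultimately show ?case
    using cvec.subspace_add[OF cvec_subspace_mspace] unfolding graded_piece_eq_mspace by simp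
qed

context toric
begin

text \<open>The monomials of degree \<open>c\<close> become the coefficients of a polynomial in one
  parameter. Powers of one parameter replace independent coefficients of a generic linear
  combination, so univariate polynomials suffice.\<close>

lemma generic_section_poly:
  obtains P where "\<And>i. coeff P i \<in> graded_piece grd c" "\<And>a. mon_deg grd a = c \<Longrightarrow> \<exists>i. coeff P i = xmon a"
proof -
  obtain h where h: "bij_betw h {..<card {a. mon_deg grd a = c}} {a. mon_deg grd a = c}"
    using ex_bij_betw_nat_finite[OF finite_degree] by (auto simp: atLeast0LessThan)
  let ?n = "card {a. mon_deg grd a = c}"
  define P where "P = (\<Sum>j<?n. monom (xmon (h j)) j)"
  have co: "coeff P i = (if i < ?n then xmon (h i) else 0)" for i
    by (simp add: P_def coeff_sum)
  have "coeff P i \<in> graded_piece grd c" for i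
    using h by (auto simp: co xmon_in_graded_piece bij_betw_def) (simp add: graded_piece_def)
  moreover have "\<exists>i. coeff P i = xmon a" if "mon_deg grd a = c" for a
  proof -
    have "a \<in> h ` {..<?n}" using h that by (simp add: bij_betw_def)
    then obtain i where "i < ?n" "a = h i" by auto
    then show ?thesis by (intro exI[of _ i]) (simp add: co)
  qed
  ultimately show ?thesis using that by blast
qed

text \<open>Membership is local on the charts of maximal cones, where the given monomials are
  invertible.\<close>

lemma saturated_vertices:
  assumes I: "is_ideal I" "B_saturated \<Sigma> I"
    and f: "\<And>\<sigma>. max_cone \<sigma> \<Longrightarrow> \<exists>a. keys a \<inter> \<sigma> = {} \<and> xmon a * f \<in> I"
  shows "f \<in> I"
proof (rule saturated_powers[OF I(1)])
  show "I = saturation I (ideal_gen (bmon ` \<Sigma>))"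
    using I(2) unfolding B_saturated_def irrelevant_ideal_eq .
  show "finite (bmon ` {\<sigma>. max_cone \<sigma>})" by simp
  show "\<exists>h0\<in>bmon ` {\<sigma>. max_cone \<sigma>}. h0 dvd h" if h: "h \<in> bmon ` \<Sigma>" for h
  proof -
    obtain \<tau> where \<tau>: "\<tau> \<in> \<Sigma>" "h = bmon \<tau>" using h by blast
    obtain \<sigma> where "max_cone \<sigma>" "\<tau> \<subseteq> \<sigma>" using cone_in_max_cone[OF \<tau>(1)] .
    then show ?thesis using bmon_dvd \<tau>(2) by blast
  qed
  fix h assume "h \<in> bmon ` {\<sigma>. max_cone \<sigma>}"
  then obtain \<sigma> where s: "max_cone \<sigma>" "h = bmon \<sigma>" by blast
  obtain a where a: "keys a \<inter> \<sigma> = {}" "xmon a * f \<in> I" using f[OF s(1)] by blast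
  obtain N where "xmon a dvd bmon \<sigma> ^ N" using xmon_dvd_bmon_power[OF a(1)] .
  then obtain g where g: "bmon \<sigma> ^ N = xmon a * g" by (rule dvdE)
  have "h ^ N * f = g * (xmon a * f)" unfolding s(2) g by (simp only: mult_ac)
  then have "h ^ N * f \<in> I" using ideal_mult_left[OF I(1) a(2)] by simp
  then show "\<exists>N. h ^ N * f \<in> I" by blast
qed

lemma expo_Pset: "a \<in> Pset w \<Longrightarrow> xmon (expo a) \<in> graded_piece grd w"
  by (simp add: xmon_in_graded_piece mon_deg_expo Pset_def)

lemma Wset_nonneg: "a \<in> Wset u c k \<Longrightarrow> 0 \<le> a j"
  by (induction k arbitrary: a) (auto simp: Pset_def)

text \<open>Since multiplication by \<open>s\<close> is bijective from degree \<open>u\<close> to degree \<open>u + c\<close> modulo \<open>I\<close>,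
  in a product of one monomial of degree \<open>u\<close> and \<open>k\<close> monomials of degree \<open>c\<close> all the latter can
  be replaced by \<open>s\<close>, modulo the part \<open>K\<close> of \<open>I\<close> that is generated in degree \<open>u + c\<close>.\<close>

lemma Wset_reduce:
  assumes K: "is_ideal K" and s: "s \<in> graded_piece grd c"
    and red: "\<And>g. g \<in> graded_piece grd (u + c) \<Longrightarrow> \<exists>h\<in>graded_piece grd u. g - s * h \<in> K"
    and a: "a \<in> Wset u c k"
  shows "\<exists>l\<in>graded_piece grd u. xmon (expo a) - s ^ k * l \<in> K"
  using a
proof (induction k arbitrary: a)
  case 0
  then show ?case
    using K by (intro bexI[of _ "xmon (expo a)"]) (auto simp: is_ideal_iff intro: expo_Pset)
next
  case (Suc k)
  then obtain x y where xy: "a = (\<lambda>j. x j + y j)" "x \<in> Wset u c k" "y \<in> Pset c" by auto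
  obtain l where l: "l \<in> graded_piece grd u" "xmon (expo x) - s ^ k * l \<in> K" using Suc.IH[OF xy(2)] by blast
  have "l * xmon (expo y) \<in> graded_piece grd (u + c)" by (rule mult_graded_piece[OF l(1) expo_Pset[OF xy(3)]])
  then obtain h where h: "h \<in> graded_piece grd u" "l * xmon (expo y) - s * h \<in> K" using red by blast
  have "xmon (expo a) = xmon (expo x) * xmon (expo y)"
    unfolding xy(1) xmon_mult using Wset_nonneg[OF xy(2)] xy(3) by (subst expo_add) (auto simp: Pset_def)
  then have "xmon (expo a) - s ^ Suc k * h
      = (xmon (expo x) - s ^ k * l) * xmon (expo y) + s ^ k * (l * xmon (expo y) - s * h)"
    unfolding power_Suc by (simp only: telescope[where l = l])
  also have "\<dots> \<in> K"
    by (intro ideal_add[OF K] ideal_mult_right[OF K l(2)] ideal_mult_left[OF K h(2)])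
  finally show ?case using h(1) by blast
qed

lemma HF_eq_imp_subset:
  assumes "is_ideal I" "graded_piece grd w \<inter> I \<subseteq> graded_piece grd w \<inter> J" "HF grd I w = HF grd J w"
  shows "graded_piece grd w \<inter> J \<subseteq> graded_piece grd w \<inter> I"
proof (rule cvec.subset_of_dim_le[OF subspace_ideal_piece[OF assms(1)] assms(2)])
  show "graded_piece grd w \<inter> J \<subseteq> cvec_span (xmon ` {p. mon_deg grd p = w})"
    using graded_piece_span by blast
  show "finite (xmon ` {p. mon_deg grd p = w})" using finite_degree by blast
  show "cvec_dim (graded_piece grd w \<inter> J) \<le> cvec_dim (graded_piece grd w \<inter> I)"
    using assms(3) dim_ideal_le[of w I] dim_ideal_le[of w J] unfolding HF_def by linarith
qed

text \<open>The coefficients of the generic section include the vertex monomials of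
  \<open>c\<close>, one invertible on each chart. By saturation nothing outside \<open>I\<close> is
  killed by all of them, which is the hypothesis of McCoy's theorem. The section may depend on
  \<open>u\<close> and \<open>k\<close>.\<close>

lemma exists_nonzerodivisor_power:
  assumes I: "is_ideal I" "B_saturated \<Sigma> I" and c: "convex_class c"
  obtains s where "s \<in> graded_piece grd c"
    "\<And>l. l \<in> graded_piece grd u \<Longrightarrow> s ^ k * l \<in> I \<Longrightarrow> l \<in> I"
proof -
  obtain P where P: "\<And>i. coeff P i \<in> graded_piece grd c" "\<And>a. mon_deg grd a = c \<Longrightarrow> \<exists>i. coeff P i = xmon a"
    using generic_section_poly by blast
  have nzd: "f \<in> I" if f: "\<And>i. coeff P i * f \<in> I" for f
  proof (rule saturated_vertices[OF I])
    fix \<sigma> assume s: "max_cone \<sigma>"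
    have "vmon \<sigma> c \<in> graded_piece grd c" using c s by (intro vmon_graded) (auto simp: convex_class_def)
    then have "mon_deg grd (expo (vx \<sigma> c)) = c" by (simp add: vmon_def xmon_in_graded_piece)
    then obtain i where "coeff P i = xmon (expo (vx \<sigma> c))" using P(2) by blast
    then have "xmon (expo (vx \<sigma> c)) * f \<in> I" using f[of i] by simp
    then show "\<exists>a. keys a \<inter> \<sigma> = {} \<and> xmon a * f \<in> I" using keys_expo_vx[OF s] by blast
  qed
  have fin: "finite (xmon ` {p. mon_deg grd p = u})" using finite_degree by blast
  obtain E where E: "E \<subseteq> graded_piece grd u" "independent_mod (\<lambda>c p. const c * p) (graded_piece grd u \<inter> I) E"
    "card E + cvec_dim (graded_piece grd u \<inter> I) = cvec_dim (graded_piece grd u)"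
    "\<And>g. g \<in> graded_piece grd u \<Longrightarrow> \<exists>c. g - (\<Sum>e\<in>E. const (c e) * e) \<in> graded_piece grd u \<inter> I"
    by (rule cvec.exists_complement[OF subspace_ideal_piece[OF I(1)] Int_lower1 graded_piece_span fin])
      (rule that, assumption+)
  have sumE: "(\<Sum>e\<in>E. const (c e) * e) \<in> graded_piece grd u" for c
    using E(1) unfolding graded_piece_eq_mspace
    by (intro cvec.subspace_sum[OF cvec_subspace_mspace] cvec.subspace_scale[OF cvec_subspace_mspace]) blast
  have "independent_mod (\<lambda>c p. const c * p) I E"
    using E(2) sumE unfolding independent_mod_def by simp
  then obtain t where t: "\<And>c. poly P (const t) ^ k * (\<Sum>e\<in>E. const (c e) * e) \<in> I \<Longrightarrow> \<forall>e\<in>E. c e = 0"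
    using generic_power_independent[OF I(1), of P E k] nzd by blast
  define s where "s = poly P (const t)"
  have "l \<in> I" if l: "l \<in> graded_piece grd u" "s ^ k * l \<in> I" for l
  proof -
    obtain c where c: "l - (\<Sum>e\<in>E. const (c e) * e) \<in> I" using E(4)[OF l(1)] by blast
    have "s ^ k * (\<Sum>e\<in>E. const (c e) * e) = s ^ k * l - s ^ k * (l - (\<Sum>e\<in>E. const (c e) * e))"
      by (simp add: right_diff_distrib)
    also have "\<dots> \<in> I" by (intro ideal_diff[OF I(1)] l(2) ideal_mult_left[OF I(1) c])
    finally have z: "\<forall>e\<in>E. c e = 0" unfolding s_def by (rule t)
    have "(\<Sum>e\<in>E. const (c e) * e) = 0" by (rule sum.neutral) (simp add: z const_def)
    then show ?thesis using c by simp
  qed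
  moreover have "s \<in> graded_piece grd c" unfolding s_def by (rule poly_in_graded_piece[OF P(1)])
  ultimately show ?thesis using that by blast
qed

lemma saturated_unique:
  assumes u: "convex_class u" and c: "strict_class c"
    and I: "homogeneous_ideal grd I" "B_saturated \<Sigma> I" and J: "homogeneous_ideal grd J"
    and HF: "\<And>w. HF grd I w = HF grd J w" "HF grd I (u + c) \<le> HF grd I u"
    and eq: "graded_piece grd u \<inter> I = graded_piece grd u \<inter> J"
      "graded_piece grd (u + c) \<inter> I = graded_piece grd (u + c) \<inter> J"
  shows "J = I"
proof -
  have idI: "is_ideal I" and idJ: "is_ideal J" using I J by (auto simp: homogeneous_ideal_def)
  have idK: "is_ideal (I \<inter> J)" using idI idJ by (auto simp: is_ideal_iff)
  obtain k1 where k1: "\<And>k. k \<ge> k1 \<Longrightarrow> Pset (u + int k *s c) \<subseteq> Wset u c k"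
    using Pset_eventually_Wset[OF u c] by blast
  have JI: "J \<subseteq> I"
  proof (rule ccontr)
    assume "\<not> J \<subseteq> I"
    then obtain w f where f: "f \<in> J" "f \<in> graded_piece grd w" "f \<notin> I"
      using homogeneous_not_subset[OF J idI] by metis
    obtain k2 where k2: "\<And>k. k \<ge> k2 \<Longrightarrow> convex_class (u - w + int k *s c)"
      using eventually_convex[OF c, of "u - w"] by blast
    \<comment> \<open>Both thresholds are met, and \<open>k\<close> is positive, so that injectivity
      of \<open>s ^ k\<close> in degree \<open>u\<close> implies that of \<open>s\<close>.\<close>
    define k where "k = Suc (max k1 k2)"
    let ?W = "u + int k *s c"
    obtain s where s: "s \<in> graded_piece grd c"
        "\<And>l. l \<in> graded_piece grd u \<Longrightarrow> s ^ k * l \<in> I \<Longrightarrow> l \<in> I"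
      using exists_nonzerodivisor_power[OF idI I(2) strict_convex[OF c], where u = u and k = k] by blast
    have s1: "l \<in> I" if "l \<in> graded_piece grd u" "s * l \<in> I" for l
    proof (rule s(2)[OF that(1)])
      have "s ^ k * l = s ^ max k1 k2 * (s * l)" unfolding k_def power_Suc2 by (rule mult.assoc)
      then show "s ^ k * l \<in> I" using ideal_mult_left[OF idI that(2)] by simp
    qed
    \<comment> \<open>Equal Hilbert functions in degrees \<open>u\<close> and \<open>u + c\<close>
      make multiplication by \<open>s\<close> surjective modulo \<open>I\<close>. The error term has
      degree \<open>u + c\<close>, where membership in \<open>I\<close> and in \<open>J\<close> is
      the same.\<close>
    have red: "\<exists>h\<in>graded_piece grd u. g - s * h \<in> I \<inter> J" if g: "g \<in> graded_piece grd (u + c)" for g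
    proof -
      obtain h where h: "h \<in> graded_piece grd u" "g - s * h \<in> I"
        using HF_mono(2)[OF idI s(1) s1 HF(2) g] by blast
      have "s * h \<in> graded_piece grd (u + c)" using mult_graded_piece[OF s(1) h(1)] by (simp add: add.commute)
      then have "g - s * h \<in> graded_piece grd (u + c)"
        using g cvec.subspace_diff[OF cvec_subspace_mspace] unfolding graded_piece_eq_mspace by blast
      then show ?thesis using h eq(2) by blast
    qed
    have "graded_piece grd ?W \<inter> I \<subseteq> graded_piece grd ?W \<inter> J"
    proof
      fix g assume g: "g \<in> graded_piece grd ?W \<inter> I"
      have "\<exists>l\<in>graded_piece grd u. xmon a - s ^ k * l \<in> I \<inter> J" if a: "a \<in> keys g" for a
      proof -
        have "(\<lambda>i. int (lookup a i)) \<in> Pset ?W" using g a by (intro lookup_Pset) (simp add: graded_piece_def)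
        moreover have "k1 \<le> k" by (simp add: k_def)
        ultimately have "(\<lambda>i. int (lookup a i)) \<in> Wset u c k" using k1 by blast
        from Wset_reduce[OF idK s(1) red this] show ?thesis by (simp add: expo_lookup)
      qed
      then obtain L where L: "\<And>a. a \<in> keys g \<Longrightarrow> L a \<in> graded_piece grd u"
        "\<And>a. a \<in> keys g \<Longrightarrow> xmon a - s ^ k * L a \<in> I \<inter> J" by metis
      define l where "l = (\<Sum>a\<in>keys g. const (lookup g a) * L a)"
      have l: "l \<in> graded_piece grd u"
        using L(1) unfolding graded_piece_eq_mspace l_def
        by (intro cvec.subspace_sum[OF cvec_subspace_mspace] cvec.subspace_scale[OF cvec_subspace_mspace])
      have "s ^ k * l = (\<Sum>a\<in>keys g. const (lookup g a) * (s ^ k * L a))"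
        unfolding l_def sum_distrib_left by (rule sum.cong[OF refl], rule mult.left_commute)
      then have "g - s ^ k * l = (\<Sum>a\<in>keys g. const (lookup g a) * (xmon a - s ^ k * L a))"
        using sum_lookup_xmon[of "keys g" g] by (simp add: right_diff_distrib sum_subtractf)
      also have "\<dots> \<in> I \<inter> J" by (intro ideal_sum[OF idK] ideal_mult_left[OF idK] L(2))
      finally have gl: "g - s ^ k * l \<in> I" "g - s ^ k * l \<in> J" by auto
      \<comment> \<open>Modulo I \<inter> J the element \<open>g\<close> is
        \<open>s ^ k * l\<close>. Cancelling \<open>s ^ k\<close> brings the question down to degree
        \<open>u\<close>, where the two ideals agree.\<close>
      have "g - (g - s ^ k * l) \<in> I" using g gl(1) ideal_diff[OF idI] by blast
      then have "l \<in> I" using s(2)[OF l] by simp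
      then have "l \<in> J" using l eq(1) by blast
      then have "(g - s ^ k * l) + s ^ k * l \<in> J" by (intro ideal_add[OF idJ] gl(2) ideal_mult_left[OF idJ])
      then show "g \<in> graded_piece grd ?W \<inter> J" using g by simp
    qed
    then have WJI: "graded_piece grd ?W \<inter> J \<subseteq> graded_piece grd ?W \<inter> I"
      by (rule HF_eq_imp_subset[OF idI _ HF(1)])
    \<comment> \<open>Vertex monomials carry \<open>f\<close> from degree \<open>w\<close> to the
      degree u + k c, in which \<open>J\<close> is already known to lie in \<open>I\<close>.\<close>
    have "f \<in> I"
    proof (rule saturated_vertices[OF idI I(2)])
      fix \<sigma> assume \<sigma>: "max_cone \<sigma>"
      have "convex_class (u - w + int k *s c)" using k2[of k] by (simp add: k_def)
      then have "vmon \<sigma> (u - w + int k *s c) \<in> graded_piece grd (u - w + int k *s c)"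
        using \<sigma> by (intro vmon_graded) (auto simp: convex_class_def)
      from mult_graded_piece[OF this f(2)]
      have "vmon \<sigma> (u - w + int k *s c) * f \<in> graded_piece grd ?W" by (simp add: algebra_simps)
      moreover have "vmon \<sigma> (u - w + int k *s c) * f \<in> J" by (rule ideal_mult_left[OF idJ f(1)])
      ultimately have "vmon \<sigma> (u - w + int k *s c) * f \<in> I" using WJI by blast
      then show "\<exists>a. keys a \<inter> \<sigma> = {} \<and> xmon a * f \<in> I"
        unfolding vmon_def using keys_expo_vx[OF \<sigma>] by blast
    qed
    then show False using f(3) by blast
  qed
  moreover have "I \<subseteq> J"
  proof (rule ccontr)
    assume "\<not> I \<subseteq> J"
    then obtain w f where f: "f \<in> I" "f \<in> graded_piece grd w" "f \<notin> J"
      using homogeneous_not_subset[OF I(1) idJ] by metis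
    have "graded_piece grd w \<inter> I \<subseteq> graded_piece grd w \<inter> J"
      using JI by (intro HF_eq_imp_subset[OF idJ _ HF(1)[symmetric]]) blast
    then show False using f by blast
  qed
  ultimately show ?thesis by blast
qed

end

text \<open>\<open>Hilb\<close> is itself closed, being cut out by the empty set of
  equations.\<close>

lemma Slip_subset_Hilb: "Slip ray \<Sigma> grd r \<subseteq> Hilb grd r"
proof -
  have "hilb_closed grd r (Hilb grd r)" unfolding hilb_closed_def by (rule exI[of _ "{}"]) simp
  moreover have "point_ideals ray \<Sigma> grd r \<subseteq> Hilb grd r" by (auto simp: point_ideals_def)
  ultimately show ?thesis unfolding Slip_def by (intro Inter_lower) simp
qed

theorem theorem6p2:
  fixes ray :: "'n::finite \<Rightarrow> int^'d"
    and \<Sigma> :: "'n set set"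
    and grd :: "'n \<Rightarrow> int^'s"
    and v u :: "int^'s"
    and C :: "(int^'s) set"
    and F :: "'n cpoly"
    and r :: nat
    and I :: "'n cpoly set"
  assumes "smooth_complete_fan ray \<Sigma>"
    and "picard_grading ray grd"
    and "ample ray \<Sigma> grd v"
    and "F \<in> graded_piece grd v" and "F \<noteq> 0"
    and "r = border_rank \<Sigma> grd v F"
    and "minimal_generating_set C (nef_semigroup ray \<Sigma> grd)"
    and "u \<in> nef_semigroup ray \<Sigma> grd"
    and "HF grd (Ann F) u = r"
    and "HF grd (Ann F) (u + (\<Sum>c\<in>C. c)) = r"
    and "I \<in> border_VSP ray \<Sigma> grd F r"
    and "B_saturated \<Sigma> I"
  shows "border_VSP ray \<Sigma> grd F r = {I}"
proof -
  interpret toric ray \<Sigma> grd using assms(1,2) by (rule toric.intro)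
  let ?c = "\<Sum>c\<in>C. c"
  have c: "strict_class ?c" by (rule generating_set_strict[OF assms(3,7)])
  have u: "convex_class u" using assms(8) nef_convex[OF assms(3)] by (simp add: nef_semigroup_def)
  have Hilb: "homogeneous_ideal grd J" "\<And>w. HF grd J w = generic_HF grd r w" "J \<subseteq> Ann F"
    if "J \<in> border_VSP ray \<Sigma> grd F r" for J
    using that Slip_subset_Hilb[of ray \<Sigma> grd r] by (auto simp: border_VSP_def Hilb_def)
  have Ann: "graded_piece grd w \<inter> J = graded_piece grd w \<inter> Ann F" "HF grd J w = r"
    if J: "J \<in> border_VSP ray \<Sigma> grd F r" and w: "HF grd (Ann F) w = r" for J w
  proof -
    have id: "is_ideal J" using Hilb(1)[OF J] by (simp add: homogeneous_ideal_def)
    \<comment> \<open>The value \<open>r\<close> of \<open>HF\<close> forces the graded piece to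
      have dimension at least \<open>r\<close>, so the minimum in \<open>generic_HF\<close> is
      \<open>r\<close>. Then \<open>J\<close> and \<open>Ann F\<close> have equal dimension in this
      degree, and the inclusion is an equality.\<close>
    have "r \<le> cvec_dim (graded_piece grd w)" using w by (auto simp: HF_def)
    then show r: "HF grd J w = r" using Hilb(2)[OF J, of w] by (simp add: generic_HF_def)
    have "graded_piece grd w \<inter> J \<subseteq> graded_piece grd w \<inter> Ann F" using Hilb(3)[OF J] by blast
    moreover from HF_eq_imp_subset[OF id this] r w
    have "graded_piece grd w \<inter> Ann F \<subseteq> graded_piece grd w \<inter> J" by simp
    ultimately show "graded_piece grd w \<inter> J = graded_piece grd w \<inter> Ann F" by (rule equalityI)
  qed
  have "J = I" if J: "J \<in> border_VSP ray \<Sigma> grd F r" for J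
  proof (rule saturated_unique[OF u c Hilb(1)[OF assms(11)] assms(12) Hilb(1)[OF J]])
    show "HF grd I w = HF grd J w" for w using Hilb(2)[OF J] Hilb(2)[OF assms(11)] by simp
    show "HF grd I (u + ?c) \<le> HF grd I u"
      using Ann(2)[OF assms(11,9)] Ann(2)[OF assms(11,10)] by simp
    show "graded_piece grd u \<inter> I = graded_piece grd u \<inter> J"
      using Ann(1)[OF assms(11,9)] Ann(1)[OF J assms(9)] by simp
    show "graded_piece grd (u + ?c) \<inter> I = graded_piece grd (u + ?c) \<inter> J"
      using Ann(1)[OF assms(11,10)] Ann(1)[OF J assms(10)] by simp
  qed
  then show ?thesis using assms(11) by blast
qed

end
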